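(* Let $\gamma$ be a hyperbolic orientation-preserving isometry of $\mathbb H^2$ of length $\ell>0$, and let $\mathfrak Z=\{\gamma^n:n\in\mathbb Z\}$ be the group it generates. Let $h$ be a complex-valued function such that, for some $\sigma>1/2$: (a) $h$ is analytic for $|\mathrm{Im}\,\rho|\le\sigma$; (b) $h(-\rho)=h(\rho)$; (c) there are $\delta>0$ and $C>0$ such that $|h(\rho)|\le C(1+|\mathrm{Re}\,\rho|)^{-2-\delta}$ for all $\rho$ in the strip $|\mathrm{Im}\,\rho|\le\sigma$. Let $k(z,w)$ be the point-pair invariant associated with $h$ and $k_{\mathfrak Z}(z,w)=\sum_{n\in\mathbb Z}k(\gamma^nz,w)$. Then $$\int_{\mathfrak Z\backslash\mathbb H^2}\bigl[k_{\mathfrak Z}(z,z)-k(z,z)\bigr]\,d\mu=\int_{\mathbb R}h(\rho)\,n_{\mathfrak Z}(\rho)\,d\rho,$$ where $$n_{\mathfrak Z}(\rho)=\frac{\ell}{\pi}\sum_{m=0}^\infty\left\{\exp\left[\left(m+\tfrac12+i\rho\right)\ell\right]-1\right\}^{-1}$$ is a meromorphic function in $\mathbb C$ with simple poles at the points $$\rho_{\nu m}=\frac{2\pi\nu}{\ell}+i\left(m+\tfrac12\right),\qquad\nu\in\mathbb Z,\quad m=0,1,2,\dots,$$ and residues $\mathrm{res}_{\rho_{\nu m}}n_{\mathfrak Z}=1/(\pi i)$.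
   Context: $\mathbb H^2$ is the hyperbolic plane of curvature $-1$ with distance $d$ and area measure $d\mu$ ($d\mu=dx\,dy/y^2$ in the half-plane model). The length of an isometry $\gamma$ is $\ell(\gamma)=\inf_{z\in\mathbb H^2}d(\gamma z,z)$; an orientation-preserving isometry is hyperbolic if its length is positive. The integral over $\mathfrak Z\backslash\mathbb H^2$ is the integral over any fundamental domain of $\mathfrak Z$ in $\mathbb H^2$. The point-pair invariant is $k(z,w)=\frac1{\pi i}\int_{-\infty}^\infty G_\rho(z,w)\,\rho\,h(\rho)\,d\rho$, where $G_\rho(z,w)=-\frac1{2\pi}Q_{-\frac12+i\rho}(\cosh d(z,w))$ and $Q_{-\frac12+i\rho}(\cosh\tau)=\frac1{\sqrt2}\int_\tau^\infty\frac{e^{-i\rho t}}{\sqrt{\cosh t-\cosh\tau}}\,dt$ is the Legendre function of the second kind. Equivalently (and also for $z=w$), with $g(t)=\frac1{2\pi}\int_{\mathbb R}h(\rho)e^{-i\rho t}d\rho$ and $\tau=d(z,w)$, $k(z,w)=-\frac1{\pi\sqrt2}\int_\tau^\infty\frac{g'(t)}{\sqrt{\cosh t-\cosh\tau}}\,dt$. *)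

theory Defs
  imports "HOL-Complex_Analysis.Complex_Analysis" "HOL-Algebra.Bij"
begin

text \<open>The upper half-plane model of the hyperbolic plane of curvature -1.\<close>

definition hplane :: "complex set" where
  "hplane = {z. Im z > 0}"

definition hdist :: "complex \<Rightarrow> complex \<Rightarrow> real" where
  "hdist z w = arcosh (1 + (cmod (z - w))\<^sup>2 / (2 * Im z * Im w))"

definition harea :: "complex measure" where
  "harea = density (restrict_space lborel hplane) (\<lambda>z. ennreal (1 / (Im z)\<^sup>2))"

text \<open>An isometry is an element of \<^term>\<open>Bij hplane\<close>, i.e. a bijection of the half-plane that is
  \<^const>\<open>undefined\<close> elsewhere, so that equal isometries are equal as functions and compositions
  and powers may be taken in \<^term>\<open>BijGroup hplane\<close>.\<close>

definition hisometry :: "(complex \<Rightarrow> complex) \<Rightarrow> bool" where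
  "hisometry \<gamma> \<longleftrightarrow> \<gamma> \<in> Bij hplane \<and>
     (\<forall>z\<in>hplane. \<forall>w\<in>hplane. hdist (\<gamma> z) (\<gamma> w) = hdist z w)"

text \<open>The real differential is required to have positive determinant; its matrix in the basis
  \<open>1, \<i>\<close> has the columns \<open>(Re (D 1), Im (D 1))\<close> and \<open>(Re (D \<i>), Im (D \<i>))\<close>.\<close>

definition orientation_preserving :: "(complex \<Rightarrow> complex) \<Rightarrow> bool" where
  "orientation_preserving \<gamma> \<longleftrightarrow>
     (\<forall>z\<in>hplane. \<exists>D. (\<gamma> has_derivative D) (at z) \<and>
        Re (D 1) * Im (D \<i>) - Im (D 1) * Re (D \<i>) > 0)"

definition hlength :: "(complex \<Rightarrow> complex) \<Rightarrow> real" where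
  "hlength \<gamma> = (INF z\<in>hplane. hdist (\<gamma> z) z)"

definition hyperbolic :: "(complex \<Rightarrow> complex) \<Rightarrow> bool" where
  "hyperbolic \<gamma> \<longleftrightarrow> hisometry \<gamma> \<and> orientation_preserving \<gamma> \<and> hlength \<gamma> > 0"

definition isom_power :: "(complex \<Rightarrow> complex) \<Rightarrow> int \<Rightarrow> complex \<Rightarrow> complex" where
  "isom_power \<gamma> n = \<gamma> [^]\<^bsub>BijGroup hplane\<^esub> n"

definition cyclic_isoms :: "(complex \<Rightarrow> complex) \<Rightarrow> (complex \<Rightarrow> complex) set" where
  "cyclic_isoms \<gamma> = range (isom_power \<gamma>)"

text \<open>Fundamental domains are understood in the measure-theoretic sense: the translates cover the
  plane and do not overlap, both up to sets of area zero.\<close>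

definition fundamental_domain :: "(complex \<Rightarrow> complex) set \<Rightarrow> complex set \<Rightarrow> bool" where
  "fundamental_domain \<Gamma> F \<longleftrightarrow> F \<in> sets harea \<and>
     (AE z in harea. z \<in> (\<Union>g\<in>\<Gamma>. g ` F)) \<and>
     (\<forall>g\<in>\<Gamma>. \<forall>g'\<in>\<Gamma>. g \<noteq> g' \<longrightarrow> g ` F \<inter> g' ` F \<in> null_sets harea)"

text \<open>The integral of \<open>f\<close> over the quotient of the plane by \<open>\<Gamma>\<close> converges absolutely and equals \<open>I\<close>:
  there is a fundamental domain, and every choice of it gives the value \<open>I\<close>.\<close>

definition has_quotient_integral ::
  "(complex \<Rightarrow> complex) set \<Rightarrow> (complex \<Rightarrow> complex) \<Rightarrow> complex \<Rightarrow> bool" where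
  "has_quotient_integral \<Gamma> f I \<longleftrightarrow> (\<exists>F. fundamental_domain \<Gamma> F) \<and>
     (\<forall>F. fundamental_domain \<Gamma> F \<longrightarrow>
        set_integrable harea F f \<and> set_lebesgue_integral harea F f = I)"

text \<open>\<open>legendre_Q \<rho> \<tau>\<close> is the Legendre function of the second kind of degree \<open>-1/2 + \<i> \<rho>\<close> at
  \<open>cosh \<tau>\<close>, for \<open>\<tau> > 0\<close>.\<close>

definition legendre_Q :: "real \<Rightarrow> real \<Rightarrow> complex" where
  "legendre_Q \<rho> \<tau> = 1 / sqrt 2 *
     (LBINT t:{\<tau><..}. exp (- \<i> * \<rho> * t) / sqrt (cosh t - cosh \<tau>))"

definition green :: "real \<Rightarrow> complex \<Rightarrow> complex \<Rightarrow> complex" where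
  "green \<rho> z w = - 1 / (2 * pi) * legendre_Q \<rho> (hdist z w)"

definition fourier_g :: "(complex \<Rightarrow> complex) \<Rightarrow> real \<Rightarrow> complex" where
  "fourier_g h t = 1 / (2 * pi) * (LBINT \<rho>. h (complex_of_real \<rho>) * exp (- \<i> * \<rho> * t))"

text \<open>The Legendre function has a logarithmic singularity at \<open>\<tau> = 0\<close>, so on the diagonal the
  point-pair invariant is given by the formula in terms of \<open>g'\<close>, which extends it continuously.\<close>

definition point_pair :: "(complex \<Rightarrow> complex) \<Rightarrow> complex \<Rightarrow> complex \<Rightarrow> complex" where
  "point_pair h z w =
     (if z \<noteq> w
      then 1 / (pi * \<i>) * (LBINT \<rho>. green \<rho> z w * complex_of_real \<rho> * h (complex_of_real \<rho>))
      else - 1 / (pi * sqrt 2) *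
             (LBINT t:{0<..}. vector_derivative (fourier_g h) (at t) / sqrt (cosh t - cosh 0)))"

definition point_pair_cyclic ::
  "(complex \<Rightarrow> complex) \<Rightarrow> (complex \<Rightarrow> complex) \<Rightarrow> complex \<Rightarrow> complex \<Rightarrow> complex" where
  "point_pair_cyclic \<gamma> h z w = (\<Sum>\<^sub>\<infinity>n. point_pair h (isom_power \<gamma> n z) w)"

definition nZ_term :: "real \<Rightarrow> complex \<Rightarrow> nat \<Rightarrow> complex" where
  "nZ_term l \<rho> m = inverse (exp ((of_nat m + 1 / 2 + \<i> * \<rho>) * complex_of_real l) - 1)"

definition nZ :: "real \<Rightarrow> complex \<Rightarrow> complex" where
  "nZ l \<rho> = complex_of_real (l / pi) * (\<Sum>m. nZ_term l \<rho> m)"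

definition nZ_pole :: "real \<Rightarrow> int \<Rightarrow> nat \<Rightarrow> complex" where
  "nZ_pole l \<nu> m = complex_of_real (2 * pi * of_int \<nu> / l) + \<i> * (of_nat m + 1 / 2)"

end

theory Submission
  imports Defs
begin

text \<open>
  An orientation-preserving isometry is a real Moebius transformation, and one whose displacement is
  bounded below by a positive constant is conjugate to \<open>z \<mapsto> e\<^sup>l z\<close>. For \<open>z = e\<^sup>s (u + \<i>)\<close> in the conjugated
  picture one has \<open>cosh d(\<gamma>\<^sup>n z, z) = cosh (n l) + 2 sinh\<^sup>2 (n l / 2) u\<^sup>2\<close> and \<open>d\<mu> = du ds\<close>, so that the
  integral over the quotient is \<open>l\<close> times the integral over \<open>u\<close>. Inserting
  \<open>k(\<tau>) = - 1 / (\<pi> sqrt 2) \<integral> g'(t) / sqrt (cosh t - cosh \<tau>) dt\<close>, taken over \<open>t > \<tau>\<close>, and exchanging the two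
  integrals leaves an arcsine integral, and \<open>\<gamma>\<^sup>n\<close> contributes \<open>l g(n l) / (2 sinh (n l / 2))\<close> for \<open>n > 0\<close>, and
  the same for \<open>- n\<close>. On the other side, expanding \<open>n\<^sub>Z\<close> into geometric series and summing over \<open>m\<close> first
  gives \<open>(l / \<pi>) \<Sum> exp (- \<i> n l \<rho>) / (2 sinh (n l / 2))\<close>, summed over \<open>n \<ge> 1\<close>, for real \<open>\<rho>\<close>.
  Absolute convergence rests on the exponential
  decay of \<open>g'\<close>, obtained by shifting the line of integration into the strip of analyticity.
  The diagonal value of \<open>k\<close> cancels and is never needed.
\<close>

section \<open>Isometries as Moebius transformations\<close>

text \<open>The quotient integral must have the same value for every measurable fundamental domain,
  so computing it on a convenient one is not enough. The area is therefore shown to be invariant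
  under all real Moebius transformations, and an arbitrary domain is compared with a standard one
  piece by piece. Since the integrand depends on \<open>u\<close> alone, everything then reduces to
  the push-forward of the area under \<open>u\<close>. Off the diagonal the point-pair invariant is
  defined through Green functions, and \<open>g'\<close> itself is never formed: its role is played
  by the Fourier transform of \<open>\<rho> * h \<rho>\<close>, which is
  \<open>2 * \<pi> * \<i>\<close> times \<open>g'\<close>. On the real line
  \<open>exp (- \<i> * \<rho> * t)\<close> is not integrable over \<open>t > a\<close>; moving the
  line into the lower half of the strip supplies both the decay in \<open>t\<close> and the
  evaluation of the integral over \<open>t > a\<close>. The two sides meet because the arcsine
  integral does not depend on \<open>t\<close>: what remains is an integral over
  \<open>t > n * l\<close>, that is, the Fourier transform of \<open>h\<close> sampled at
  \<open>n * l\<close>, and these samples are what the expansion of \<open>nZ\<close>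
  produces.\<close>

definition mob :: "real \<Rightarrow> real \<Rightarrow> real \<Rightarrow> real \<Rightarrow> complex \<Rightarrow> complex" where
  "mob a b c d z = (of_real a * z + of_real b) / (of_real c * z + of_real d)"

lemma cosh_hdist:
  assumes "z \<in> hplane" "w \<in> hplane"
  shows "cosh (hdist z w) = 1 + (cmod (z - w))\<^sup>2 / (2 * Im z * Im w)"
  using assms unfolding hdist_def hplane_def by (intro cosh_arcosh_real) auto

lemma hdist_nonneg:
  assumes "z \<in> hplane" "w \<in> hplane"
  shows "hdist z w \<ge> 0"
  using assms unfolding hdist_def hplane_def by (intro arcosh_nonneg_real) auto

lemma hdist_eqI:
  assumes "(cmod (z - w))\<^sup>2 / (Im z * Im w) = (cmod (z' - w'))\<^sup>2 / (Im z' * Im w')"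
  shows "hdist z w = hdist z' w'"
proof -
  have "(cmod (z - w))\<^sup>2 / (2 * Im z * Im w) = (cmod (z' - w'))\<^sup>2 / (2 * Im z' * Im w')"
    using arg_cong[OF assms, of "\<lambda>x. x / 2"] by (simp add: mult.commute mult.left_commute)
  then show ?thesis by (simp add: hdist_def)
qed

lemma hdist_eqD:
  assumes "z \<in> hplane" "w \<in> hplane" "z' \<in> hplane" "w' \<in> hplane" "hdist z w = hdist z' w'"
  shows "(cmod (z - w))\<^sup>2 / (Im z * Im w) = (cmod (z' - w'))\<^sup>2 / (Im z' * Im w')"
proof -
  have "(cmod (z - w))\<^sup>2 / (2 * Im z * Im w) = (cmod (z' - w'))\<^sup>2 / (2 * Im z' * Im w')"
    using cosh_hdist[of z w] cosh_hdist[of z' w'] assms by simp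
  from arg_cong[OF this, of "\<lambda>x. x * 2"] show ?thesis by (simp add: field_simps)
qed

lemma mob_denominator:
  assumes "a * d - b * c = 1" "z \<in> hplane"
  shows "of_real c * z + of_real d \<noteq> 0"
proof
  assume "of_real c * z + of_real d = 0"
  then have "c * Im z = 0" "c * Re z + d = 0" by (auto simp: complex_eq_iff)
  then show False using assms by (auto simp: hplane_def)
qed

lemma Im_mob:
  assumes "a * d - b * c = 1" "z \<in> hplane"
  shows "Im (mob a b c d z) = Im z / (cmod (of_real c * z + of_real d))\<^sup>2"
proof -
  have "Im (mob a b c d z) = (a * d - b * c) * Im z / (cmod (of_real c * z + of_real d))\<^sup>2"
    unfolding mob_def cmod_power2 by (simp add: Im_divide power2_eq_square algebra_simps)
  then show ?thesis using assms by simp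
qed

lemma mob_in_hplane:
  assumes "a * d - b * c = 1" "z \<in> hplane"
  shows "mob a b c d z \<in> hplane"
  using Im_mob[OF assms] mob_denominator[OF assms] assms(2) by (simp add: hplane_def)

text \<open>Both denominators reappear squared in \<open>Im_mob\<close>, so they cancel in the
  quotient of the squared \<open>cmod (z - w)\<close> by \<open>Im z * Im w\<close>, through which
  alone \<open>hdist\<close> depends on its arguments.\<close>

lemma mob_diff:
  assumes "a * d - b * c = 1" "z \<in> hplane" "w \<in> hplane"
  shows "mob a b c d z - mob a b c d w =
    (z - w) / ((of_real c * z + of_real d) * (of_real c * w + of_real d))"
proof -
  have "mob a b c d z - mob a b c d w = of_real (a * d - b * c) * (z - w) /
      ((of_real c * z + of_real d) * (of_real c * w + of_real d))"
    unfolding mob_def using mob_denominator[OF assms(1,2)] mob_denominator[OF assms(1,3)]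
    by (simp add: diff_frac_eq) (simp add: algebra_simps)
  then show ?thesis using assms(1) by simp
qed

lemma hdist_mob:
  assumes "a * d - b * c = 1" "z \<in> hplane" "w \<in> hplane"
  shows "hdist (mob a b c d z) (mob a b c d w) = hdist z w"
proof (rule hdist_eqI)
  show "(cmod (mob a b c d z - mob a b c d w))\<^sup>2 / (Im (mob a b c d z) * Im (mob a b c d w)) =
      (cmod (z - w))\<^sup>2 / (Im z * Im w)"
    using mob_denominator[OF assms(1,2)] mob_denominator[OF assms(1,3)]
    by (simp add: mob_diff[OF assms] Im_mob assms norm_divide norm_mult power_divide power_mult_distrib)
qed

lemma mob_mob:
  assumes "a' * d' - b' * c' = 1" "a * d - b * c = 1" "z \<in> hplane"
  shows "mob a' b' c' d' (mob a b c d z) =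
    mob (a' * a + b' * c) (a' * b + b' * d) (c' * a + d' * c) (c' * b + d' * d) z"
proof -
  let ?w = "of_real c * z + of_real d :: complex"
  have w: "?w \<noteq> 0" by (rule mob_denominator[OF assms(2,3)])
  have "mob a' b' c' d' (mob a b c d z) =
    ((of_real a' * mob a b c d z + of_real b') * ?w) / ((of_real c' * mob a b c d z + of_real d') * ?w)"
    using w by (simp add: mob_def[of a' b' c' d'])
  also have "(of_real a' * mob a b c d z + of_real b') * ?w =
      of_real (a' * a + b' * c) * z + of_real (a' * b + b' * d)"
    using w by (simp add: mob_def[of a b c d] field_simps)
  also have "(of_real c' * mob a b c d z + of_real d') * ?w =
      of_real (c' * a + d' * c) * z + of_real (c' * b + d' * d)"
    using w by (simp add: mob_def[of a b c d] field_simps)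
  finally show ?thesis by (simp add: mob_def)
qed

text \<open>Agreement is required on the half-plane only, because elements of
  \<open>Bij hplane\<close> are \<open>undefined\<close> elsewhere. Hiding the coefficients allows
  maps to be composed and inverted without tracking matrices.\<close>

definition real_moebius :: "(complex \<Rightarrow> complex) \<Rightarrow> bool" where
  "real_moebius f \<longleftrightarrow> (\<exists>a b c d. a * d - b * c = 1 \<and> (\<forall>z\<in>hplane. f z = mob a b c d z))"

lemma real_moebius_mob: "a * d - b * c = 1 \<Longrightarrow> real_moebius (mob a b c d)"
  by (auto simp: real_moebius_def)

lemma real_moebius_in: "real_moebius f \<Longrightarrow> z \<in> hplane \<Longrightarrow> f z \<in> hplane"
  by (auto simp: real_moebius_def mob_in_hplane)

lemma real_moebius_hdist:
  "real_moebius f \<Longrightarrow> z \<in> hplane \<Longrightarrow> w \<in> hplane \<Longrightarrow> hdist (f z) (f w) = hdist z w"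
  by (auto simp: real_moebius_def hdist_mob)

lemma real_moebius_comp:
  assumes "real_moebius f" "real_moebius g"
  shows "real_moebius (\<lambda>z. f (g z))"
proof -
  obtain a b c d where f: "a * d - b * c = 1" "\<And>z. z\<in>hplane \<Longrightarrow> f z = mob a b c d z"
    using assms(1) by (auto simp: real_moebius_def)
  obtain a' b' c' d' where g: "a' * d' - b' * c' = 1" "\<And>z. z\<in>hplane \<Longrightarrow> g z = mob a' b' c' d' z"
    using assms(2) by (auto simp: real_moebius_def)
  have "(a * a' + b * c') * (c * b' + d * d') - (a * b' + b * d') * (c * a' + d * c') =
     (a * d - b * c) * (a' * d' - b' * c')" by algebra
  then show ?thesis using f g
    unfolding real_moebius_def by (metis mob_in_hplane mob_mob mult_1)
qed

lemma real_moebius_inverse: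
  assumes "real_moebius f"
  obtains g where "real_moebius g" "\<And>z. z \<in> hplane \<Longrightarrow> g (f z) = z" "\<And>z. z \<in> hplane \<Longrightarrow> f (g z) = z"
proof -
  obtain a b c d where f: "a * d - b * c = 1" "\<And>z. z\<in>hplane \<Longrightarrow> f z = mob a b c d z"
    using assms(1) by (auto simp: real_moebius_def)
  have f': "d * a - (-b) * (-c) = 1" using f(1) by (simp add: mult.commute)
  have id: "mob 1 0 0 1 z = z" for z by (simp add: mob_def)
  have e: "d * a + - b * c = 1" "d * b + - b * d = 0" "- c * a + a * c = 0" "- c * b + a * d = 1"
    "a * d + b * - c = 1" "a * - b + b * a = 0" "c * d + d * - c = 0" "c * - b + d * a = 1"
    using f(1) by (auto simp: algebra_simps)
  show ?thesis
  proof
    show "real_moebius (mob d (-b) (-c) a)" using f' by (rule real_moebius_mob)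
    fix z assume z: "z \<in> hplane"
    show "mob d (-b) (-c) a (f z) = z"
      using mob_mob[OF f' f(1) z] f(2)[OF z] unfolding e by (simp add: id)
    show "f (mob d (-b) (-c) a z) = z"
      using mob_mob[OF f(1) f' z] f(2)[OF mob_in_hplane[OF f' z]] unfolding e by (simp add: id)
  qed
qed

lemma real_moebius_affine:
  assumes "a > 0" shows "real_moebius (\<lambda>z. of_real a * z + of_real b)"
proof -
  have "sqrt a * (1 / sqrt a) - (b / sqrt a) * 0 = 1" using assms by simp
  moreover have "of_real a * z + of_real b = mob (sqrt a) (b / sqrt a) 0 (1 / sqrt a) z" for z
  proof -
    have "of_real a = (of_real (sqrt a) * of_real (sqrt a) :: complex)"
      using assms by (metis of_real_mult real_sqrt_mult_self abs_of_pos)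
    moreover have "(of_real (sqrt a) :: complex) \<noteq> 0" using assms by simp
    ultimately show ?thesis by (simp add: mob_def field_simps)
  qed
  ultimately show ?thesis unfolding real_moebius_def by metis
qed

lemma real_moebius_inversion: "real_moebius (\<lambda>z. - 1 / (z - of_real p))"
  unfolding real_moebius_def
  by (intro exI[of _ 0] exI[of _ "-1"] exI[of _ 1] exI[of _ "-p"]) (simp add: mob_def)

lemma real_moebius_cong: "real_moebius f \<Longrightarrow> (\<And>z. z \<in> hplane \<Longrightarrow> g z = f z) \<Longrightarrow> real_moebius g"
  by (auto simp: real_moebius_def)

section \<open>Rigidity of isometries and the role of orientation\<close>

lemma isometry_fixing_vertical:
  assumes maps: "\<And>z. z \<in> hplane \<Longrightarrow> f z \<in> hplane"
    and iso: "\<And>z w. z \<in> hplane \<Longrightarrow> w \<in> hplane \<Longrightarrow> hdist (f z) (f w) = hdist z w"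
    and fix1: "f \<i> = \<i>" and fix2: "f (2 * \<i>) = 2 * \<i>"
  shows "(\<forall>z\<in>hplane. f z = z) \<or> (\<forall>z\<in>hplane. f z = - cnj z)"
proof -
  have I: "\<i> \<in> hplane" "2 * \<i> \<in> hplane" by (auto simp: hplane_def)
  have q: "(cmod (f z - f w))\<^sup>2 / (Im (f z) * Im (f w)) = (cmod (z - w))\<^sup>2 / (Im z * Im w)"
    if "z \<in> hplane" "w \<in> hplane" for z w
    using that by (intro hdist_eqD iso maps)
  have cases: "Im (f z) = Im z \<and> (f z = z \<or> f z = - cnj z)" if z: "z \<in> hplane" for z
  proof -
    define X Y x y where d: "X = Re (f z)" "Y = Im (f z)" "x = Re z" "y = Im z"
    have pos: "Y > 0" "y > 0" using z maps[OF z] by (auto simp: d hplane_def)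
    have "(X\<^sup>2 + (Y - 1)\<^sup>2) / Y = (x\<^sup>2 + (y - 1)\<^sup>2) / y"
      using q[OF z I(1)] by (simp add: fix1 cmod_power2 d)
    then have e1: "(X\<^sup>2 + (Y - 1)\<^sup>2) * y = (x\<^sup>2 + (y - 1)\<^sup>2) * Y" using pos by (simp add: field_simps)
    have "(X\<^sup>2 + (Y - 2)\<^sup>2) / (Y * 2) = (x\<^sup>2 + (y - 2)\<^sup>2) / (y * 2)"
      using q[OF z I(2)] by (simp add: fix2 cmod_power2 d)
    then have e2: "(X\<^sup>2 + (Y - 2)\<^sup>2) * y = (x\<^sup>2 + (y - 2)\<^sup>2) * Y" using pos by (simp add: field_simps)
    \<comment> \<open>Subtracting \<open>e2\<close> from \<open>e1\<close> cancels all squares and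
      leaves \<open>(2 * Y - 3) * y = (2 * y - 3) * Y\<close>.\<close>
    have Yy: "Y = y" using e1 e2 by (simp add: power2_eq_square algebra_simps)
    with e1 pos have "X\<^sup>2 = x\<^sup>2" by simp
    then have "X = x \<or> X = - x" by (simp add: power2_eq_iff)
    then show ?thesis using Yy by (auto simp: d complex_eq_iff)
  qed
  \<comment> \<open>So far the choice between \<open>z\<close> and \<open>- cnj z\<close> may vary
    with \<open>z\<close>. One point off the imaginary axis settles it: the Euclidean distances from
    \<open>z\<close> to \<open>p\<close> and to the mirror image of \<open>p\<close> agree only if
    \<open>Re z = 0\<close>, where the two choices coincide.\<close>
  define p where "p = Complex 1 1"
  have p: "p \<in> hplane" by (simp add: hplane_def p_def)
  have *: "(cmod (f z - f p))\<^sup>2 = (cmod (z - p))\<^sup>2" if z: "z \<in> hplane" for z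
  proof -
    have "Im (f z) = Im z" "Im (f p) = Im p" using cases[OF z] cases[OF p] by blast+
    moreover have "Im z * Im p \<noteq> 0" using z p by (simp add: hplane_def)
    ultimately show ?thesis using q[OF z p] by simp
  qed
  show ?thesis
  proof (cases "f p = p")
    case True
    have "f z = z" if z: "z \<in> hplane" for z
    proof (rule ccontr)
      assume "f z \<noteq> z"
      then have fz: "f z = - cnj z" using cases[OF z] by blast
      have "(- Re z - 1)\<^sup>2 = (Re z - 1)\<^sup>2"
        using *[OF z] unfolding True fz by (simp add: cmod_power2 p_def)
      then have "Re z = 0" by (simp add: power2_eq_square algebra_simps)
      with fz \<open>f z \<noteq> z\<close> show False by (simp add: complex_eq_iff)
    qed
    then show ?thesis by blast
  next
    case False
    then have fp: "f p = - cnj p" using cases[OF p] by blast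
    have "f z = - cnj z" if z: "z \<in> hplane" for z
    proof (rule ccontr)
      assume "f z \<noteq> - cnj z"
      then have fz: "f z = z" using cases[OF z] by blast
      have "(Re z + 1)\<^sup>2 = (Re z - 1)\<^sup>2"
        using *[OF z] unfolding fp fz by (simp add: cmod_power2 p_def)
      then have "Re z = 0" by (simp add: power2_eq_square algebra_simps)
      with fz \<open>f z \<noteq> - cnj z\<close> show False by (simp add: complex_eq_iff)
    qed
    then show ?thesis by blast
  qed
qed

text \<open>An affine map takes \<open>p\<close> to \<open>\<i>\<close>, and a rotation about
  \<open>\<i>\<close> brings the image of \<open>q\<close> to the imaginary axis. The prescribed
  distance leaves two positions there, exchanged by \<open>- 1 / z\<close>, which fixes
  \<open>\<i>\<close>.\<close>

lemma real_moebius_to_vertical: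
  assumes p: "p \<in> hplane" and q: "q \<in> hplane" and pq: "hdist p q = hdist \<i> (2 * \<i>)"
  obtains A where "real_moebius A" "A p = \<i>" "A q = 2 * \<i>"
proof -
  have I: "\<i> \<in> hplane" "2 * \<i> \<in> hplane" by (auto simp: hplane_def)
  define A0 where "A0 = (\<lambda>z. complex_of_real (1 / Im p) * z + complex_of_real (- Re p / Im p))"
  have A0: "real_moebius A0" unfolding A0_def using p by (intro real_moebius_affine) (simp add: hplane_def)
  have A0p: "A0 p = \<i>" using p by (simp add: A0_def hplane_def complex_eq_iff)
  define q' where "q' = A0 q"
  have q': "q' \<in> hplane" unfolding q'_def by (rule real_moebius_in[OF A0 q])
  \<comment> \<open>\<open>Re (R q')\<close> is a real multiple of \<open>cos (2 * \<phi>) * (2 * Re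
    q') - sin (2 * \<phi>) * ((cmod q')^2 - 1)\<close>. It vanishes when the vector with coordinates
    \<open>(cmod q')^2 - 1\<close> and \<open>2 * Re q'\<close> has direction
    \<open>2 * \<phi>\<close>, hence the half of its argument.\<close>
  define \<phi> where "\<phi> = Arg (Complex ((cmod q')\<^sup>2 - 1) (2 * Re q')) / 2"
  define r where "r = cmod (Complex ((cmod q')\<^sup>2 - 1) (2 * Re q'))"
  have "Complex ((cmod q')\<^sup>2 - 1) (2 * Re q') = rcis r (2 * \<phi>)"
    unfolding r_def \<phi>_def by (simp add: rcis_cmod_Arg)
  then have rc: "(cmod q')\<^sup>2 - 1 = r * cos (2 * \<phi>)" "2 * Re q' = r * sin (2 * \<phi>)"
    by (auto simp: complex_eq_iff)
  define R where "R = mob (cos \<phi>) (sin \<phi>) (- sin \<phi>) (cos \<phi>)"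
  have det: "cos \<phi> * cos \<phi> - sin \<phi> * (- sin \<phi>) = 1"
    using sin_cos_squared_add[of \<phi>] by (simp add: power2_eq_square)
  have R: "real_moebius R" unfolding R_def using det by (rule real_moebius_mob)
  have Ri: "R \<i> = \<i>"
    using mob_denominator[OF det I(1)] unfolding R_def mob_def
    by (simp add: divide_eq_eq algebra_simps)
  have "Re (R q') = 0"
  proof -
    have "Re ((cos \<phi> * q' + sin \<phi>) * cnj (- sin \<phi> * q' + cos \<phi>)) =
      sin \<phi> * cos \<phi> * (1 - (cmod q')\<^sup>2) + ((cos \<phi>)\<^sup>2 - (sin \<phi>)\<^sup>2) * Re q'"
      unfolding cmod_power2 by (simp add: power2_eq_square algebra_simps)
    also have "\<dots> = (cos (2 * \<phi>) * (2 * Re q') - sin (2 * \<phi>) * ((cmod q')\<^sup>2 - 1)) / 2"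
      unfolding cos_double sin_double by (simp add: field_simps)
    also have "\<dots> = 0" unfolding rc by simp
    finally have "Re ((cos \<phi> * q' + sin \<phi>) * cnj (- sin \<phi> * q' + cos \<phi>)) = 0" .
    then show ?thesis unfolding R_def mob_def by (subst complex_div_cnj) simp
  qed
  moreover define t where "t = Im (R q')"
  ultimately have Rq: "R q' = of_real t * \<i>" by (simp add: complex_eq_iff)
  have t0: "t > 0" using real_moebius_in[OF R q'] by (simp add: t_def hplane_def)
  have tI: "of_real t * \<i> \<in> hplane" using t0 by (simp add: hplane_def)
  have "hdist \<i> (of_real t * \<i>) = hdist (A0 p) (A0 q)"
    using real_moebius_hdist[OF R I(1) q'] by (simp add: Ri Rq A0p q'_def[symmetric])
  also have "\<dots> = hdist \<i> (2 * \<i>)" using real_moebius_hdist[OF A0 p q] pq by simp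
  finally have "(cmod (\<i> - of_real t * \<i>))\<^sup>2 / t = (cmod (\<i> - 2 * \<i>))\<^sup>2 / 2"
    using hdist_eqD[OF I(1) tI I(1) I(2)] by simp
  then have "(1 - t)\<^sup>2 / t = 1 / 2" by (simp add: cmod_power2)
  then have "(t - 2) * (2 * t - 1) = 0" using t0 by (simp add: field_simps power2_eq_square)
  then have "t = 2 \<or> t = 1 / 2" by auto
  then show ?thesis
  proof
    assume "t = 2"
    show ?thesis
      by (rule that[of "\<lambda>z. R (A0 z)"])
        (use real_moebius_comp[OF R A0] Ri A0p Rq \<open>t = 2\<close> q'_def in auto)
  next
    assume "t = 1 / 2"
    show ?thesis
    proof (rule that[of "\<lambda>z. - 1 / (R (A0 z) - of_real 0)"])
      show "real_moebius (\<lambda>z. - 1 / (R (A0 z) - of_real 0))"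
        by (rule real_moebius_comp[OF real_moebius_inversion[of 0] real_moebius_comp[OF R A0]])
    qed (simp_all add: Ri A0p Rq[unfolded q'_def] \<open>t = 1/2\<close> complex_eq_iff)
  qed
qed

lemma real_moebius_derivative:
  assumes "real_moebius f" "z \<in> hplane"
  shows "\<exists>f'. (f has_field_derivative f') (at z)"
proof -
  obtain a b c d where f: "a * d - b * c = 1" "\<And>z. z\<in>hplane \<Longrightarrow> f z = mob a b c d z"
    using assms(1) by (auto simp: real_moebius_def)
  have "open hplane" unfolding hplane_def by (rule open_halfspace_Im_gt)
  moreover have "mob a b c d holomorphic_on hplane"
    unfolding mob_def using mob_denominator[OF f(1)] by (intro holomorphic_intros) auto
  then have "f holomorphic_on hplane"
    by (rule holomorphic_transform) (simp add: f(2))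
  ultimately show ?thesis
    using assms(2) by (metis holomorphic_derivI)
qed

text \<open>A Moebius map that restores \<open>\<i>\<close> and \<open>2 * \<i>\<close> reduces the
  claim to the identity and the reflection \<open>- cnj z\<close>. Orientation, tested at the single
  point \<open>\<i>\<close>, excludes the reflection.\<close>

lemma orientation_preserving_isometry_real_moebius:
  assumes iso: "hisometry \<gamma>" and ori: "orientation_preserving \<gamma>"
  shows "real_moebius \<gamma>"
proof -
  have I: "\<i> \<in> hplane" "2 * \<i> \<in> hplane" by (auto simp: hplane_def)
  have maps: "\<gamma> z \<in> hplane" if "z \<in> hplane" for z
    using iso that by (auto simp: hisometry_def Bij_def bij_betw_def)
  have d: "hdist (\<gamma> z) (\<gamma> w) = hdist z w" if "z \<in> hplane" "w \<in> hplane" for z w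
    using iso that by (auto simp: hisometry_def)
  obtain A where A: "real_moebius A" "A (\<gamma> \<i>) = \<i>" "A (\<gamma> (2 * \<i>)) = 2 * \<i>"
    using real_moebius_to_vertical[OF maps[OF I(1)] maps[OF I(2)] d[OF I]] by blast
  obtain B where B: "real_moebius B" "\<And>z. z \<in> hplane \<Longrightarrow> B (A z) = z"
    using real_moebius_inverse[OF A(1)] by metis
  have "(\<forall>z\<in>hplane. A (\<gamma> z) = z) \<or> (\<forall>z\<in>hplane. A (\<gamma> z) = - cnj z)"
    using A by (intro isometry_fixing_vertical) (auto simp: real_moebius_in real_moebius_hdist maps d)
  then show ?thesis
  proof
    assume "\<forall>z\<in>hplane. A (\<gamma> z) = z"
    then show ?thesis using B maps by (intro real_moebius_cong[OF B(1)]) metis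
  next
    assume "\<forall>z\<in>hplane. A (\<gamma> z) = - cnj z"
    then have g: "\<gamma> z = B (- cnj z)" if "z \<in> hplane" for z using B(2) maps that by metis
    obtain b where b: "(B has_field_derivative b) (at \<i>)" using real_moebius_derivative[OF B(1) I(1)] by blast
    have opn: "open hplane" unfolding hplane_def by (rule open_halfspace_Im_gt)
    have "((\<lambda>z. - cnj z) has_derivative (\<lambda>z. - cnj z)) (at \<i>)"
      by (intro derivative_intros bounded_linear.has_derivative[OF bounded_linear_cnj])
    then have "((\<lambda>z. B (- cnj z)) has_derivative (\<lambda>z. b * (- cnj z))) (at \<i>)"
      using b by (intro has_derivative_compose[of "\<lambda>z. - cnj z" _ _ _ B "\<lambda>v. b * v"]) (auto simp: has_field_derivative_def)
    then have D1: "(\<gamma> has_derivative (\<lambda>z. b * (- cnj z))) (at \<i>)"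
      by (rule has_derivative_transform_within_open[OF _ opn I(1)]) (simp add: g)
    obtain D where D: "(\<gamma> has_derivative D) (at \<i>)" "Re (D 1) * Im (D \<i>) - Im (D 1) * Re (D \<i>) > 0"
      using ori I(1) by (auto simp: orientation_preserving_def)
    have "D = (\<lambda>z. b * (- cnj z))" by (rule has_derivative_unique[OF D(1) D1])
    \<comment> \<open>The map \<open>z \<mapsto> - b * cnj z\<close> has determinant minus the
      squared modulus of \<open>b\<close>.\<close>
    with D(2) have "- (Re b * Re b) - Im b * Im b > 0" by simp
    then show ?thesis by (smt (verit) zero_le_square)
  qed
qed


section \<open>Displacement and conjugation to a dilation\<close>

lemma hdist_scaling:
  assumes "\<alpha> > 1" "w \<in> hplane"
  shows "hdist (of_real \<alpha> * w) w \<ge> ln \<alpha>" and "Re w = 0 \<Longrightarrow> hdist (of_real \<alpha> * w) w = ln \<alpha>"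
proof -
  have y: "Im w > 0" using assms(2) by (simp add: hplane_def)
  have aw: "of_real \<alpha> * w \<in> hplane" using assms by (simp add: hplane_def)
  have c: "cosh (hdist (of_real \<alpha> * w) w) = 1 + (\<alpha> - 1)\<^sup>2 * (cmod w)\<^sup>2 / (2 * \<alpha> * (Im w)\<^sup>2)"
  proof -
    have "of_real \<alpha> * w - w = of_real (\<alpha> - 1) * w" by (simp add: algebra_simps)
    then have "cmod (of_real \<alpha> * w - w) = (\<alpha> - 1) * cmod w" using assms(1) by (simp only: norm_mult norm_of_real)
    then show ?thesis using assms
      by (simp add: cosh_hdist[OF aw assms(2)] power_mult_distrib power2_eq_square mult.assoc)
  qed
  have l: "cosh (ln \<alpha>) = 1 + (\<alpha> - 1)\<^sup>2 / (2 * \<alpha>)"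
    using assms(1) by (simp add: cosh_ln_real field_simps power2_eq_square)
  \<comment> \<open>The displacement grows with \<open>cmod w / Im w\<close>, whose least value 1 is
    taken exactly on the imaginary axis.\<close>
  have "(\<alpha> - 1)\<^sup>2 * (Im w)\<^sup>2 \<le> (\<alpha> - 1)\<^sup>2 * (cmod w)\<^sup>2"
    by (intro mult_left_mono) (auto simp: cmod_power2)
  then have "(\<alpha> - 1)\<^sup>2 / (2 * \<alpha>) \<le> (\<alpha> - 1)\<^sup>2 * (cmod w)\<^sup>2 / (2 * \<alpha> * (Im w)\<^sup>2)"
    using y assms(1) by (simp add: field_simps)
  then have "cosh (ln \<alpha>) \<le> cosh (hdist (of_real \<alpha> * w) w)" unfolding c l by simp
  then show "hdist (of_real \<alpha> * w) w \<ge> ln \<alpha>"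
    using assms(1) hdist_nonneg[OF aw assms(2)] by (subst (asm) cosh_real_nonneg_le_iff) auto
  assume "Re w = 0"
  then have "(cmod w)\<^sup>2 = (Im w)\<^sup>2" by (simp add: cmod_power2)
  then have "cosh (ln \<alpha>) = cosh (hdist (of_real \<alpha> * w) w)" unfolding c l using y by simp
  then show "hdist (of_real \<alpha> * w) w = ln \<alpha>"
    using assms(1) hdist_nonneg[OF aw assms(2)] by (subst (asm) cosh_real_eq_iff) auto
qed

lemma translation_displacement_small:
  assumes "e > 0"
  obtains z where "z \<in> hplane" "hdist (z + of_real b) z < e"
proof -
  define k where "k = cosh e - 1"
  have k: "k > 0" using assms cosh_real_strict_mono[of 0 e] by (simp add: k_def)
  \<comment> \<open>At height \<open>y\<close> the translation has \<open>cosh\<close> of its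
    displacement equal to \<open>1 + b^2 / (2 * y^2)\<close>, and this \<open>y\<close> gives
    \<open>2 * y^2 = (\<bar>b\<bar> + 1)^2 / k\<close>. The added 1 makes the inequality strict and
    keeps \<open>y\<close> positive for \<open>b = 0\<close>.\<close>
  define y where "y = (\<bar>b\<bar> + 1) / sqrt (2 * k)"
  have y: "y > 0" using k by (auto simp: y_def add_nonneg_pos)
  have z: "of_real y * \<i> \<in> hplane" "of_real y * \<i> + of_real b \<in> hplane" using y by (auto simp: hplane_def)
  have y2: "2 * y * y = (\<bar>b\<bar> + 1)\<^sup>2 / k"
    using k by (simp add: y_def power2_eq_square field_simps)
  have "b\<^sup>2 < (\<bar>b\<bar> + 1)\<^sup>2" using power_strict_mono[of "\<bar>b\<bar>" "\<bar>b\<bar> + 1" 2] by simp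
  then have "b\<^sup>2 / (2 * y * y) < cosh e - 1"
    using k unfolding y2 k_def[symmetric] by (simp add: field_simps add_nonneg_pos)
  then have "cosh (hdist (of_real y * \<i> + of_real b) (of_real y * \<i>)) < cosh e"
    using y by (simp add: cosh_hdist[OF z(2,1)])
  then have "hdist (of_real y * \<i> + of_real b) (of_real y * \<i>) < e"
    using assms hdist_nonneg[OF z(2,1)] by (subst (asm) cosh_real_nonneg_less_iff) auto
  then show ?thesis using that[OF z(1)] by blast
qed

text \<open>Every Moebius transformation with displacement bounded below has a real fixed point or fixes
  infinity; an inversion moves the fixed point to infinity, and an affine map with
  no fixed point in the reals is a translation, whose displacement is not bounded below.\<close>
lemma real_moebius_conjugate_scaling:
  assumes f: "real_moebius f" and e: "e > 0" "\<And>z. z \<in> hplane \<Longrightarrow> hdist (f z) z \<ge> e"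
  obtains M N \<alpha> where "real_moebius M" "real_moebius N"
    "\<And>z. z \<in> hplane \<Longrightarrow> N (M z) = z" "\<And>z. z \<in> hplane \<Longrightarrow> M (N z) = z"
    "\<alpha> > 1" "\<And>z. z \<in> hplane \<Longrightarrow> M (f z) = of_real \<alpha> * M z"
proof -
  note result = that
  text \<open>Conjugating with \<open>- 1 / z\<close> turns a contraction into an expansion.\<close>
  have scale: thesis if M: "real_moebius M" and k: "k > 0" "k \<noteq> 1" "\<And>z. z \<in> hplane \<Longrightarrow> M (f z) = of_real k * M z" for M k
  proof -
    obtain M' k' where M': "real_moebius M'" "k' > 1" "\<And>z. z \<in> hplane \<Longrightarrow> M' (f z) = of_real k' * M' z"
    proof (cases "k > 1")
      case True
      then show ?thesis using that M k by blast
    next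
      case False
      show ?thesis
      proof (rule that[of "\<lambda>z. - 1 / (M z - of_real 0)" "1 / k"])
        show "real_moebius (\<lambda>z. - 1 / (M z - of_real 0))"
          by (rule real_moebius_comp[OF real_moebius_inversion M])
      qed (use False k in auto)
    qed
    obtain N' where "real_moebius N'" "\<And>z. z \<in> hplane \<Longrightarrow> N' (M' z) = z" "\<And>z. z \<in> hplane \<Longrightarrow> M' (N' z) = z"
      using real_moebius_inverse[OF M'(1)] by blast
    with M' show thesis by (intro result[of M' N' k']) auto
  qed
  have affine: thesis if M: "real_moebius M" and k: "k > 0" "\<And>z. z \<in> hplane \<Longrightarrow> M (f z) = of_real k * M z + of_real m" for M k m
  proof (cases "k = 1")
    case True
    obtain N where N: "real_moebius N" "\<And>z. z \<in> hplane \<Longrightarrow> N (M z) = z" "\<And>z. z \<in> hplane \<Longrightarrow> M (N z) = z"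
      using real_moebius_inverse[OF M(1)] by blast
    obtain z where z: "z \<in> hplane" "hdist (z + of_real m) z < e"
      using translation_displacement_small[OF e(1)] by blast
    have nz: "N z \<in> hplane" using real_moebius_in[OF N(1) z(1)] .
    have "hdist (f (N z)) (N z) = hdist (M (f (N z))) (M (N z))"
      using nz by (intro real_moebius_hdist[OF M, symmetric] real_moebius_in[OF f])
    also have "\<dots> = hdist (z + of_real m) z" using k(2)[OF nz] N(3)[OF z(1)] True by simp
    finally show thesis using e(2)[OF nz] z(2) by simp
  next
    case False
    \<comment> \<open>The fixed point of \<open>w \<mapsto> k * w + m\<close>; moving it to 0 leaves
      a pure dilation.\<close>
    define p where "p = m / (1 - k)"
    have "(1 - k) * p = m" using False by (simp add: p_def)
    then have "m = p - k * p" by (simp add: algebra_simps)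
    then have m: "of_real m = of_real p - of_real k * (of_real p :: complex)" by simp
    show thesis
    proof (rule scale[of "\<lambda>z. of_real 1 * M z + of_real (-p)" k])
      show "real_moebius (\<lambda>z. of_real 1 * M z + of_real (-p))"
        by (rule real_moebius_comp[OF real_moebius_affine M]) simp
      show "of_real 1 * M (f z) + of_real (- p) = of_real k * (of_real 1 * M z + of_real (- p))"
        if "z \<in> hplane" for z
        using k(2)[OF that] by (simp add: m algebra_simps)
    qed (use k False in auto)
  qed
  obtain a b c d where ad: "a * d - b * c = 1" and fm: "\<And>z. z \<in> hplane \<Longrightarrow> f z = mob a b c d z"
    using f by (auto simp: real_moebius_def)
  show thesis
  proof (cases "c = 0")
    case True
    then have ad1: "a * d = 1" and "a \<noteq> 0" using ad by auto
    then have "d = 1 / a" by (simp add: eq_divide_eq mult.commute)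
    then have fz: "f z = of_real (a * a) * z + of_real (a * b)" if "z \<in> hplane" for z
      using fm[OF that] True by (simp add: mob_def field_simps)
    show thesis
    proof (rule affine[of "\<lambda>z. of_real 1 * z + of_real 0" "a * a" "a * b"])
      show "real_moebius (\<lambda>z. of_real 1 * z + of_real 0)" by (rule real_moebius_affine) simp
      show "a * a > 0" using \<open>a \<noteq> 0\<close> by (simp add: zero_less_mult_iff) linarith
    qed (use fz in auto)
  next
    case c: False
    \<comment> \<open>The squared trace minus 4, which is the discriminant of the fixed-point
      equation \<open>c * z^2 + (d - a) * z - b = 0\<close>.\<close>
    define D where "D = (a + d)\<^sup>2 - 4"
    have D: "D = (a - d)\<^sup>2 + 4 * b * c" using ad by (simp add: D_def power2_eq_square algebra_simps)
    show thesis
    proof (cases "D < 0")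
      case True
      \<comment> \<open>The root in the upper half-plane, selected by \<open>sgn c\<close>. It would
        be a fixed point inside the plane, against the positive lower bound \<open>e\<close> for the
        displacement.\<close>
      define z where "z = (of_real (a - d) + \<i> * of_real (sgn c * sqrt (- D))) / of_real (2 * c)"
      have "Im z = sgn c * sqrt (- D) / (2 * c)" unfolding z_def by (simp add: Im_divide_of_real)
      also have "\<dots> = sgn c / c * (sqrt (- D) / 2)" by simp
      also have "\<dots> > 0" using True c by (intro mult_pos_pos) (auto simp: sgn_if zero_less_divide_iff)
      finally have z: "z \<in> hplane" by (simp add: hplane_def)
      have e1: "2 * of_real c * z - of_real (a - d) = \<i> * of_real (sgn c * sqrt (- D))"
        using c by (simp add: z_def)
      have "(2 * of_real c * z - of_real (a - d))\<^sup>2 = - of_real ((sgn c * sqrt (- D))\<^sup>2)"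
        unfolding e1 by (simp add: power_mult_distrib)
      also have "(sgn c * sqrt (- D))\<^sup>2 = - D" using True c by (simp add: power_mult_distrib sgn_if)
      also have "- of_real (- D) = (of_real ((a - d)\<^sup>2 + 4 * b * c) :: complex)" by (simp add: D)
      finally have "4 * of_real c * (of_real c * z * z + of_real d * z - (of_real a * z + of_real b)) = 0"
        by (simp add: power2_eq_square algebra_simps)
      then have "of_real c * z * z + of_real d * z - (of_real a * z + of_real b) = 0"
        using c by (metis mult_eq_0_iff of_real_eq_0_iff zero_neq_numeral)
      then have "z * (of_real c * z + of_real d) = of_real a * z + of_real b"
        by (simp add: algebra_simps)
      then have "f z = z" using mob_denominator[OF ad z] fm[OF z] by (simp add: mob_def divide_eq_eq)
      then have "cosh (hdist (f z) z) = 1" using cosh_hdist[OF z z] by simp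
      moreover have "cosh (hdist (f z) z) > 1"
        using e(2)[OF z] e(1) cosh_real_strict_mono[of 0 "hdist (f z) z"] by simp
      ultimately show thesis by simp
    next
      case False
      define p where "p = (a - d + sqrt D) / (2 * c)"
      have "2 * c * p - (a - d) = sqrt D" using c by (simp add: p_def)
      then have "(2 * c * p - (a - d))\<^sup>2 = D" using False by simp
      then have "4 * c * (c * p * p + d * p - (a * p + b)) = 0" unfolding D by (simp add: power2_eq_square algebra_simps)
      then have fixp: "c * p * p + d * p - a * p - b = 0" using c by simp
      \<comment> \<open>The vector \<open>(p, 1)\<close> is an eigenvector of the matrix with
        eigenvalue \<open>j\<close>, and \<open>a - c * p\<close> is the other eigenvalue, so their
        product is the determinant 1. With \<open>p\<close> sent to infinity the map becomes affine
        with factor \<open>j * j\<close>.\<close>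
      define j where "j = c * p + d"
      have j: "(a - c * p) * j = 1" using fixp ad by (simp add: j_def algebra_simps) algebra
      then have j0: "j \<noteq> 0" by auto
      have acp: "a - c * p = 1 / j" using j j0 by (simp add: field_simps)
      show thesis
      proof (rule affine[of "\<lambda>z. - 1 / (z - of_real p)" "j * j" "- c * j"])
        show "real_moebius (\<lambda>z. - 1 / (z - of_real p))" by (rule real_moebius_inversion)
        show "j * j > 0" using j0 by (simp add: zero_less_mult_iff) linarith
        fix z assume z: "z \<in> hplane"
        let ?P = "of_real p :: complex" let ?J = "of_real j :: complex"
        have zp: "z - ?P \<noteq> 0" using z by (auto simp: hplane_def complex_eq_iff)
        have den: "of_real c * z + of_real d \<noteq> 0" by (rule mob_denominator[OF ad z])
        have b: "b = c * p * p + d * p - a * p" using fixp by simp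
        have "f z - ?P = (of_real (a - c * p) * (z - ?P)) / (of_real c * z + of_real d)"
          using den by (simp add: fm[OF z] mob_def field_simps) (simp add: b algebra_simps)
        then have "f z - ?P = (z - ?P) / (?J * (of_real c * z + of_real d))"
          unfolding acp by simp
        then have "- 1 / (f z - ?P) = - ?J * (of_real c * z + of_real d) / (z - ?P)" by simp
        also have "of_real c * z + of_real d = of_real c * (z - ?P) + ?J" by (simp add: j_def algebra_simps)
        also have "- ?J * (of_real c * (z - ?P) + ?J) / (z - ?P) = of_real (j * j) * (- 1 / (z - ?P)) + of_real (- c * j)"
          using zp by (simp add: field_simps)
        finally show "- 1 / (f z - ?P) = of_real (j * j) * (- 1 / (z - ?P)) + of_real (- c * j)" .
      qed
    qed
  qed
qed

text \<open>Conjugation preserves displacements, so \<open>hlength \<gamma>\<close> is the least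
  displacement of the dilation, attained at \<open>N \<i>\<close>. This identifies the dilation
  factor, so far unspecified, as \<open>exp (hlength \<gamma>)\<close>.\<close>

lemma hyperbolic_conjugate_scaling:
  assumes hyp: "hyperbolic \<gamma>"
  obtains M N where "real_moebius M" "real_moebius N"
    "\<And>z. z \<in> hplane \<Longrightarrow> N (M z) = z" "\<And>z. z \<in> hplane \<Longrightarrow> M (N z) = z"
    "\<And>z. z \<in> hplane \<Longrightarrow> \<gamma> z = N (of_real (exp (hlength \<gamma>)) * M z)"
proof -
  have I: "\<i> \<in> hplane" by (simp add: hplane_def)
  have g: "real_moebius \<gamma>"
    using hyp orientation_preserving_isometry_real_moebius by (auto simp: hyperbolic_def)
  have bdd: "bdd_below ((\<lambda>z. hdist (\<gamma> z) z) ` hplane)"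
    using hdist_nonneg real_moebius_in[OF g] by (intro bdd_belowI2) auto
  have "hlength \<gamma> \<le> hdist (\<gamma> z) z" if "z \<in> hplane" for z
    unfolding hlength_def by (rule cINF_lower[OF bdd that])
  moreover have "hlength \<gamma> > 0" using hyp by (simp add: hyperbolic_def)
  ultimately obtain M N \<alpha> where MN: "real_moebius M" "real_moebius N"
    "\<And>z. z \<in> hplane \<Longrightarrow> N (M z) = z" "\<And>z. z \<in> hplane \<Longrightarrow> M (N z) = z"
    "\<alpha> > 1" "\<And>z. z \<in> hplane \<Longrightarrow> M (\<gamma> z) = of_real \<alpha> * M z"
    using real_moebius_conjugate_scaling[OF g] by metis
  have d: "hdist (\<gamma> z) z = hdist (of_real \<alpha> * M z) (M z)" if "z \<in> hplane" for z
    using MN(6)[OF that] real_moebius_hdist[OF MN(1) real_moebius_in[OF g that] that] by simp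
  have "hlength \<gamma> = ln \<alpha>"
  proof (rule antisym)
    have "hlength \<gamma> \<le> hdist (\<gamma> (N \<i>)) (N \<i>)"
      unfolding hlength_def by (rule cINF_lower[OF bdd real_moebius_in[OF MN(2) I]])
    also have "\<dots> = ln \<alpha>"
      using d[OF real_moebius_in[OF MN(2) I]] hdist_scaling(2)[OF MN(5) I] by (simp add: MN(4)[OF I])
    finally show "hlength \<gamma> \<le> ln \<alpha>" .
    show "ln \<alpha> \<le> hlength \<gamma>" unfolding hlength_def
      using I by (intro cINF_greatest) (auto simp: d intro!: hdist_scaling(1) MN real_moebius_in[OF MN(1)])
  qed
  then have "exp (hlength \<gamma>) = \<alpha>" using MN(5) by simp
  moreover have "\<gamma> z = N (of_real \<alpha> * M z)" if "z \<in> hplane" for z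
    using MN(3)[OF real_moebius_in[OF g that]] MN(6)[OF that] by simp
  ultimately show ?thesis using MN by (intro that) auto
qed

section \<open>The function \<open>n\<^sub>Z\<close>\<close>

lemma exp_eq_1_iff_nZ_pole:
  assumes "l > 0"
  shows "exp ((of_nat m + 1 / 2 + \<i> * \<rho>) * complex_of_real l) = 1 \<longleftrightarrow> (\<exists>\<nu>. \<rho> = nZ_pole l \<nu> m)"
proof -
  have "exp ((of_nat m + 1 / 2 + \<i> * \<rho>) * complex_of_real l) = 1 \<longleftrightarrow>
      Im \<rho> = of_nat m + 1 / 2 \<and> (\<exists>\<nu>::int. Re \<rho> * l = of_int (2 * \<nu>) * pi)"
  proof -
    have "Re ((of_nat m + 1 / 2 + \<i> * \<rho>) * complex_of_real l) = (of_nat m + 1 / 2 - Im \<rho>) * l"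
      "Im ((of_nat m + 1 / 2 + \<i> * \<rho>) * complex_of_real l) = Re \<rho> * l" by simp_all
    then show ?thesis unfolding exp_eq_1 using assms by auto
  qed
  also have "\<dots> \<longleftrightarrow> (\<exists>\<nu>. \<rho> = nZ_pole l \<nu> m)"
  proof -
    have "\<rho> = nZ_pole l \<nu> m \<longleftrightarrow> Im \<rho> = of_nat m + 1 / 2 \<and> Re \<rho> * l = of_int (2 * \<nu>) * pi" for \<nu>
      using assms by (simp add: nZ_pole_def complex_eq_iff eq_divide_eq conj_commute mult.commute mult.left_commute)
    then show ?thesis by auto
  qed
  finally show ?thesis .
qed

text \<open>Assumption \<open>E\<close> makes the exponential at least 2 in modulus, so that
  subtracting 1 costs at most half of it.\<close>

lemma norm_nZ_term_le:
  assumes "Im \<rho> \<le> R" and E: "ln 2 \<le> (of_nat m + 1 / 2 - R) * l" and "l > 0"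
  shows "norm (nZ_term l \<rho> m) \<le> 2 * exp (- ((of_nat m + 1 / 2 - R) * l))"
proof -
  let ?x = "exp ((of_nat m + 1 / 2 + \<i> * \<rho>) * complex_of_real l)"
  let ?E = "exp ((of_nat m + 1 / 2 - R) * l)"
  have "2 = exp (ln (2::real))" by simp
  also have "\<dots> \<le> ?E" using E by (subst exp_le_cancel_iff)
  finally have E2: "?E \<ge> 2" .
  have "norm ?x = exp ((of_nat m + 1 / 2 - Im \<rho>) * l)" by (simp add: norm_exp_eq_Re)
  also have "\<dots> \<ge> ?E" using assms by (simp add: mult_right_mono)
  finally have x: "norm ?x \<ge> ?E" .
  have "norm ?x - 1 \<le> norm (?x - 1)" using norm_triangle_ineq2[of ?x 1] by (simp only: norm_one)
  then have "?E / 2 \<le> norm (?x - 1)" using x E2 by linarith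
  then have "inverse (norm (?x - 1)) \<le> inverse (?E / 2)"
    by (intro le_imp_inverse_le) auto
  also have "inverse (?E / 2) = 2 * exp (- ((of_nat m + 1 / 2 - R) * l))"
    unfolding exp_minus inverse_divide by (rule divide_inverse)
  finally show ?thesis by (simp only: nZ_term_def norm_inverse)
qed

lemma summable_exp_minus_of_nat:
  assumes "l > 0"
  shows "summable (\<lambda>m. exp (- ((of_nat m + c) * l)) :: real)"
proof -
  have "exp (- ((of_nat m + c) * l)) = exp (- (c * l)) * exp (- l) ^ m" for m
    by (simp add: exp_of_nat_mult[symmetric] exp_add[symmetric] algebra_simps)
  then show ?thesis using assms by (simp add: summable_mult summable_geometric)
qed

text \<open>Omitting the indices in \<open>K\<close> allows one to split off the singular term near a pole.\<close>
lemma nZ_partial_sum_holomorphic: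
  fixes l R :: real and K :: "nat set"
  defines "f \<equiv> \<lambda>\<rho> m. if m \<in> K then 0 else nZ_term l \<rho> m"
  assumes l: "l > 0" and S: "open S" "\<And>\<rho>. \<rho> \<in> S \<Longrightarrow> Im \<rho> \<le> R"
    and np: "\<And>\<rho> \<nu> m. \<rho> \<in> S \<Longrightarrow> m \<notin> K \<Longrightarrow> \<rho> \<noteq> nZ_pole l \<nu> m"
  shows "\<And>\<rho>. \<rho> \<in> S \<Longrightarrow> summable (f \<rho>)" and "(\<lambda>\<rho>. \<Sum>m. f \<rho> m) holomorphic_on S"
proof -
  \<comment> \<open>The majorant sees \<open>\<rho>\<close> only through the bound \<open>R\<close>
    for its imaginary part and is therefore uniform on \<open>S\<close>.\<close>
  define h where "h m = complex_of_real (2 * exp (- ((of_nat m + (1 / 2 - R)) * l)))" for m :: nat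
  have "summable h" unfolding h_def
    by (intro summable_of_real summable_mult summable_exp_minus_of_nat l)
  have "\<forall>\<^sub>F m in sequentially. real m \<ge> (ln 2 / l + R)"
    using filterlim_real_sequentially by (auto simp: filterlim_at_top)
  then have ev: "\<forall>\<^sub>F m in sequentially. \<forall>y\<in>S. cmod (f y m) \<le> cmod (h m)"
  proof eventually_elim
    case (elim m)
    have "ln 2 / l \<le> of_nat m + 1 / 2 - R" using elim by simp
    then have "ln 2 \<le> (of_nat m + 1 / 2 - R) * l" using l by (simp add: field_simps)
    then show ?case using S(2) norm_nZ_term_le[OF S(2) _ l]
      by (auto simp: f_def h_def add_diff_eq)
  qed
  have "\<exists>g. \<forall>\<rho>\<in>S. ((\<lambda>m. f \<rho> m) sums g \<rho>) \<and> g field_differentiable (at \<rho>)"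
  proof (rule series_differentiable_comparison_complex[OF S(1), of "\<lambda>m \<rho>. f \<rho> m"])
    fix m \<rho> assume \<rho>: "\<rho> \<in> S"
    have "(\<lambda>\<rho>. f \<rho> m) holomorphic_on S"
    proof (cases "m \<in> K")
      case False
      then have "exp ((of_nat m + 1 / 2 + \<i> * \<rho>) * complex_of_real l) - 1 \<noteq> 0" if "\<rho> \<in> S" for \<rho>
        using np[OF that] exp_eq_1_iff_nZ_pole[OF l, of m \<rho>] by auto
      then show ?thesis unfolding f_def nZ_term_def using False
        by (auto intro!: holomorphic_intros)
    qed (simp add: f_def)
    then show "(\<lambda>\<rho>. f \<rho> m) field_differentiable (at \<rho>)"
      using S(1) \<rho> by (rule holomorphic_on_imp_differentiable_at)
  next
    fix \<rho> assume "\<rho> \<in> S"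
    show "\<exists>d h. 0 < d \<and> summable h \<and> range h \<subseteq> \<real>\<^sub>\<ge>\<^sub>0 \<and>
      (\<forall>\<^sub>F m in sequentially. \<forall>y\<in>ball \<rho> d \<inter> S. cmod (f y m) \<le> cmod (h m))"
    proof (intro exI conjI)
      show "range h \<subseteq> \<real>\<^sub>\<ge>\<^sub>0" by (auto simp: h_def complex_nonneg_Reals_iff)
      show "\<forall>\<^sub>F m in sequentially. \<forall>y\<in>ball \<rho> 1 \<inter> S. cmod (f y m) \<le> cmod (h m)"
        using ev by eventually_elim blast
    qed (use \<open>summable h\<close> in auto)
  qed blast
  then obtain g where g: "\<And>\<rho>. \<rho> \<in> S \<Longrightarrow> (\<lambda>m. f \<rho> m) sums g \<rho>" "\<And>\<rho>. \<rho> \<in> S \<Longrightarrow> g field_differentiable (at \<rho>)"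
    by blast
  show "summable (f \<rho>)" if "\<rho> \<in> S" for \<rho> using g(1)[OF that] by (rule sums_summable)
  have "g holomorphic_on S" using g(2) by (auto simp: holomorphic_on_def field_differentiable_at_within)
  then show "(\<lambda>\<rho>. \<Sum>m. f \<rho> m) holomorphic_on S"
    by (rule holomorphic_transform) (simp add: sums_unique[OF g(1)])
qed

section \<open>The lattice of poles, principal parts and residues\<close>

lemma nZ_pole_separated:
  assumes "l > 0" "dist (nZ_pole l \<nu> m) (nZ_pole l \<nu>' m') < min 1 (2 * pi / l)"
  shows "\<nu> = \<nu>' \<and> m = m'"
proof -
  let ?d = "nZ_pole l \<nu> m - nZ_pole l \<nu>' m'"
  have n: "norm ?d < 1" "norm ?d < 2 * pi / l" using assms(2) by (auto simp: dist_norm)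
  \<comment> \<open>Both coordinates of a difference of poles are integer multiples of a spacing, 1
    vertically and \<open>2 * pi / l\<close> horizontally; below the spacing they vanish.\<close>
  have "Im ?d = of_int (int m - int m')" by (simp add: nZ_pole_def)
  then have "\<bar>of_int (int m - int m') :: real\<bar> < 1" using abs_Im_le_cmod[of ?d] n by linarith
  then have "m = m'" by linarith
  have "Re ?d = of_int (\<nu> - \<nu>') * (2 * pi / l)" by (simp add: nZ_pole_def diff_divide_distrib algebra_simps)
  then have "\<bar>of_int (\<nu> - \<nu>')\<bar> * (2 * pi / l) < 1 * (2 * pi / l)"
    using abs_Re_le_cmod[of ?d] n assms(1) by (simp add: abs_mult)
  then have "\<bar>of_int (\<nu> - \<nu>') :: real\<bar> < 1"
    using assms(1) by (subst (asm) mult_less_cancel_right_pos) auto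
  then have "\<nu> = \<nu>'" by linarith
  with \<open>m = m'\<close> show ?thesis by simp
qed

lemma nZ_poles_not_islimpt:
  assumes "l > 0"
  shows "\<not> z islimpt {nZ_pole l \<nu> m | \<nu> m. True}"
proof
  define r where "r = min 1 (2 * pi / l)"
  let ?P = "{nZ_pole l \<nu> m | \<nu> m. True}"
  have r: "r > 0" using assms by (auto simp: r_def)
  assume z: "z islimpt ?P"
  then obtain x where x: "x \<in> ?P" "x \<noteq> z" "dist x z < r / 2" using r
    unfolding islimpt_approachable by (metis half_gt_zero)
  \<comment> \<open>A second pole is taken closer to \<open>z\<close> than \<open>x\<close> is.
    Separation forces it to equal \<open>x\<close>, which the distances forbid.\<close>
  have "min (r / 2) (dist x z) > 0" using r x(2) by simp
  then obtain y where y: "y \<in> ?P" "dist y z < min (r / 2) (dist x z)"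
    using z unfolding islimpt_approachable by meson
  have "dist x y < r" using x(3) y(2) dist_triangle2[of x y z] by simp
  then have "x = y" using x(1) y(1) nZ_pole_separated[OF assms] unfolding r_def by blast
  then show False using y by simp
qed

lemma open_not_nZ_pole: "l > 0 \<Longrightarrow> open (- {nZ_pole l \<nu> m | \<nu> m. True})"
  by (intro open_Compl closed_limpt[THEN iffD2] allI impI) (blast dest: nZ_poles_not_islimpt)

lemma
  assumes l: "l > 0"
  shows summable_nZ_term: "\<And>\<rho>. (\<nexists>\<nu> m. \<rho> = nZ_pole l \<nu> m) \<Longrightarrow> summable (nZ_term l \<rho>)"
    and nZ_analytic: "nZ l analytic_on - {nZ_pole l \<nu> m | \<nu> m. True}"
proof -
  \<comment> \<open>The series is controlled only where \<open>Im \<rho>\<close> is bounded above,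
    so the complement of the poles is exhausted by pieces of half-planes.\<close>
  define S where "S R = - {nZ_pole l \<nu> m | \<nu> m. True} \<inter> {\<rho>. Im \<rho> < R}" for R
  have S: "open (S R)" for R unfolding S_def
    by (intro open_Int open_not_nZ_pole l open_halfspace_Im_lt)
  have b: "Im \<rho> \<le> R" if "\<rho> \<in> S R" for \<rho> R using that by (simp add: S_def)
  have np: "\<rho> \<noteq> nZ_pole l \<nu> m" if "\<rho> \<in> S R" for \<rho> R \<nu> m using that unfolding S_def by blast
  have 1: "summable (nZ_term l \<rho>)" if "\<rho> \<in> S R" for \<rho> R
    using nZ_partial_sum_holomorphic(1)[OF l S b np that, where K = "{}"] by simp
  have 2: "(\<lambda>\<rho>. \<Sum>m. nZ_term l \<rho> m) holomorphic_on S R" for R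
    using nZ_partial_sum_holomorphic(2)[OF l S b np, where K = "{}"] by simp
  show "summable (nZ_term l \<rho>)" if "\<nexists>\<nu> m. \<rho> = nZ_pole l \<nu> m" for \<rho>
    by (rule 1[of \<rho> "Im \<rho> + 1"]) (use that in \<open>simp add: S_def\<close>)
  have "nZ l analytic_on {\<rho>}" if "\<rho> \<in> - {nZ_pole l \<nu> m | \<nu> m. True}" for \<rho>
  proof -
    have \<rho>: "\<rho> \<in> S (Im \<rho> + 1)" using that by (simp add: S_def)
    have "nZ l holomorphic_on S (Im \<rho> + 1)"
      unfolding nZ_def by (intro holomorphic_intros 2)
    then have "nZ l analytic_on S (Im \<rho> + 1)" using S by (simp add: analytic_on_open)
    then show ?thesis using \<rho> by (blast intro: analytic_on_subset)
  qed
  then show "nZ l analytic_on - {nZ_pole l \<nu> m | \<nu> m. True}" by (subst analytic_on_analytic_at) auto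
qed

text \<open>\<open>E 0 = 1\<close> is the derivative of \<open>exp\<close> at 0, filled in at a
  removable singularity. The factorization exhibits the denominator of the singular term as a simple
  zero times a nonvanishing factor.\<close>

lemma exp_minus_1_factorization:
  obtains E where "E holomorphic_on UNIV" "\<And>w. exp w - 1 = w * E w" "E 0 = (1::complex)"
proof
  let ?E = "\<lambda>w::complex. if w = 0 then 1 else (exp w - 1) / w"
  have "((\<lambda>w. (exp w - 1) / w) \<longlongrightarrow> 1) (at (0::complex))"
    using DERIV_exp[of "0::complex"] by (simp add: has_field_derivative_iff)
  moreover have "(\<lambda>w::complex. (exp w - 1) / w) holomorphic_on UNIV - {0}"
    by (intro holomorphic_intros) auto
  ultimately show "?E holomorphic_on UNIV"
    by (intro removable_singularity) auto
qed auto

text \<open>Near \<open>p\<close> only the term with index \<open>m\<close> is singular. Hence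
  \<open>nZ l\<close> is \<open>g \<rho> / (\<rho> - p)\<close> with \<open>g\<close> holomorphic
  and \<open>g p = (l / pi) * (1 / (\<i> * l))\<close>, from which pole, order and residue are read
  off together.\<close>

lemma
  assumes l: "l > 0"
  shows nZ_is_pole: "is_pole (nZ l) (nZ_pole l \<nu> m)"
    and nZ_zorder: "zorder (nZ l) (nZ_pole l \<nu> m) = - 1"
    and nZ_residue: "residue (nZ l) (nZ_pole l \<nu> m) = 1 / (pi * \<i>)"
proof -
  define p where "p = nZ_pole l \<nu> m"
  \<comment> \<open>The spacing of the lattice, so that \<open>p\<close> is the only pole in the
    ball \<open>S\<close>.\<close>
  define r where "r = min 1 (2 * pi / l)"
  define S where "S = ball p r"
  have r: "r > 0" using l by (auto simp: r_def)
  then have S: "open S" "p \<in> S" by (auto simp: S_def)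
  obtain E where E: "E holomorphic_on UNIV" "\<And>w. exp w - 1 = w * E w" "E 0 = (1::complex)"
    using exp_minus_1_factorization by blast
  define Q where "Q \<rho> = (\<Sum>k. if k \<in> {m} then 0 else nZ_term l \<rho> k)" for \<rho>
  have bound: "Im \<rho> \<le> Im p + r" if "\<rho> \<in> S" for \<rho>
    using that abs_Im_le_cmod[of "\<rho> - p"] unfolding S_def by (auto simp: dist_norm norm_minus_commute)
  have np: "\<rho> \<noteq> nZ_pole l \<nu>' k" if "\<rho> \<in> S" "\<nu>' \<noteq> \<nu> \<or> k \<noteq> m" for \<rho> \<nu>' k
    using that nZ_pole_separated[OF l, of \<nu> m \<nu>' k] by (auto simp: S_def p_def r_def)
  have Q: "Q holomorphic_on S"
    unfolding Q_def by (rule nZ_partial_sum_holomorphic(2)[OF l S(1) bound]) (use np in auto)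
  have Qs: "summable (\<lambda>k. if k \<in> {m} then 0 else nZ_term l \<rho> k)" if "\<rho> \<in> S" for \<rho>
    by (rule nZ_partial_sum_holomorphic(1)[OF l S(1) bound _ that]) (use np in auto)
  have split: "nZ l \<rho> = l / pi * (nZ_term l \<rho> m + Q \<rho>)" if "\<rho> \<in> S" for \<rho>
  proof -
    have "(\<lambda>k. if k = m then nZ_term l \<rho> m else 0) sums nZ_term l \<rho> m" by (rule sums_single)
    from sums_add[OF this summable_sums[OF Qs[OF that]]]
    have "(\<lambda>k. nZ_term l \<rho> k) sums (nZ_term l \<rho> m + Q \<rho>)"
      unfolding Q_def by (rule sums_cong[THEN iffD1, rotated]) auto
    then show ?thesis by (simp add: nZ_def sums_unique[symmetric])
  qed
  have arg: "(of_nat m + 1 / 2 + \<i> * \<rho>) * complex_of_real l = \<i> * l * (\<rho> - p) + of_int (2 * \<nu>) * pi * \<i>" for \<rho>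
    using l by (simp add: p_def nZ_pole_def field_simps)
  \<comment> \<open>This holds even at \<open>\<rho> = p\<close>, where both sides are
    \<open>inverse 0 = 0\<close>.\<close>
  have term_m: "nZ_term l \<rho> m = inverse (\<i> * l * (\<rho> - p) * E (\<i> * l * (\<rho> - p)))" for \<rho>
  proof -
    have "exp (of_int (2 * \<nu>) * pi * \<i>) = (1::complex)"
      by (subst exp_eq_1) auto
    then have "exp ((of_nat m + 1 / 2 + \<i> * \<rho>) * complex_of_real l) = exp (\<i> * l * (\<rho> - p))"
      unfolding arg exp_add by simp
    then show ?thesis using E(2)[of "\<i> * l * (\<rho> - p)"] by (simp add: nZ_term_def)
  qed
  have E0: "E (\<i> * l * (\<rho> - p)) \<noteq> 0" if "\<rho> \<in> S" for \<rho>
  proof (cases "\<rho> = p")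
    case False
    show ?thesis
    proof
      assume "E (\<i> * l * (\<rho> - p)) = 0"
      then have "exp ((of_nat m + 1 / 2 + \<i> * \<rho>) * complex_of_real l) - 1 = 0"
        using term_m[of \<rho>] by (simp add: nZ_term_def)
      then obtain \<nu>' where "\<rho> = nZ_pole l \<nu>' m" using exp_eq_1_iff_nZ_pole[OF l, of m \<rho>] by auto
      then show False using np[OF that, of \<nu>' m] False by (auto simp: p_def)
    qed
  qed (simp add: E(3))
  define g where "g \<rho> = l / pi * (inverse (\<i> * l * E (\<i> * l * (\<rho> - p))) + (\<rho> - p) * Q \<rho>)" for \<rho>
  have "(\<lambda>\<rho>. E (\<i> * l * (\<rho> - p))) holomorphic_on S"
    by (rule holomorphic_on_compose_gen[of "\<lambda>\<rho>. \<i> * l * (\<rho> - p)" S E UNIV, unfolded o_def])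
      (use E(1) in \<open>auto intro!: holomorphic_intros\<close>)
  then have g: "g holomorphic_on S"
    unfolding g_def using E0 l Q by (intro holomorphic_intros) auto
  have gp: "g p = 1 / (pi * \<i>)" using l by (simp add: g_def E(3) field_simps)
  then have gp0: "g p \<noteq> 0" by simp
  have eq: "nZ l \<rho> = g \<rho> / (\<rho> - p)" if "\<rho> \<in> S" "\<rho> \<noteq> p" for \<rho>
    using that E0[OF that(1)] l unfolding split[OF that(1)] g_def term_m by (simp add: field_simps)
  have ev: "\<forall>\<^sub>F \<rho> in at p. nZ l \<rho> = g \<rho> / (\<rho> - p)"
    using eventually_at_in_open[OF S] by eventually_elim (simp add: eq)
  have "is_pole (\<lambda>\<rho>. g \<rho> / (\<rho> - p) ^ 1) p"
    by (rule is_pole_basic[OF g S gp0]) simp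
  then have "is_pole (\<lambda>\<rho>. g \<rho> / (\<rho> - p)) p" by simp
  then show "is_pole (nZ l) (nZ_pole l \<nu> m)"
    using is_pole_cong[OF ev refl] by (simp add: p_def)
  show "zorder (nZ l) (nZ_pole l \<nu> m) = - 1"
    unfolding p_def[symmetric]
    by (rule zorder_eqI[OF S g gp0]) (simp add: eq power_int_minus divide_inverse)
  have "residue (nZ l) p = residue (\<lambda>\<rho>. g \<rho> / (\<rho> - p)) p"
    by (rule residue_cong[OF ev refl])
  also have "\<dots> = g p" by (rule residue_simple[OF S g])
  finally have "residue (nZ l) p = 1 / (pi * \<i>)" by (simp only: gp)
  then show "residue (nZ l) (nZ_pole l \<nu> m) = 1 / (pi * \<i>)" by (simp only: p_def)
qed

lemma nZ_meromorphic: "l > 0 \<Longrightarrow> nZ l meromorphic_on UNIV"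
proof (rule meromorphic_onI_open[where pts = "{nZ_pole l \<nu> m | \<nu> m. True}"])
  assume l: "l > 0"
  show "nZ l analytic_on UNIV - {nZ_pole l \<nu> m | \<nu> m. True}"
    using nZ_analytic[OF l] by (simp only: Compl_eq_Diff_UNIV)
  show "not_essential (nZ l) z" if "z \<in> {nZ_pole l \<nu> m | \<nu> m. True}" for z
    using that nZ_is_pole[OF l] by (auto intro!: is_pole_imp_not_essential)
  show "\<not> z islimpt {nZ_pole l \<nu> m | \<nu> m. True} \<inter> UNIV" for z
    using nZ_poles_not_islimpt[OF l] by simp
qed simp

section \<open>Hyperbolic area\<close>

lemma Complex_measurable [measurable]: "(\<lambda>p. Complex (fst p) (snd p)) \<in> borel_measurable (borel \<Otimes>\<^sub>M borel)"
  by (subst borel_measurable_complex_iff) simp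

text \<open>Lebesgue measure is determined by its values on boxes. The identity gives access to
  Tonelli in the real and imaginary parts.\<close>

lemma lborel_complex_eq_distr:
  "(lborel :: complex measure) = distr (lborel \<Otimes>\<^sub>M lborel) borel (\<lambda>p. Complex (fst p) (snd p))"
proof (rule lborel_eqI)
  fix l u :: complex assume le: "\<And>b. b \<in> Basis \<Longrightarrow> l \<bullet> b \<le> u \<bullet> b"
  have le': "Re l \<le> Re u" "Im l \<le> Im u" using le[of 1] le[of \<i>] by (auto simp: Basis_complex_def)
  have "emeasure (distr (lborel \<Otimes>\<^sub>M lborel) borel (\<lambda>p. Complex (fst p) (snd p))) (box l u) =
      emeasure (lborel \<Otimes>\<^sub>M lborel) ((\<lambda>p. Complex (fst p) (snd p)) -` box l u \<inter> space (lborel \<Otimes>\<^sub>M lborel))"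
    by (rule emeasure_distr) auto
  also have "(\<lambda>p. Complex (fst p) (snd p)) -` box l u \<inter> space (lborel \<Otimes>\<^sub>M lborel) =
      {Re l<..<Re u} \<times> {Im l<..<Im u}"
    by (auto simp: space_pair_measure in_box_complex_iff)
  also have "emeasure (lborel \<Otimes>\<^sub>M lborel) ({Re l<..<Re u} \<times> {Im l<..<Im u}) =
      ennreal ((Re u - Re l) * (Im u - Im l))"
    using le' by (subst lborel.emeasure_pair_measure_Times) (auto simp: ennreal_mult)
  also have "(Re u - Re l) * (Im u - Im l) = (\<Prod>b\<in>Basis. (u - l) \<bullet> b)"
    by (simp add: Basis_complex_def)
  finally show "emeasure (distr (lborel \<Otimes>\<^sub>M lborel) borel (\<lambda>p. Complex (fst p) (snd p))) (box l u) =
      ennreal (\<Prod>b\<in>Basis. (u - l) \<bullet> b)" .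
qed simp

text \<open>The substitution \<open>y = exp s\<close> is made on compact intervals, which exhaust
  the half-line and the line; monotone convergence does the rest. The index \<open>Suc n\<close>
  keeps the intervals from degenerating to a point.\<close>

lemma nn_integral_exp_substitution:
  assumes [measurable]: "G \<in> borel_measurable borel"
  shows "(\<integral>\<^sup>+y. indicator {0<..} y * (ennreal (1 / y) * G y) \<partial>lborel) = (\<integral>\<^sup>+s. G (exp s) \<partial>lborel)"
proof -
  have I: "(\<integral>\<^sup>+y. (ennreal (1 / y) * G y) * indicator {exp (- real (Suc n))..exp (real (Suc n))} y \<partial>lborel) =
      (\<integral>\<^sup>+s. G (exp s) * indicator {- real (Suc n)..real (Suc n)} s \<partial>lborel)" for n
  proof -
    have "(\<integral>\<^sup>+y. (ennreal (1 / y) * G y) * indicator {exp (- real (Suc n))..exp (real (Suc n))} y \<partial>lborel) =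
      (\<integral>\<^sup>+s. (ennreal (1 / exp s) * G (exp s)) * ennreal (exp s) * indicator {- real (Suc n)..real (Suc n)} s \<partial>lborel)"
      by (rule nn_integral_substitution_aux) (auto intro!: derivative_eq_intros continuous_intros)
    also have "\<dots> = (\<integral>\<^sup>+s. G (exp s) * indicator {- real (Suc n)..real (Suc n)} s \<partial>lborel)"
    proof (rule nn_integral_cong)
      fix s :: real
      have "ennreal (1 / exp s) * ennreal (exp s) = 1" by (simp flip: ennreal_mult)
      then show "ennreal (1 / exp s) * G (exp s) * ennreal (exp s) * indicator {- real (Suc n)..real (Suc n)} s =
          G (exp s) * indicator {- real (Suc n)..real (Suc n)} s"
        by (metis mult.assoc mult.commute mult_1)
    qed
    finally show ?thesis .
  qed
  have sup: "(SUP n. c * indicator (A n) x) = c * indicator (\<Union>n. A n) x" for c :: ennreal and A :: "nat \<Rightarrow> real set" and x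
  proof (cases "\<exists>n. x \<in> A n")
    case True
    then obtain n where "x \<in> A n" by blast
    then show ?thesis
      by (intro antisym SUP_least SUP_upper2[of n]) (auto split: split_indicator)
  qed auto
  have inc: "incseq (\<lambda>n x. g x * indicator (A n) x)" if "incseq A" for g :: "real \<Rightarrow> ennreal" and A :: "nat \<Rightarrow> real set"
    unfolding incseq_def le_fun_def
  proof (intro allI impI)
    fix m n :: nat and x :: real assume "m \<le> n"
    then have "A m \<subseteq> A n" using that by (auto simp: incseq_def)
    then show "g x * indicator (A m) x \<le> g x * indicator (A n) x" by (cases "x \<in> A m") auto
  qed
  have inc1: "incseq (\<lambda>n. {exp (- real (Suc n))..exp (real (Suc n))})" by (auto simp: incseq_def)
  have inc2: "incseq (\<lambda>n. {- real (Suc n)..real (Suc n)})" by (auto simp: incseq_def)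
  have arch: "\<exists>n. \<bar>s\<bar> \<le> real (Suc n)" for s
    using real_arch_simple[of "\<bar>s\<bar>"] by (metis le_SucI order_trans of_nat_le_iff order_refl)
  have U2: "(\<Union>n. {- real (Suc n)..real (Suc n)}) = UNIV"
  proof (intro equalityI subsetI)
    fix s :: real
    obtain n where "\<bar>s\<bar> \<le> real (Suc n)" using arch by blast
    then have "s \<in> {- real (Suc n)..real (Suc n)}" by auto
    then show "s \<in> (\<Union>n. {- real (Suc n)..real (Suc n)})" by blast
  qed simp
  have U1: "(\<Union>n. {exp (- real (Suc n))..exp (real (Suc n))}) = {0<..}"
  proof (intro equalityI subsetI)
    fix y :: real assume "y \<in> {0<..}"
    then have y: "y = exp (ln y)" by simp
    obtain n where "\<bar>ln y\<bar> \<le> real (Suc n)" using arch by blast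
    then have "y \<in> {exp (- real (Suc n))..exp (real (Suc n))}"
      by (subst y) (auto simp del: exp_ln exp_ln_iff)
    then show "y \<in> (\<Union>n. {exp (- real (Suc n))..exp (real (Suc n))})" by blast
  qed (auto intro: less_le_trans[OF exp_gt_zero])
  have "(\<integral>\<^sup>+y. indicator {0<..} y * (ennreal (1 / y) * G y) \<partial>lborel) =
      (\<integral>\<^sup>+y. (SUP n. (ennreal (1 / y) * G y) * indicator {exp (- real (Suc n))..exp (real (Suc n))} y) \<partial>lborel)"
    unfolding sup U1 by (simp add: mult.commute)
  also have "\<dots> = (SUP n. (\<integral>\<^sup>+y. (ennreal (1 / y) * G y) * indicator {exp (- real (Suc n))..exp (real (Suc n))} y \<partial>lborel))"
    by (intro nn_integral_monotone_convergence_SUP inc inc1) auto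
  also have "\<dots> = (SUP n. (\<integral>\<^sup>+s. G (exp s) * indicator {- real (Suc n)..real (Suc n)} s \<partial>lborel))"
    unfolding I ..
  also have "\<dots> = (\<integral>\<^sup>+s. (SUP n. G (exp s) * indicator {- real (Suc n)..real (Suc n)} s) \<partial>lborel)"
    by (intro nn_integral_monotone_convergence_SUP[symmetric] inc inc2) auto
  also have "\<dots> = (\<integral>\<^sup>+s. G (exp s) \<partial>lborel)" unfolding sup U2 by simp
  finally show ?thesis .
qed

lemma space_harea [simp]: "space harea = hplane"
  by (simp add: harea_def space_restrict_space)

lemma hplane_borel [measurable]: "hplane \<in> sets borel"
  unfolding hplane_def by measurable

lemma sets_harea: "sets harea = sets (restrict_space borel hplane)"
  by (simp add: harea_def cong: sets_restrict_space_cong)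

lemma measurable_harea: "f \<in> borel \<rightarrow>\<^sub>M N \<Longrightarrow> f \<in> harea \<rightarrow>\<^sub>M N"
  unfolding measurable_cong_sets[OF sets_harea refl] by (rule measurable_restrict_space1)

lemma sets_hareaD: "A \<in> sets harea \<Longrightarrow> A \<in> sets borel \<and> A \<subseteq> hplane"
  using hplane_borel by (auto simp: sets_harea sets_restrict_space_iff)

text \<open>In the coordinates \<open>z = e\<^sup>s (u + \<i>)\<close> the hyperbolic area is the Lebesgue measure \<open>du ds\<close>, and
  all Moebius generators become shears and reflections.\<close>
lemma nn_integral_harea:
  assumes f[measurable]: "f \<in> borel_measurable borel"
  shows "(\<integral>\<^sup>+z. f z \<partial>harea) = (\<integral>\<^sup>+s. \<integral>\<^sup>+u. f (Complex (exp s * u) (exp s)) \<partial>lborel \<partial>lborel)"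
proof -
  have "(\<integral>\<^sup>+z. f z \<partial>harea) =
    (\<integral>\<^sup>+z. ennreal (1 / (Im z)\<^sup>2) * f z \<partial>restrict_space lborel hplane)"
    unfolding harea_def by (rule nn_integral_density) (auto intro!: measurable_restrict_space1)
  also have "\<dots> = (\<integral>\<^sup>+z. (ennreal (1 / (Im z)\<^sup>2) * f z) * indicator hplane z \<partial>lborel)"
    by (rule nn_integral_restrict_space) simp
  also have "\<dots> = (\<integral>\<^sup>+p. (ennreal (1 / (snd p)\<^sup>2) * f (Complex (fst p) (snd p))) * indicator hplane (Complex (fst p) (snd p)) \<partial>(lborel \<Otimes>\<^sub>M lborel))"
    by (subst lborel_complex_eq_distr, subst nn_integral_distr) auto
  also have "\<dots> = (\<integral>\<^sup>+y. \<integral>\<^sup>+x. (ennreal (1 / y\<^sup>2) * f (Complex x y)) * indicator hplane (Complex x y) \<partial>lborel \<partial>lborel)"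
    by (subst lborel_pair.nn_integral_snd[symmetric]) auto
  also have "\<dots> = (\<integral>\<^sup>+y. indicator {0<..} y * (ennreal (1 / y) * (\<integral>\<^sup>+u. f (Complex (y * u) y) \<partial>lborel)) \<partial>lborel)"
  proof (rule nn_integral_cong)
    fix y :: real
    show "(\<integral>\<^sup>+x. (ennreal (1 / y\<^sup>2) * f (Complex x y)) * indicator hplane (Complex x y) \<partial>lborel) =
      indicator {0<..} y * (ennreal (1 / y) * (\<integral>\<^sup>+u. f (Complex (y * u) y) \<partial>lborel))"
    proof (cases "y > 0")
      case True
      have [measurable]: "(\<lambda>x. f (Complex x y)) \<in> borel_measurable borel"
        using measurable_compose[OF _ f, of "\<lambda>x. Complex x y" borel]
        by (auto simp: borel_measurable_complex_iff)
      \<comment> \<open>The density contributes \<open>1 / y^2\<close> and the substitution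
        \<open>x = y * u\<close> contributes \<open>y\<close>. The remaining \<open>1 / y\<close> is
        what \<open>y = exp s\<close> absorbs.\<close>
      have "ennreal (1 / y\<^sup>2) * ennreal y = ennreal (1 / y)"
        using True by (simp add: power2_eq_square flip: ennreal_mult)
      moreover have "(\<integral>\<^sup>+x. f (Complex x y) \<partial>lborel) = ennreal y * (\<integral>\<^sup>+u. f (Complex (y * u) y) \<partial>lborel)"
        using nn_integral_real_affine[of "\<lambda>x. f (Complex x y)" y 0] True by simp
      ultimately have "ennreal (1 / y\<^sup>2) * (\<integral>\<^sup>+x. f (Complex x y) \<partial>lborel) =
          ennreal (1 / y) * (\<integral>\<^sup>+u. f (Complex (y * u) y) \<partial>lborel)"
        by (simp flip: mult.assoc)
      then show ?thesis using True by (simp add: hplane_def nn_integral_cmult)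
    qed (simp add: hplane_def)
  qed
  also have "\<dots> = (\<integral>\<^sup>+s. \<integral>\<^sup>+u. f (Complex (exp s * u) (exp s)) \<partial>lborel \<partial>lborel)"
  proof (rule nn_integral_exp_substitution)
    have "(\<lambda>p. Complex (fst p * snd p) (fst p)) \<in> borel_measurable (borel \<Otimes>\<^sub>M borel)"
      by (subst borel_measurable_complex_iff) simp
    from measurable_compose[OF this f] have "(\<lambda>p. f (Complex (fst p * snd p) (fst p))) \<in> borel_measurable (borel \<Otimes>\<^sub>M borel)" .
    then show "(\<lambda>y. \<integral>\<^sup>+u. f (Complex (y * u) y) \<partial>lborel) \<in> borel_measurable borel"
      using lborel.borel_measurable_nn_integral_fst[of "\<lambda>p. f (Complex (fst p * snd p) (fst p))" borel]
      by (simp cong: measurable_cong_sets)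
  qed
  finally show ?thesis .
qed

section \<open>Invariance of the area and comparison of tilings\<close>

lemma nn_integral_harea_affine:
  assumes f[measurable]: "f \<in> borel_measurable borel" and "a > 0"
  shows "(\<integral>\<^sup>+z. f (of_real a * z + of_real b) \<partial>harea) = (\<integral>\<^sup>+z. f z \<partial>harea)"
proof -
  have [measurable]: "(\<lambda>p. Complex (exp (fst p) * snd p) (exp (fst p))) \<in> borel_measurable (borel \<Otimes>\<^sub>M borel)"
    by (subst borel_measurable_complex_iff) simp
  have m: "(\<lambda>u. f (Complex (exp s * u) (exp s))) \<in> borel_measurable borel" for s
    using measurable_compose[OF _ f, of "\<lambda>u. Complex (exp s * u) (exp s)" borel]
    by (auto simp: borel_measurable_complex_iff)
  define G where "G s = (\<integral>\<^sup>+u. f (Complex (exp s * u) (exp s)) \<partial>lborel)" for s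
  have G: "G \<in> borel_measurable borel" unfolding G_def
    using lborel.borel_measurable_nn_integral_fst[of "\<lambda>p. f (Complex (exp (fst p) * snd p) (exp (fst p)))" borel]
    by (simp cong: measurable_cong_sets)
  have "(\<integral>\<^sup>+z. f (of_real a * z + of_real b) \<partial>harea) =
    (\<integral>\<^sup>+s. \<integral>\<^sup>+u. f (of_real a * Complex (exp s * u) (exp s) + of_real b) \<partial>lborel \<partial>lborel)"
    by (rule nn_integral_harea) measurable
  also have "\<dots> = (\<integral>\<^sup>+s. G (ln a + 1 * s) \<partial>lborel)"
  proof (rule nn_integral_cong)
    fix s :: real
    \<comment> \<open>In coordinates the affine map adds \<open>ln a\<close> to \<open>s\<close> and
      \<open>b / (a * exp s)\<close> to \<open>u\<close>. With \<open>s\<close> fixed the inner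
      integral is merely translated, and the outer one is translated afterwards.\<close>
    have e: "exp (ln a + 1 * s) = a * exp s" using assms(2) by (simp add: exp_add)
    have "of_real a * Complex (exp s * u) (exp s) + of_real b =
        Complex (exp (ln a + 1 * s) * (b / (a * exp s) + 1 * u)) (exp (ln a + 1 * s))" for u
      unfolding e using assms(2) by (simp add: complex_eq_iff field_simps)
    then have "(\<integral>\<^sup>+u. f (of_real a * Complex (exp s * u) (exp s) + of_real b) \<partial>lborel) =
      (\<integral>\<^sup>+u. f (Complex (exp (ln a + 1 * s) * (b / (a * exp s) + 1 * u)) (exp (ln a + 1 * s))) \<partial>lborel)"
      by simp
    also have "\<dots> = G (ln a + 1 * s)"
      unfolding G_def using nn_integral_real_affine[OF m[of "ln a + 1 * s"], of 1 "b / (a * exp s)"] by simp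
    finally show "(\<integral>\<^sup>+u. f (of_real a * Complex (exp s * u) (exp s) + of_real b) \<partial>lborel) = G (ln a + 1 * s)" .
  qed
  also have "\<dots> = (\<integral>\<^sup>+s. G s \<partial>lborel)"
    using nn_integral_real_affine[OF G, of 1 "ln a"] by simp
  also have "\<dots> = (\<integral>\<^sup>+z. f z \<partial>harea)" unfolding G_def by (rule nn_integral_harea[OF f, symmetric])
  finally show ?thesis .
qed

text \<open>In coordinates \<open>- 1 / z\<close> replaces \<open>u\<close> by \<open>- u\<close>
  and \<open>s\<close> by \<open>- s - ln (1 + u^2)\<close>. The reflection of \<open>s\<close>
  depends on \<open>u\<close>, so the integral over \<open>s\<close> has to be the inner one; this
  is why the order is exchanged twice.\<close>

lemma nn_integral_harea_inversion:
  assumes f[measurable]: "f \<in> borel_measurable borel"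
  shows "(\<integral>\<^sup>+z. f (- 1 / z) \<partial>harea) = (\<integral>\<^sup>+z. f z \<partial>harea)"
proof -
  let ?\<Phi> = "\<lambda>s u. Complex (exp s * u) (exp s)"
  have \<Phi>[measurable]: "(\<lambda>p. ?\<Phi> (fst p) (snd p)) \<in> borel_measurable (borel \<Otimes>\<^sub>M borel)"
    by (subst borel_measurable_complex_iff) simp
  have m2: "(\<lambda>p. f (?\<Phi> (fst p) (snd p))) \<in> borel_measurable (borel \<Otimes>\<^sub>M borel)"
    by measurable
  have [measurable]: "(\<lambda>p. ?\<Phi> (snd p) (fst p)) \<in> borel_measurable (borel \<Otimes>\<^sub>M borel)"
    by (subst borel_measurable_complex_iff) simp
  have m3: "(\<lambda>p. f (?\<Phi> (snd p) (fst p))) \<in> borel_measurable (borel \<Otimes>\<^sub>M borel)"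
    by measurable
  have m2': "(\<lambda>p. f (- 1 / ?\<Phi> (fst p) (snd p))) \<in> borel_measurable (borel \<Otimes>\<^sub>M borel)"
    by measurable
  have m: "(\<lambda>s. f (?\<Phi> s u)) \<in> borel_measurable borel" for u
    using measurable_compose[OF _ f, of "\<lambda>s. ?\<Phi> s u" borel]
    by (auto simp: borel_measurable_complex_iff)
  have swap: "(\<integral>\<^sup>+s. \<integral>\<^sup>+u. F (s, u) \<partial>lborel \<partial>lborel) = (\<integral>\<^sup>+u. \<integral>\<^sup>+s. F (s, u) \<partial>lborel \<partial>lborel)"
    if "F \<in> borel_measurable (borel \<Otimes>\<^sub>M borel)" for F :: "real \<times> real \<Rightarrow> ennreal"
    using that by (intro lborel_pair.Fubini'[symmetric]) (simp cong: measurable_cong_sets)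
  define G where "G u = (\<integral>\<^sup>+s. f (?\<Phi> s u) \<partial>lborel)" for u
  have G: "G \<in> borel_measurable borel" unfolding G_def
    using lborel.borel_measurable_nn_integral_fst[of "\<lambda>p. f (?\<Phi> (snd p) (fst p))" borel] m3
    by (simp cong: measurable_cong_sets)
  have "(\<integral>\<^sup>+z. f (- 1 / z) \<partial>harea) = (\<integral>\<^sup>+s. \<integral>\<^sup>+u. f (- 1 / ?\<Phi> s u) \<partial>lborel \<partial>lborel)"
    by (rule nn_integral_harea) measurable
  also have "\<dots> = (\<integral>\<^sup>+u. \<integral>\<^sup>+s. f (- 1 / ?\<Phi> s u) \<partial>lborel \<partial>lborel)"
    using swap[OF m2'] by simp
  also have "\<dots> = (\<integral>\<^sup>+u. G (0 + (- 1) * u) \<partial>lborel)"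
  proof (rule nn_integral_cong)
    fix u :: real
    have u: "1 + u\<^sup>2 > 0" by (simp add: add_pos_nonneg)
    have "- 1 / ?\<Phi> s u = ?\<Phi> (- ln (1 + u\<^sup>2) + (- 1) * s) (0 + (- 1) * u)" for s
    proof -
      have e: "exp (- ln (1 + u\<^sup>2) + (- 1) * s) = 1 / (exp s * (1 + u\<^sup>2))"
        using u by (simp add: exp_diff exp_minus field_simps)
      have nz: "?\<Phi> s u \<noteq> 0" by (simp add: complex_eq_iff)
      have "?\<Phi> (- ln (1 + u\<^sup>2) + (- 1) * s) (0 + (- 1) * u) * ?\<Phi> s u = - 1"
      proof -
        define E where "E = 1 / (exp s * (1 + u\<^sup>2))"
        have "E * (exp s * (1 + u\<^sup>2)) = 1" using u by (simp add: E_def)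
        then show ?thesis unfolding e E_def[symmetric]
          by (simp add: complex_eq_iff power2_eq_square algebra_simps)
      qed
      then show ?thesis unfolding nonzero_divide_eq_eq[OF nz] by (rule sym)
    qed
    then have "(\<integral>\<^sup>+s. f (- 1 / ?\<Phi> s u) \<partial>lborel) =
        (\<integral>\<^sup>+s. f (?\<Phi> (- ln (1 + u\<^sup>2) + (- 1) * s) (0 + (- 1) * u)) \<partial>lborel)" by simp
    also have "\<dots> = G (0 + (- 1) * u)"
      unfolding G_def using nn_integral_real_affine[OF m[of "0 + (- 1) * u"], of "- 1" "- ln (1 + u\<^sup>2)"] by simp
    finally show "(\<integral>\<^sup>+s. f (- 1 / ?\<Phi> s u) \<partial>lborel) = G (0 + (- 1) * u)" .
  qed
  also have "\<dots> = (\<integral>\<^sup>+u. G u \<partial>lborel)"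
    using nn_integral_real_affine[OF G, of "- 1" 0] by simp
  also have "\<dots> = (\<integral>\<^sup>+s. \<integral>\<^sup>+u. f (?\<Phi> s u) \<partial>lborel \<partial>lborel)"
    unfolding G_def using swap[OF m2] by simp
  also have "\<dots> = (\<integral>\<^sup>+z. f z \<partial>harea)" by (rule nn_integral_harea[OF f, symmetric])
  finally show ?thesis .
qed

lemma mob_measurable [measurable]: "mob a b c d \<in> borel_measurable borel"
  unfolding mob_def[abs_def] by measurable

text \<open>For \<open>c \<noteq> 0\<close> the map is \<open>a / c - 1 / (c^2 * z + c * d)\<close>:
  affine, then inversion, then translation. For \<open>c = 0\<close> it is affine already.\<close>

lemma nn_integral_harea_mob:
  assumes f[measurable]: "f \<in> borel_measurable borel" and ad: "a * d - b * c = 1"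
  shows "(\<integral>\<^sup>+z. f (mob a b c d z) \<partial>harea) = (\<integral>\<^sup>+z. f z \<partial>harea)"
proof (cases "c = 0")
  case True
  then have "a * d = 1" using ad by simp
  then have d: "d = 1 / a" and "a \<noteq> 0" by (auto simp: eq_divide_eq mult.commute)
  then have "mob a b c d z = of_real (a * a) * z + of_real (a * b)" for z
    using True by (simp add: mob_def d field_simps)
  moreover have "a * a > 0" using \<open>a \<noteq> 0\<close> by (simp add: zero_less_mult_iff) linarith
  ultimately show ?thesis using nn_integral_harea_affine[OF f, of "a * a" "a * b"] by simp
next
  case False
  have c2: "c * c > 0" using False by (simp add: zero_less_mult_iff) linarith
  have "mob a b c d z = of_real 1 * (- 1 / (of_real (c * c) * z + of_real (c * d))) + of_real (a / c)"
    if "z \<in> hplane" for z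
  proof -
    let ?w = "of_real c * z + of_real d :: complex"
    have w: "?w \<noteq> 0" by (rule mob_denominator[OF ad that])
    have "of_real a * ?w - (of_real a * z + of_real b) * of_real c = (of_real (a * d - b * c) :: complex)"
      by (simp add: algebra_simps)
    also have "\<dots> = 1" using ad by simp
    finally have "(of_real a * z + of_real b) * of_real c = of_real a * ?w - 1" by (simp only: algebra_simps)
    then have "mob a b c d z * of_real c = of_real a - 1 / ?w"
      using w unfolding mob_def by (simp add: field_simps)
    then have "mob a b c d z = (of_real a - 1 / ?w) / of_real c"
      using False by (simp add: eq_divide_eq)
    also have "\<dots> = of_real (a / c) - 1 / (of_real c * ?w)"
      by (simp add: diff_divide_distrib mult.commute)
    finally show ?thesis by (simp add: algebra_simps)
  qed
  then have "(\<integral>\<^sup>+z. f (mob a b c d z) \<partial>harea) =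
    (\<integral>\<^sup>+z. f (of_real 1 * (- 1 / (of_real (c * c) * z + of_real (c * d))) + of_real (a / c)) \<partial>harea)"
    by (intro nn_integral_cong) simp
  also have "\<dots> = (\<integral>\<^sup>+z. f (of_real 1 * (- 1 / z) + of_real (a / c)) \<partial>harea)"
    by (rule nn_integral_harea_affine[of "\<lambda>z. f (of_real 1 * (- 1 / z) + of_real (a / c))", OF _ c2]) measurable
  also have "\<dots> = (\<integral>\<^sup>+z. f (of_real 1 * z + of_real (a / c)) \<partial>harea)"
    by (rule nn_integral_harea_inversion) measurable
  also have "\<dots> = (\<integral>\<^sup>+z. f z \<partial>harea)" by (rule nn_integral_harea_affine[OF f]) simp
  finally show ?thesis .
qed

lemma real_moebius_measurable:
  assumes "real_moebius f"
  shows "f \<in> harea \<rightarrow>\<^sub>M harea"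
proof -
  obtain a b c d where ad: "a * d - b * c = 1" and fm: "\<And>z. z \<in> hplane \<Longrightarrow> f z = mob a b c d z"
    using assms by (auto simp: real_moebius_def)
  have "mob a b c d \<in> harea \<rightarrow>\<^sub>M restrict_space borel hplane"
    by (intro measurable_restrict_space2 measurable_harea) (auto simp: mob_in_hplane[OF ad])
  then have "mob a b c d \<in> harea \<rightarrow>\<^sub>M harea" unfolding measurable_cong_sets[OF refl sets_harea] .
  then show ?thesis using fm by (subst measurable_cong) auto
qed

lemma real_moebius_distr_harea:
  assumes "real_moebius f"
  shows "distr harea harea f = harea"
proof (rule measure_eqI)
  obtain a b c d where ad: "a * d - b * c = 1" and fm: "\<And>z. z \<in> hplane \<Longrightarrow> f z = mob a b c d z"
    using assms by (auto simp: real_moebius_def)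
  fix A assume "A \<in> sets (distr harea harea f)"
  then have A: "A \<in> sets harea" by simp
  then have [measurable]: "A \<in> sets borel" using sets_hareaD by blast
  have "emeasure (distr harea harea f) A = (\<integral>\<^sup>+z. indicator A z \<partial>distr harea harea f)" using A by simp
  also have "\<dots> = (\<integral>\<^sup>+z. indicator A (f z) \<partial>harea)"
    using A by (intro nn_integral_distr real_moebius_measurable[OF assms]) simp
  also have "\<dots> = (\<integral>\<^sup>+z. indicator A (mob a b c d z) \<partial>harea)"
    by (intro nn_integral_cong) (simp add: fm)
  also have "\<dots> = (\<integral>\<^sup>+z. indicator A z \<partial>harea)" by (rule nn_integral_harea_mob[OF _ ad]) simp
  also have "\<dots> = emeasure harea A" using A by simp
  finally show "emeasure (distr harea harea f) A = emeasure harea A" .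
qed simp

text \<open>Both sides are the integral of \<open>f\<close> over all pieces \<open>D \<inter> T\<^sub>n F\<close>.\<close>
lemma nn_integral_tiling_unique:
  fixes T :: "int \<Rightarrow> 'a \<Rightarrow> 'a" and f :: "'a \<Rightarrow> ennreal"
  assumes T: "\<And>n. T n \<in> M \<rightarrow>\<^sub>M M" "\<And>n. distr M M (T n) = M"
    "\<And>n z. z \<in> space M \<Longrightarrow> T (- n) (T n z) = z"
    and D: "D \<in> sets M" "AE z in M. \<exists>!n. T n z \<in> D"
    and F: "F \<in> sets M" "AE z in M. \<exists>!n. T n z \<in> F"
    and f: "f \<in> borel_measurable M" "\<And>n z. z \<in> space M \<Longrightarrow> f (T n z) = f z"
  shows "(\<integral>\<^sup>+z. f z * indicator F z \<partial>M) = (\<integral>\<^sup>+z. f z * indicator D z \<partial>M)"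
proof -
  note [measurable] = T(1) D(1) F(1) f(1)
  \<comment> \<open>Uniqueness of the index becomes a counting integral equal to 1, which can be
    inserted under the integral so that Tonelli applies.\<close>
  have count: "(\<integral>\<^sup>+n. indicator B (S n) \<partial>count_space UNIV) = (1::ennreal)" if ex1: "\<exists>!n. S n \<in> B"
    for S :: "int \<Rightarrow> 'a" and B
  proof -
    obtain n0 where "S n0 \<in> B" "\<And>n. S n \<in> B \<Longrightarrow> n = n0" using ex1 by blast
    then have n0: "{n. S n \<in> B} = {n0}" by blast
    have "(\<integral>\<^sup>+n. indicator B (S n) \<partial>count_space UNIV) = (\<integral>\<^sup>+n. indicator {n. S n \<in> B} n \<partial>count_space UNIV)"
      by (intro nn_integral_cong) (auto split: split_indicator)
    also have "\<dots> = emeasure (count_space UNIV) {n. S n \<in> B}" by (rule nn_integral_indicator) simp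
    also have "\<dots> = 1" unfolding n0 by simp
    finally show ?thesis .
  qed
  have inv: "(\<integral>\<^sup>+z. g (T n z) \<partial>M) = (\<integral>\<^sup>+z. g z \<partial>M)" if "g \<in> borel_measurable M" for g :: "'a \<Rightarrow> ennreal" and n
  proof -
    have "(\<integral>\<^sup>+z. g z \<partial>distr M M (T n)) = (\<integral>\<^sup>+z. g (T n z) \<partial>M)"
      by (rule nn_integral_distr[OF T(1)]) (simp add: that)
    then show ?thesis by (simp add: T(2))
  qed
  have "(\<integral>\<^sup>+z. f z * indicator F z \<partial>M) =
      (\<integral>\<^sup>+z. (\<integral>\<^sup>+n. f z * indicator F z * indicator D (T n z) \<partial>count_space UNIV) \<partial>M)"
  proof (rule nn_integral_cong_AE)
    show "AE z in M. f z * indicator F z = (\<integral>\<^sup>+n. f z * indicator F z * indicator D (T n z) \<partial>count_space UNIV)"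
      using D(2)
    proof eventually_elim
      case (elim z)
      have "(\<integral>\<^sup>+n. f z * indicator F z * indicator D (T n z) \<partial>count_space UNIV) =
          f z * indicator F z * (\<integral>\<^sup>+n. indicator D (T n z) \<partial>count_space UNIV)"
        by (rule nn_integral_cmult) simp
      then show ?case unfolding count[OF elim] by simp
    qed
  qed
  also have "\<dots> = (\<integral>\<^sup>+n. (\<integral>\<^sup>+z. f z * indicator F z * indicator D (T n z) \<partial>M) \<partial>count_space UNIV)"
    by (rule nn_integral_count_space_nn_integral) auto
  also have "\<dots> = (\<integral>\<^sup>+n. (\<integral>\<^sup>+w. f w * indicator D w * indicator F (T (- n) w) \<partial>M) \<partial>count_space UNIV)"
  proof (rule nn_integral_cong)
    fix n
    have "(\<integral>\<^sup>+z. f z * indicator F z * indicator D (T n z) \<partial>M) =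
      (\<integral>\<^sup>+z. (\<lambda>w. f w * indicator D w * indicator F (T (- n) w)) (T n z) \<partial>M)"
      by (intro nn_integral_cong) (simp add: T(3) f(2) mult_ac)
    also have "\<dots> = (\<integral>\<^sup>+w. f w * indicator D w * indicator F (T (- n) w) \<partial>M)"
      by (rule inv) measurable
    finally show "(\<integral>\<^sup>+z. f z * indicator F z * indicator D (T n z) \<partial>M) =
      (\<integral>\<^sup>+w. f w * indicator D w * indicator F (T (- n) w) \<partial>M)" .
  qed
  also have "\<dots> = (\<integral>\<^sup>+w. (\<integral>\<^sup>+n. f w * indicator D w * indicator F (T (- n) w) \<partial>count_space UNIV) \<partial>M)"
    by (rule nn_integral_count_space_nn_integral[symmetric]) auto
  also have "\<dots> = (\<integral>\<^sup>+w. f w * indicator D w \<partial>M)"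
  proof (rule nn_integral_cong_AE)
    show "AE w in M. (\<integral>\<^sup>+n. f w * indicator D w * indicator F (T (- n) w) \<partial>count_space UNIV) = f w * indicator D w"
      using F(2)
    proof eventually_elim
      case (elim w)
      then obtain n0 where n0: "T n0 w \<in> F" "\<And>n. T n w \<in> F \<Longrightarrow> n = n0" by blast
      have ex1: "\<exists>!n. T (- n) w \<in> F"
      proof (rule ex1I[of _ "- n0"])
        show "n = - n0" if "T (- n) w \<in> F" for n using n0(2)[OF that] by simp
      qed (simp add: n0(1))
      have "(\<integral>\<^sup>+n. f w * indicator D w * indicator F (T (- n) w) \<partial>count_space UNIV) =
          f w * indicator D w * (\<integral>\<^sup>+n. indicator F (T (- n) w) \<partial>count_space UNIV)"
        by (rule nn_integral_cmult) simp
      then show ?case unfolding count[of "\<lambda>n. T (- n) w", OF ex1] by simp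
    qed
  qed
  finally show ?thesis .
qed

section \<open>The cyclic group and its fundamental domains\<close>

locale scaling_conjugate =
  fixes \<gamma> M N :: "complex \<Rightarrow> complex" and l :: real
  assumes gamma_Bij: "\<gamma> \<in> Bij hplane" and l_pos: "l > 0"
    and M: "real_moebius M" and N: "real_moebius N"
    and NM: "\<And>z. z \<in> hplane \<Longrightarrow> N (M z) = z"
    and MN: "\<And>z. z \<in> hplane \<Longrightarrow> M (N z) = z"
    and gamma_eq: "\<And>z. z \<in> hplane \<Longrightarrow> \<gamma> z = N (of_real (exp l) * M z)"
begin

text \<open>A closed form for the powers of \<open>\<gamma>\<close>, in which the exponent enters
  only through the dilation factor. Computations use \<open>T\<close>; the group power is translated
  once, in \<open>isom_power_eq\<close>.\<close>

definition T :: "int \<Rightarrow> complex \<Rightarrow> complex" where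
  "T n z = N (of_real (exp (of_int n * l)) * M z)"

lemma real_moebius_scaling: "real_moebius (\<lambda>z. of_real (exp c) * z)"
  using real_moebius_affine[of "exp c" 0] by simp

lemma real_moebius_T: "real_moebius (T n)"
  unfolding T_def[abs_def] by (intro real_moebius_comp[OF N] real_moebius_comp[OF real_moebius_scaling] M)

lemmas T_in = real_moebius_in[OF real_moebius_T]

lemma M_T: "z \<in> hplane \<Longrightarrow> M (T n z) = of_real (exp (of_int n * l)) * M z"
  unfolding T_def by (intro MN real_moebius_in[OF real_moebius_scaling] real_moebius_in[OF M])

lemma T_T: "z \<in> hplane \<Longrightarrow> T m (T n z) = T (m + n) z"
  unfolding T_def[of m] T_def[of "m + n"] by (simp add: M_T distrib_right exp_add mult.assoc)

lemma T_0: "z \<in> hplane \<Longrightarrow> T 0 z = z"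
  by (simp add: T_def NM)

lemma T_inverse: "z \<in> hplane \<Longrightarrow> T (- n) (T n z) = z" "z \<in> hplane \<Longrightarrow> T n (T (- n) z) = z"
  by (simp_all add: T_T T_0)

lemma restrict_T_Bij: "restrict (T n) hplane \<in> Bij hplane"
proof -
  have "bij_betw (T n) hplane hplane"
    by (rule bij_betw_byWitness[of _ "T (- n)"]) (auto simp: T_inverse T_in)
  then show ?thesis by (simp add: Bij_def)
qed

text \<open>The restrictions of \<open>T n\<close> multiply like the integers and \<open>T 1\<close>
  restricts to \<open>\<gamma>\<close>; induction in both directions does the rest. Restriction is
  what turns agreement on the half-plane into equality of functions.\<close>

lemma isom_power_eq: "isom_power \<gamma> n = restrict (T n) hplane"
proof -
  let ?G = "BijGroup hplane"
  interpret G: group ?G by (rule group_BijGroup)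
  have car: "restrict (T n) hplane \<in> carrier ?G" for n using restrict_T_Bij by (simp add: BijGroup_def)
  have g1: "\<gamma> = restrict (T 1) hplane"
    using gamma_Bij by (intro extensionalityI[of _ hplane]) (auto simp: Bij_def gamma_eq T_def)
  have mult: "restrict (T m) hplane \<otimes>\<^bsub>?G\<^esub> restrict (T n) hplane = restrict (T (m + n)) hplane" for m n
    using restrict_T_Bij by (auto simp: BijGroup_def compose_def T_T T_in fun_eq_iff)
  have one: "\<one>\<^bsub>?G\<^esub> = restrict (T 0) hplane" by (auto simp: BijGroup_def T_0 fun_eq_iff)
  have inv: "inv\<^bsub>?G\<^esub> (restrict (T 1) hplane) = restrict (T (- 1)) hplane"
    by (rule G.inv_equality) (simp_all add: mult one car)
  have "restrict (T 1) hplane [^]\<^bsub>?G\<^esub> n = restrict (T n) hplane"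
  proof (induction n rule: int_induct[where k = 0])
    case base
    show ?case by (simp add: one)
  next
    case (step1 i)
    have "restrict (T 1) hplane [^]\<^bsub>?G\<^esub> (i + 1) = restrict (T 1) hplane [^]\<^bsub>?G\<^esub> i \<otimes>\<^bsub>?G\<^esub> restrict (T 1) hplane [^]\<^bsub>?G\<^esub> (1::int)"
      by (rule G.int_pow_mult[OF car])
    also have "\<dots> = restrict (T (i + 1)) hplane" by (simp only: step1.IH G.int_pow_1[OF car] mult)
    finally show ?case .
  next
    case (step2 i)
    have "restrict (T 1) hplane [^]\<^bsub>?G\<^esub> (i - 1) = restrict (T 1) hplane [^]\<^bsub>?G\<^esub> i \<otimes>\<^bsub>?G\<^esub> inv\<^bsub>?G\<^esub> (restrict (T 1) hplane [^]\<^bsub>?G\<^esub> (1::int))"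
      by (rule G.int_pow_diff[OF car])
    also have "\<dots> = restrict (T (i - 1)) hplane"
      by (simp only: step2.IH G.int_pow_1[OF car] inv mult diff_conv_add_uminus)
    finally show ?case .
  qed
  then show ?thesis unfolding isom_power_def by (subst g1)
qed

lemma isom_power_apply: "z \<in> hplane \<Longrightarrow> isom_power \<gamma> n z = T n z"
  by (simp add: isom_power_eq)

section \<open>Translates, fundamental domains and the standard strip\<close>

lemma isom_power_image_iff:
  assumes "F \<subseteq> hplane" "z \<in> hplane"
  shows "z \<in> isom_power \<gamma> n ` F \<longleftrightarrow> T (- n) z \<in> F"
proof
  assume "z \<in> isom_power \<gamma> n ` F"
  then obtain w where "w \<in> F" "z = T n w" using assms isom_power_apply by auto
  then show "T (- n) z \<in> F" using assms T_inverse by auto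
next
  assume F: "T (- n) z \<in> F"
  have "isom_power \<gamma> n (T (- n) z) = z"
    using assms T_in by (simp add: isom_power_apply T_inverse)
  then show "z \<in> isom_power \<gamma> n ` F" using F by (metis imageI)
qed

lemma T_eqD: assumes "z \<in> hplane" "T n z = T m z" shows "n = m"
proof -
  have "Im (M z) > 0" using real_moebius_in[OF M assms(1)] by (simp add: hplane_def)
  moreover have "Im (M (T n z)) = Im (M (T m z))" using assms(2) by simp
  ultimately have "exp (of_int n * l) = exp (of_int m * l)" by (simp add: M_T assms(1))
  then show ?thesis using l_pos by simp
qed

text \<open>The group is given as a set, and overlaps are null only for distinct elements; this lets
  distinct exponents be used instead.\<close>

lemma inj_isom_power: assumes "isom_power \<gamma> n = isom_power \<gamma> m" shows "n = m"
proof -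
  have I: "\<i> \<in> hplane" by (simp add: hplane_def)
  show ?thesis using assms T_eqD[OF I] isom_power_apply[OF I] by metis
qed

text \<open>The group is countable, so the null overlaps of all pairs of translates can be discarded
  at once. What is left is a unique representative on almost every orbit, the form needed for
  comparing domains.\<close>

lemma fundamental_domain_tiling:
  assumes "fundamental_domain (cyclic_isoms \<gamma>) F"
  shows "F \<in> sets harea" "AE z in harea. \<exists>!n. T n z \<in> F"
proof -
  have F: "F \<in> sets harea" "AE z in harea. z \<in> (\<Union>g\<in>cyclic_isoms \<gamma>. g ` F)"
    "\<And>g g'. g \<in> cyclic_isoms \<gamma> \<Longrightarrow> g' \<in> cyclic_isoms \<gamma> \<Longrightarrow> g \<noteq> g' \<Longrightarrow> g ` F \<inter> g' ` F \<in> null_sets harea"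
    using assms unfolding fundamental_domain_def by blast+
  show "F \<in> sets harea" by (rule F(1))
  then have Fh: "F \<subseteq> hplane" using sets_hareaD by blast
  have "AE z in harea. n \<noteq> m \<longrightarrow> z \<notin> isom_power \<gamma> n ` F \<inter> isom_power \<gamma> m ` F" for n m
  proof (cases "n = m")
    case False
    have "isom_power \<gamma> n ` F \<inter> isom_power \<gamma> m ` F \<in> null_sets harea"
      using False inj_isom_power[of n m] by (intro F(3)) (auto simp: cyclic_isoms_def)
    from AE_not_in[OF this] show ?thesis by simp
  qed simp
  then have "AE z in harea. \<forall>n m. n \<noteq> m \<longrightarrow> z \<notin> isom_power \<gamma> n ` F \<inter> isom_power \<gamma> m ` F"
    by (simp add: AE_all_countable)
  moreover have "AE z in harea. z \<in> hplane" using AE_space[of harea] by simp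
  ultimately show "AE z in harea. \<exists>!n. T n z \<in> F" using F(2)
  proof eventually_elim
    case (elim z)
    then obtain n where n: "z \<in> isom_power \<gamma> n ` F" by (auto simp: cyclic_isoms_def)
    show ?case
    proof (rule ex1I[of _ "- n"])
      show "T (- n) z \<in> F" using n isom_power_image_iff[OF Fh elim(2)] by blast
      fix k assume "T k z \<in> F"
      then have "z \<in> isom_power \<gamma> (- k) ` F" using isom_power_image_iff[OF Fh elim(2), of "- k"] by simp
      then show "k = - n" using n elim(1) by (metis IntI minus_minus)
    qed
  qed
qed

text \<open>After applying \<open>M\<close> this is \<open>0 \<le> s < l\<close> in the coordinates
  of the area formula, with \<open>u\<close> unrestricted. It is half-open so that every orbit meets
  it exactly once, without exceptional points.\<close>

definition strip :: "complex set" where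
  "strip = {z \<in> hplane. 0 \<le> ln (Im (M z)) \<and> ln (Im (M z)) < l}"

lemma M_measurable [measurable]: "M \<in> harea \<rightarrow>\<^sub>M harea" "M \<in> harea \<rightarrow>\<^sub>M borel"
proof -
  show M1: "M \<in> harea \<rightarrow>\<^sub>M harea" by (rule real_moebius_measurable[OF M])
  show "M \<in> harea \<rightarrow>\<^sub>M borel"
    using measurable_compose[OF M1 measurable_harea[of "\<lambda>z. z"]] by simp
qed

lemma strip_sets [measurable]: "strip \<in> sets harea"
proof -
  have "strip = {z \<in> space harea. 0 \<le> ln (Im (M z)) \<and> ln (Im (M z)) < l}" by (simp add: strip_def)
  also have "\<dots> \<in> sets harea" by measurable
  finally show ?thesis .
qed

text \<open>\<open>T n\<close> adds \<open>n * l\<close> to \<open>ln (Im (M z))\<close>, so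
  membership in the strip says that \<open>- n\<close> is the floor of
  \<open>ln (Im (M z)) / l\<close>.\<close>

lemma strip_ex1: assumes z: "z \<in> hplane" shows "\<exists>!n. T n z \<in> strip"
proof -
  have "Im (M z) > 0" using real_moebius_in[OF M z] by (simp add: hplane_def)
  then have ln: "ln (Im (M (T n z))) = of_int n * l + ln (Im (M z))" for n
    by (simp add: M_T[OF z] ln_mult)
  have iff: "T n z \<in> strip \<longleftrightarrow> - n = \<lfloor>ln (Im (M z)) / l\<rfloor>" for n
  proof -
    have "- n = \<lfloor>ln (Im (M z)) / l\<rfloor> \<longleftrightarrow> - of_int n * l \<le> ln (Im (M z)) \<and> ln (Im (M z)) < (1 - of_int n) * l"
      unfolding eq_commute[of "- n"] floor_eq_iff using l_pos
      by (simp add: pos_le_divide_eq pos_divide_less_eq)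
    moreover have "(1 - of_int n) * l = l - of_int n * l" by (simp add: left_diff_distrib)
    moreover have "T n z \<in> strip \<longleftrightarrow> 0 \<le> of_int n * l + ln (Im (M z)) \<and> of_int n * l + ln (Im (M z)) < l"
      unfolding strip_def using T_in[OF z, of n] ln by simp
    ultimately show ?thesis by auto
  qed
  show ?thesis unfolding iff by (rule ex1I[of _ "- \<lfloor>ln (Im (M z)) / l\<rfloor>"]) auto
qed

lemma fundamental_domain_strip: "fundamental_domain (cyclic_isoms \<gamma>) strip"
proof -
  have sub: "strip \<subseteq> hplane" by (auto simp: strip_def)
  have "z \<in> (\<Union>g\<in>cyclic_isoms \<gamma>. g ` strip)" if z: "z \<in> hplane" for z
  proof -
    obtain n where "T n z \<in> strip" using strip_ex1[OF z] by blast
    then have "z \<in> isom_power \<gamma> (- n) ` strip" using isom_power_image_iff[OF sub z, of "- n"] by simp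
    then show ?thesis by (auto simp: cyclic_isoms_def)
  qed
  moreover have "isom_power \<gamma> n ` strip \<inter> isom_power \<gamma> m ` strip = {}" if "isom_power \<gamma> n \<noteq> isom_power \<gamma> m" for n m
  proof (rule ccontr)
    assume "isom_power \<gamma> n ` strip \<inter> isom_power \<gamma> m ` strip \<noteq> {}"
    then obtain z where z: "z \<in> isom_power \<gamma> n ` strip" "z \<in> isom_power \<gamma> m ` strip" by blast
    have zh: "z \<in> hplane" using z(1) sub isom_power_apply T_in by auto
    have "T (- n) z \<in> strip" "T (- m) z \<in> strip" using z isom_power_image_iff[OF sub zh] by blast+
    then have "n = m" using strip_ex1[OF zh] by (metis minus_equation_iff)
    then show False using that by simp
  qed
  ultimately show ?thesis
    unfolding fundamental_domain_def using AE_space[of harea]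
    by (auto simp: cyclic_isoms_def elim!: eventually_mono)
qed

text \<open>The level sets of \<open>slope\<close> are the hypercycles around the axis of \<open>\<gamma>\<close>.\<close>
definition slope :: "complex \<Rightarrow> real" where
  "slope z = Re (M z) / Im (M z)"

lemma slope_measurable [measurable]: "slope \<in> borel_measurable harea"
  unfolding slope_def[abs_def] by measurable

lemma slope_T: "z \<in> hplane \<Longrightarrow> slope (T n z) = slope z"
  by (simp add: slope_def M_T)

text \<open>The slope is constant on orbits, so any domain may be exchanged for
  \<open>strip\<close>. There the variables separate, and \<open>s\<close> contributes only the
  length \<open>l\<close> of its interval.\<close>

lemma nn_integral_fundamental_domain:
  assumes F: "fundamental_domain (cyclic_isoms \<gamma>) F" and \<phi>[measurable]: "\<phi> \<in> borel_measurable borel"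
  shows "(\<integral>\<^sup>+z. \<phi> (slope z) * indicator F z \<partial>harea) = ennreal l * (\<integral>\<^sup>+u. \<phi> u \<partial>lborel)"
proof -
  define g where "g w = \<phi> (Re w / Im w) * indicator {w. 0 \<le> ln (Im w) \<and> ln (Im w) < l} w" for w
  have gm: "g \<in> borel_measurable borel" unfolding g_def by measurable
  have "(\<integral>\<^sup>+z. \<phi> (slope z) * indicator F z \<partial>harea) = (\<integral>\<^sup>+z. \<phi> (slope z) * indicator strip z \<partial>harea)"
    by (rule nn_integral_tiling_unique[of T])
      (auto simp: real_moebius_measurable real_moebius_T real_moebius_distr_harea T_inverse slope_T
        intro: fundamental_domain_tiling[OF F] fundamental_domain_tiling[OF fundamental_domain_strip])
  also have "\<dots> = (\<integral>\<^sup>+z. g (M z) \<partial>harea)"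
    by (intro nn_integral_cong) (auto simp: g_def slope_def strip_def split: split_indicator)
  also have "\<dots> = (\<integral>\<^sup>+w. g w \<partial>distr harea harea M)"
    by (rule nn_integral_distr[symmetric]) (auto intro: measurable_harea gm)
  also have "\<dots> = (\<integral>\<^sup>+w. g w \<partial>harea)" by (simp add: real_moebius_distr_harea[OF M])
  also have "\<dots> = (\<integral>\<^sup>+s. \<integral>\<^sup>+u. g (Complex (exp s * u) (exp s)) \<partial>lborel \<partial>lborel)"
    by (rule nn_integral_harea[OF gm])
  also have "\<dots> = (\<integral>\<^sup>+s. \<integral>\<^sup>+u. indicator {0..<l} s * \<phi> u \<partial>lborel \<partial>lborel)"
    by (intro nn_integral_cong) (auto simp: g_def split: split_indicator)
  also have "\<dots> = (\<integral>\<^sup>+s. indicator {0..<l} s * (\<integral>\<^sup>+u. \<phi> u \<partial>lborel) \<partial>lborel)"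
    by (intro nn_integral_cong nn_integral_cmult) simp
  also have "\<dots> = ennreal l * (\<integral>\<^sup>+u. \<phi> u \<partial>lborel)"
    using l_pos by (subst nn_integral_multc) auto
  finally show ?thesis .
qed

text \<open>The nonnegative case, applied to indicators, says that the area on \<open>F\<close>
  pushes forward under \<open>slope\<close> to \<open>l\<close> times Lebesgue measure.
  Integrability and value for complex integrands follow together from this identity of
  measures.\<close>

lemma has_quotient_integral_slope:
  fixes \<phi> :: "real \<Rightarrow> complex"
  assumes \<phi>: "integrable lborel \<phi>" and f: "\<And>z. z \<in> hplane \<Longrightarrow> f z = \<phi> (slope z)"
  shows "has_quotient_integral (cyclic_isoms \<gamma>) f (of_real l * (LBINT u. \<phi> u))"
proof -
  have [measurable]: "\<phi> \<in> borel_measurable borel" using \<phi> by (simp add: borel_measurable_integrable)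
  have "set_integrable harea F f \<and> set_lebesgue_integral harea F f = of_real l * (LBINT u. \<phi> u)"
    if F: "fundamental_domain (cyclic_isoms \<gamma>) F" for F
  proof -
    have [measurable]: "F \<in> sets harea" using fundamental_domain_tiling(1)[OF F] .
    let ?\<mu> = "density harea (\<lambda>z. ennreal (indicator F z))"
    have d: "distr ?\<mu> borel slope = density lborel (\<lambda>_. ennreal l)"
    proof (rule measure_eqI)
      fix A assume "A \<in> sets (distr ?\<mu> borel slope)"
      then have [measurable]: "A \<in> sets borel" by simp
      have "emeasure (distr ?\<mu> borel slope) A = (\<integral>\<^sup>+u. indicator A u \<partial>distr ?\<mu> borel slope)" by simp
      also have "\<dots> = (\<integral>\<^sup>+z. indicator A (slope z) \<partial>?\<mu>)"
        by (rule nn_integral_distr) (auto simp: measurable_cong_sets[OF sets_density refl])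
      also have "\<dots> = (\<integral>\<^sup>+z. ennreal (indicator F z) * indicator A (slope z) \<partial>harea)"
        by (rule nn_integral_density) auto
      also have "\<dots> = (\<integral>\<^sup>+z. indicator A (slope z) * indicator F z \<partial>harea)"
        by (intro nn_integral_cong) (auto split: split_indicator)
      also have "\<dots> = ennreal l * (\<integral>\<^sup>+u. indicator A u \<partial>lborel)"
        by (rule nn_integral_fundamental_domain[OF F]) simp
      also have "\<dots> = (\<integral>\<^sup>+u. indicator A u \<partial>density lborel (\<lambda>_. ennreal l))"
        by (subst nn_integral_density) (auto simp: nn_integral_cmult)
      also have "\<dots> = emeasure (density lborel (\<lambda>_. ennreal l)) A" by simp
      finally show "emeasure (distr ?\<mu> borel slope) A = emeasure (density lborel (\<lambda>_. ennreal l)) A" .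
    qed simp
    have m: "slope \<in> ?\<mu> \<rightarrow>\<^sub>M borel" by simp
    have int: "integrable (density lborel (\<lambda>_. ennreal l)) \<phi>"
      using \<phi> l_pos by (subst integrable_density) auto
    then have i1: "integrable ?\<mu> (\<lambda>z. \<phi> (slope z))"
      unfolding d[symmetric] by (subst (asm) integrable_distr_eq) auto
    then have i2: "integrable harea (\<lambda>z. indicator F z *\<^sub>R \<phi> (slope z))"
      by (subst (asm) integrable_density) auto
    have cong: "indicator F z *\<^sub>R \<phi> (slope z) = indicator F z *\<^sub>R f z" if "z \<in> space harea" for z
      using that f by simp
    have "set_integrable harea F f"
      unfolding set_integrable_def using i2 by (subst (asm) Bochner_Integration.integrable_cong[OF refl cong]) auto
    moreover have "set_lebesgue_integral harea F f = (LINT z|harea. indicator F z *\<^sub>R \<phi> (slope z))"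
      unfolding set_lebesgue_integral_def by (rule Bochner_Integration.integral_cong[OF refl cong[symmetric]])
    moreover have "\<dots> = (LINT z|?\<mu>. \<phi> (slope z))"
      by (rule integral_density[symmetric]) auto
    moreover have "\<dots> = (LINT u|distr ?\<mu> borel slope. \<phi> u)"
      by (rule integral_distr[symmetric, OF m]) simp
    moreover have "\<dots> = (LINT u|lborel. l *\<^sub>R \<phi> u)"
      unfolding d by (rule integral_density) (use l_pos in auto)
    moreover have "\<dots> = of_real l * (LBINT u. \<phi> u)"
      by (simp add: scaleR_conv_of_real)
    ultimately show ?thesis by simp
  qed
  then show ?thesis unfolding has_quotient_integral_def using fundamental_domain_strip by blast
qed

end

section \<open>Fourier transforms of functions on a strip\<close>

lemma integrable_powr_decay:
  fixes \<delta> :: real assumes "\<delta> > 0"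
  shows "integrable lborel (\<lambda>x. (1 + \<bar>x\<bar>) powr (- 1 - \<delta>))"
proof -
  have "set_integrable lborel (einterval (ereal 0) \<infinity>) (\<lambda>x. (1 + x) powr (- 1 - \<delta>))"
  proof (rule interval_integral_FTC_nonneg(1)[where F = "\<lambda>x. - ((1 + x) powr (- \<delta>)) / \<delta>" and A = "- 1 / \<delta>" and B = 0])
    show "DERIV (\<lambda>x. - ((1 + x) powr (- \<delta>)) / \<delta>) x :> (1 + x) powr (- 1 - \<delta>)"
      if "ereal 0 < ereal x" for x
    proof -
      have eq: "- 1 - \<delta> = - \<delta> - 1" by simp
      show ?thesis unfolding eq
        using that assms by (auto intro!: derivative_eq_intros simp: powr_diff[symmetric])
    qed
    show "((( \<lambda>x. - ((1 + x) powr (- \<delta>)) / \<delta>) \<circ> real_of_ereal) \<longlongrightarrow> - 1 / \<delta>) (at_right (ereal 0))"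
      unfolding ereal_tendsto_simps using assms
      by (auto intro!: tendsto_eq_intros)
    have "((\<lambda>x. (1 + x) powr (- \<delta>)) \<longlongrightarrow> 0) at_top"
      using assms by (intro tendsto_neg_powr filterlim_tendsto_add_at_top[OF tendsto_const filterlim_ident]) auto
    then have "((\<lambda>x. - ((1 + x) powr (- \<delta>)) / \<delta>) \<longlongrightarrow> - 0 / \<delta>) at_top"
      using assms by (intro tendsto_divide tendsto_minus tendsto_const) auto
    then show "(((\<lambda>x. - ((1 + x) powr (- \<delta>)) / \<delta>) \<circ> real_of_ereal) \<longlongrightarrow> 0) (at_left \<infinity>)"
      unfolding ereal_tendsto_simps by simp
  qed (auto intro!: continuous_intros)
  then have 1: "integrable lborel (\<lambda>x. indicator {0<..} x * (1 + x) powr (- 1 - \<delta>))"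
    by (simp add: set_integrable_def einterval_def greaterThan_def)
  from lborel_integrable_real_affine[OF this, of "- 1" 0]
  have 2: "integrable lborel (\<lambda>x. indicator {0<..} (- x) * (1 - x) powr (- 1 - \<delta>))" by simp
  have "integrable lborel (\<lambda>x. indicator {0<..} x * (1 + x) powr (- 1 - \<delta>) +
      indicator {0<..} (- x) * (1 - x) powr (- 1 - \<delta>))"
    by (rule Bochner_Integration.integrable_add[OF 1 2])
  moreover have "AE x in lborel. indicator {0<..} x * (1 + x) powr (- 1 - \<delta>) +
      indicator {0<..} (- x) * (1 - x) powr (- 1 - \<delta>) = (1 + \<bar>x\<bar>) powr (- 1 - \<delta>)"
    using AE_lborel_singleton[of "0::real"] by eventually_elim (auto split: split_indicator)
  ultimately show ?thesis by (subst integrable_cong_AE[symmetric]) auto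
qed

lemma integrable_pair_mult:
  fixes f g :: "real \<Rightarrow> real"
  assumes f: "integrable lborel f" and g: "integrable lborel g"
  shows "integrable (lborel \<Otimes>\<^sub>M lborel) (\<lambda>p. f (fst p) * g (snd p))"
proof -
  have [measurable]: "f \<in> borel_measurable borel" "g \<in> borel_measurable borel"
    using borel_measurable_integrable[OF f] borel_measurable_integrable[OF g] by simp_all
  show ?thesis
  proof (rule lborel_pair.Fubini_integrable)
    have "integrable lborel (\<lambda>x. \<bar>f x\<bar> * (LBINT y. \<bar>g y\<bar>))" using f by (intro integrable_mult_left) auto
    then show "integrable lborel (\<lambda>x. LBINT y. norm (f (fst (x, y)) * g (snd (x, y))))"
      by (simp add: abs_mult)
    show "AE x in lborel. integrable lborel (\<lambda>y. f (fst (x, y)) * g (snd (x, y)))"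
      using g by simp
  qed measurable
qed

lemma set_integrable_exp_decay:
  fixes e :: real assumes "e > 0"
  shows "set_integrable lborel {a<..} (\<lambda>t. exp (- (e * t)))"
proof -
  have "set_integrable lborel (einterval (ereal a) \<infinity>) (\<lambda>t. exp (- (e * t)))"
  proof (rule interval_integral_FTC_nonneg(1)[where F = "\<lambda>t. - exp (- (e * t)) / e" and A = "- exp (- (e * a)) / e" and B = 0])
    show "DERIV (\<lambda>t. - exp (- (e * t)) / e) x :> exp (- (e * x))" for x
      using assms by (auto intro!: derivative_eq_intros)
    show "(((\<lambda>t. - exp (- (e * t)) / e) \<circ> real_of_ereal) \<longlongrightarrow> - exp (- (e * a)) / e) (at_right (ereal a))"
      unfolding ereal_tendsto_simps using assms by (auto intro!: tendsto_eq_intros)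
    have "((\<lambda>t. exp (- (e * t))) \<longlongrightarrow> 0) at_top"
      using assms by real_asymp
    then have "((\<lambda>t. - exp (- (e * t)) / e) \<longlongrightarrow> - 0 / e) at_top"
      using assms by (intro tendsto_divide tendsto_minus tendsto_const) auto
    then show "(((\<lambda>t. - exp (- (e * t)) / e) \<circ> real_of_ereal) \<longlongrightarrow> 0) (at_left \<infinity>)"
      unfolding ereal_tendsto_simps by simp
  qed (auto intro!: continuous_intros)
  then show ?thesis by (simp add: einterval_def greaterThan_def)
qed

lemma integral_exp_decay:
  fixes z :: complex assumes z: "Im z < 0"
  shows "(LBINT t:{a<..}. exp (- \<i> * z * of_real t)) = exp (- \<i> * z * of_real a) / (\<i> * z)"
proof -
  have z0: "z \<noteq> 0" using z by auto
  have n: "norm (exp (- \<i> * z * of_real t)) = exp (- (- Im z * t))" for t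
    by (simp add: norm_exp_eq_Re)
  have int: "set_integrable lborel {a<..} (\<lambda>t. exp (- \<i> * z * of_real t))"
    by (rule set_integrable_bound[OF set_integrable_exp_decay[of "- Im z" a]])
      (use z in \<open>auto simp: n set_borel_measurable_def\<close>)
  have "(LBINT t=ereal a..\<infinity>. exp (- \<i> * z * of_real t)) = 0 - (- exp (- \<i> * z * of_real a) / (\<i> * z))"
  proof (rule interval_integral_FTC_integrable[where F = "\<lambda>t. - exp (- \<i> * z * of_real t) / (\<i> * z)"])
    show "((\<lambda>t. - exp (- \<i> * z * of_real t) / (\<i> * z)) has_vector_derivative exp (- \<i> * z * of_real x)) (at x)" for x
      using z0 by (auto intro!: derivative_eq_intros has_vector_derivative_real_field simp: field_simps)
    show "set_integrable lborel (einterval (ereal a) \<infinity>) (\<lambda>t. exp (- \<i> * z * of_real t))"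
      using int by (simp add: einterval_def greaterThan_def)
    show "(((\<lambda>t. - exp (- \<i> * z * of_real t) / (\<i> * z)) \<circ> real_of_ereal) \<longlongrightarrow> - exp (- \<i> * z * of_real a) / (\<i> * z)) (at_right (ereal a))"
      unfolding ereal_tendsto_simps using z0 by (auto intro!: tendsto_eq_intros)
    have "((\<lambda>t. exp (- (- Im z * t))) \<longlongrightarrow> 0) at_top" using z by real_asymp
    then have "((\<lambda>t. exp (- \<i> * z * of_real t)) \<longlongrightarrow> 0) at_top"
      unfolding n[symmetric] by (rule tendsto_norm_zero_cancel)
    then have "((\<lambda>t. - exp (- \<i> * z * of_real t) / (\<i> * z)) \<longlongrightarrow> - 0 / (\<i> * z)) at_top"
      using z0 by (intro tendsto_divide tendsto_minus tendsto_const) auto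
    then show "(((\<lambda>t. - exp (- \<i> * z * of_real t) / (\<i> * z)) \<circ> real_of_ereal) \<longlongrightarrow> 0) (at_left \<infinity>)"
      unfolding ereal_tendsto_simps by simp
  qed (auto intro!: continuous_intros)
  then show ?thesis
    by (simp add: interval_lebesgue_integral_def einterval_def greaterThan_def)
qed

lemma convex_strip: "convex {z. \<bar>Im z\<bar> < \<sigma>}"
proof -
  have "{z. \<bar>Im z\<bar> < \<sigma>} = {z. Im z < \<sigma>} \<inter> {z. Im z > - \<sigma>}" by auto
  then show ?thesis by (auto intro!: convex_Int convex_halfspace_Im_lt convex_halfspace_Im_gt)
qed

lemma open_strip: "open {z. \<bar>Im z\<bar> < \<sigma>}"
  by (intro open_Collect_less continuous_intros)

text \<open>The exponent \<open>- 1 - \<delta>\<close> is one power weaker than the decay of the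
  test function, so that \<open>h\<close> and \<open>\<rho> * h \<rho>\<close> are both
  instances.\<close>

locale strip_function =
  fixes f :: "complex \<Rightarrow> complex" and \<sigma> \<delta> C :: real
  assumes sigma_pos: "\<sigma> > 0" and delta_pos: "\<delta> > 0"
    and holo: "f holomorphic_on {z. \<bar>Im z\<bar> < \<sigma>}"
    and bound: "\<And>z. \<bar>Im z\<bar> < \<sigma> \<Longrightarrow> cmod (f z) \<le> C * (1 + \<bar>Re z\<bar>) powr (- 1 - \<delta>)"
begin

lemma C_nonneg: "C \<ge> 0"
  using bound[of 0] sigma_pos by (auto intro: order_trans[OF norm_ge_zero])

lemma line_continuous: "\<bar>y\<bar> < \<sigma> \<Longrightarrow> continuous_on UNIV (\<lambda>x. f (Complex x y))"
  by (intro continuous_on_compose2[OF holomorphic_on_imp_continuous_on[OF holo]])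
    (auto simp: Complex_eq intro!: continuous_intros)

lemma line_measurable [measurable]: "\<bar>y\<bar> < \<sigma> \<Longrightarrow> (\<lambda>x. f (Complex x y)) \<in> borel_measurable borel"
  by (intro borel_measurable_continuous_onI line_continuous)

lemma line_bound:
  assumes "\<bar>y\<bar> < \<sigma>"
  shows "cmod (f (Complex x y) * exp (- \<i> * Complex x y * of_real t)) \<le>
    C * exp (y * t) * (1 + \<bar>x\<bar>) powr (- 1 - \<delta>)"
proof -
  have "cmod (exp (- \<i> * Complex x y * of_real t)) = exp (y * t)" by (simp add: norm_exp_eq_Re)
  then show ?thesis using mult_right_mono[OF bound[of "Complex x y"], of "exp (y * t)"] assms
    by (simp add: norm_mult mult_ac)
qed

lemma line_integrable:
  assumes "\<bar>y\<bar> < \<sigma>"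
  shows "integrable lborel (\<lambda>x. f (Complex x y) * exp (- \<i> * Complex x y * of_real t))"
proof (rule Bochner_Integration.integrable_bound)
  show "integrable lborel (\<lambda>x. C * exp (y * t) * (1 + \<bar>x\<bar>) powr (- 1 - \<delta>))"
    by (intro integrable_mult_right integrable_powr_decay delta_pos)
  show "AE x in lborel. norm (f (Complex x y) * exp (- \<i> * Complex x y * of_real t)) \<le>
      norm (C * exp (y * t) * (1 + \<bar>x\<bar>) powr (- 1 - \<delta>))"
    using line_bound[OF assms] C_nonneg by (auto simp: abs_mult)
  have "continuous_on UNIV (\<lambda>x. f (Complex x y) * exp (- \<i> * Complex x y * of_real t))"
    unfolding Complex_eq by (intro continuous_intros line_continuous[unfolded Complex_eq] assms)
  then show "(\<lambda>x. f (Complex x y) * exp (- \<i> * Complex x y * of_real t)) \<in> borel_measurable lborel"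
    by (simp add: borel_measurable_continuous_onI)
qed

definition ft :: "real \<Rightarrow> complex" where
  "ft t = (LBINT x. f (of_real x) * exp (- \<i> * of_real x * of_real t))"

text \<open>Cauchy's theorem in the form of a primitive \<open>G\<close> on the convex strip:
  integrals along the two horizontal lines are limits of differences of \<open>G\<close>, and their
  discrepancy is a difference of \<open>G\<close> across the vertical sides, which tends to
  0.\<close>

lemma ft_shift:
  assumes e: "0 < e" "e < \<sigma>"
  shows "ft t = (LBINT x. f (Complex x (- e)) * exp (- \<i> * Complex x (- e) * of_real t))"
proof -
  let ?S = "{z. \<bar>Im z\<bar> < \<sigma>}"
  let ?F = "\<lambda>z. f z * exp (- \<i> * z * of_real t)"
  have "?F holomorphic_on ?S" by (intro holomorphic_intros holo)
  then obtain G where G: "\<And>z. z \<in> ?S \<Longrightarrow> (G has_field_derivative ?F z) (at z within ?S)"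
    using holomorphic_convex_primitive'[OF convex_strip open_strip] by blast
  have G': "(G has_field_derivative ?F z) (at z)" if "z \<in> ?S" for z
    using G[OF that] at_within_open[OF that open_strip] by simp
  have line: "(\<lambda>n. G (Complex (real n) y) - G (Complex (- real n) y)) \<longlonglongrightarrow> (LBINT x. ?F (Complex x y))"
    if y: "\<bar>y\<bar> < \<sigma>" for y
  proof -
    have "((\<lambda>x. G (Complex x y)) has_vector_derivative ?F (Complex x y)) (at x)" for x
    proof -
      have d: "((\<lambda>x. Complex x y) has_vector_derivative 1) (at x)"
        unfolding Complex_eq by (auto intro!: derivative_eq_intros)
      have "((G \<circ> (\<lambda>x. Complex x y)) has_vector_derivative 1 * ?F (Complex x y)) (at x)"
        by (rule field_vector_diff_chain_at[OF d]) (use G' y in auto)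
      then show ?thesis by (simp add: o_def)
    qed
    moreover have "continuous_on A (\<lambda>x. ?F (Complex x y))" for A
      by (intro continuous_intros continuous_on_subset[OF line_continuous[OF y]])
        (auto simp: Complex_eq intro!: continuous_intros)
    ultimately have I: "(LBINT x. indicator {- real n..real n} x *\<^sub>R ?F (Complex x y)) =
        G (Complex (real n) y) - G (Complex (- real n) y)" for n
      by (intro integral_FTC_Icc) (auto intro: has_vector_derivative_at_within)
    have "(\<lambda>n. LBINT x. indicator {- real n..real n} x *\<^sub>R ?F (Complex x y)) \<longlonglongrightarrow> (LBINT x. ?F (Complex x y))"
    proof (rule integral_dominated_convergence[where w = "\<lambda>x. norm (?F (Complex x y))"])
      show "integrable lborel (\<lambda>x. norm (?F (Complex x y)))"
        using line_integrable[OF y] by (rule integrable_norm)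
      show "AE x in lborel. (\<lambda>n. indicator {- real n..real n} x *\<^sub>R ?F (Complex x y)) \<longlonglongrightarrow> ?F (Complex x y)"
      proof (rule AE_I2)
        fix x :: real
        have "\<forall>\<^sub>F n in sequentially. real n \<ge> \<bar>x\<bar>"
          using filterlim_real_sequentially by (auto simp: filterlim_at_top)
        then have "\<forall>\<^sub>F n in sequentially. indicator {- real n..real n} x *\<^sub>R ?F (Complex x y) = ?F (Complex x y)"
          by eventually_elim (auto simp: indicator_def)
        then show "(\<lambda>n. indicator {- real n..real n} x *\<^sub>R ?F (Complex x y)) \<longlonglongrightarrow> ?F (Complex x y)"
          by (rule tendsto_eventually)
      qed
      show "(\<lambda>x. ?F (Complex x y)) \<in> borel_measurable lborel"
        using borel_measurable_integrable[OF line_integrable[OF y]] .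
      then show "(\<lambda>x. indicator {- real n..real n} x *\<^sub>R ?F (Complex x y)) \<in> borel_measurable lborel" for n
        by (intro borel_measurable_scaleR) auto
    qed (auto split: split_indicator)
    then show ?thesis unfolding I .
  qed
  \<comment> \<open>Bounds the integrand on the vertical sides at real part \<open>n\<close> or
    \<open>- n\<close>: the exponential has modulus \<open>exp (y * t)\<close> with \<open>y\<close>
    between \<open>- e\<close> and 0.\<close>
  define B where "B n = C * exp (e * \<bar>t\<bar>) * (1 + real n) powr (- 1 - \<delta>)" for n
  have side: "cmod (G (Complex x 0) - G (Complex x (- e))) \<le> B n * e" if x: "\<bar>x\<bar> = real n" for x n
  proof -
    have "norm (G (Complex x 0) - G (Complex x (- e))) \<le> B n * norm (Complex x 0 - Complex x (- e))"
    proof (rule field_differentiable_bound[where S = "closed_segment (Complex x 0) (Complex x (- e))"])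
      fix z assume "z \<in> closed_segment (Complex x 0) (Complex x (- e))"
      then obtain u where u: "0 \<le> u" "u \<le> 1" "z = (1 - u) *\<^sub>R Complex x 0 + u *\<^sub>R Complex x (- e)"
        by (auto simp: in_segment)
      have z: "z = Complex x (- (u * e))" unfolding u(3) by (simp add: complex_eq_iff algebra_simps)
      have ue: "u * e \<le> e" "0 \<le> u * e" using u e by (simp_all add: mult_left_le_one_le)
      have y: "\<bar>- (u * e)\<bar> < \<sigma>"
        unfolding abs_minus_cancel abs_of_nonneg[OF ue(2)] using ue e by linarith
      show "(G has_field_derivative ?F z) (at z within closed_segment (Complex x 0) (Complex x (- e)))"
        by (rule has_field_derivative_at_within[OF G']) (use y z in simp)
      have "- (u * e) * t \<le> \<bar>u * e\<bar> * \<bar>t\<bar>" by (metis abs_ge_minus_self abs_mult mult_minus_left)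
      also have "\<dots> \<le> e * \<bar>t\<bar>" using ue by (intro mult_right_mono) auto
      finally have "exp (- (u * e) * t) \<le> exp (e * \<bar>t\<bar>)" by simp
      then have "C * exp (- (u * e) * t) * (1 + \<bar>x\<bar>) powr (- 1 - \<delta>) \<le> B n"
        unfolding B_def x using C_nonneg by (intro mult_right_mono mult_left_mono) auto
      then show "norm (?F z) \<le> B n" unfolding z using line_bound[OF y, of x t] by linarith
    qed auto
    also have "Complex x 0 - Complex x (- e) = Complex 0 e" by (simp add: complex_eq_iff)
    also have "norm (Complex 0 e) = e" using e by (simp add: cmod_def)
    finally show ?thesis .
  qed
  have B0: "B \<longlonglongrightarrow> 0"
  proof -
    have "(\<lambda>n. (1 + real n) powr (- 1 - \<delta>)) \<longlonglongrightarrow> 0"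
      using delta_pos by (intro tendsto_neg_powr filterlim_tendsto_add_at_top[OF tendsto_const filterlim_real_sequentially]) auto
    then show ?thesis unfolding B_def by (intro tendsto_mult_right_zero)
  qed
  let ?D = "\<lambda>n. (G (Complex (real n) 0) - G (Complex (- real n) 0)) - (G (Complex (real n) (- e)) - G (Complex (- real n) (- e)))"
  have "?D \<longlonglongrightarrow> (LBINT x. ?F (Complex x 0)) - (LBINT x. ?F (Complex x (- e)))"
    using e by (intro tendsto_diff line) auto
  moreover have "?D \<longlonglongrightarrow> 0"
  proof (rule tendsto_norm_zero_cancel, rule tendsto_sandwich[OF _ _ tendsto_const])
    show "(\<lambda>n. 2 * (B n * e)) \<longlonglongrightarrow> 0" by (intro tendsto_mult_right_zero tendsto_mult_left_zero B0)
    show "\<forall>\<^sub>F n in sequentially. norm (?D n) \<le> 2 * (B n * e)"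
    proof (rule always_eventually, rule allI)
      fix n
      have D: "?D n = (G (Complex (real n) 0) - G (Complex (real n) (- e))) -
        (G (Complex (- real n) 0) - G (Complex (- real n) (- e)))" by simp
      have "cmod (G (Complex (real n) 0) - G (Complex (real n) (- e))) \<le> B n * e"
        "cmod (G (Complex (- real n) 0) - G (Complex (- real n) (- e))) \<le> B n * e"
        using side by simp_all
      then show "norm (?D n) \<le> 2 * (B n * e)"
        unfolding D using norm_triangle_ineq4[of "G (Complex (real n) 0) - G (Complex (real n) (- e))" "G (Complex (- real n) 0) - G (Complex (- real n) (- e))"] by linarith
    qed
  qed (auto intro: always_eventually)
  ultimately have "(LBINT x. ?F (Complex x 0)) - (LBINT x. ?F (Complex x (- e))) = 0"
    by (rule LIMSEQ_unique)
  then show ?thesis unfolding ft_def complex_of_real_def by simp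
qed

text \<open>The line is shifted downwards because \<open>exp (- \<i> * z * t)\<close> is small there
  for positive \<open>t\<close>, the only range in which the bound serves.\<close>

lemma ft_bound:
  assumes e: "0 < e" "e < \<sigma>"
  shows "cmod (ft t) \<le> C * (LBINT x. (1 + \<bar>x\<bar>) powr (- 1 - \<delta>)) * exp (- (e * t))"
proof -
  have y: "\<bar>- e\<bar> < \<sigma>" using e by simp
  have "cmod (ft t) \<le> (LBINT x. C * exp (- e * t) * (1 + \<bar>x\<bar>) powr (- 1 - \<delta>))"
    unfolding ft_shift[OF e]
    by (rule order_trans[OF integral_norm_bound integral_mono])
      (use line_bound[OF y, of _ t] line_integrable[OF y, of t] in
        \<open>auto intro!: integrable_mult_right integrable_powr_decay delta_pos\<close>)
  also have "\<dots> = C * (LBINT x. (1 + \<bar>x\<bar>) powr (- 1 - \<delta>)) * exp (- (e * t))" by simp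
  finally show ?thesis .
qed

lemma joint_measurable:
  assumes "\<bar>y\<bar> < \<sigma>"
  shows "(\<lambda>p. f (Complex (snd p) y) * exp (- \<i> * Complex (snd p) y * of_real (fst p))) \<in> borel_measurable (borel \<Otimes>\<^sub>M borel)"
proof -
  note [measurable] = line_measurable[OF assms]
  have [measurable]: "(\<lambda>x. Complex x y) \<in> borel_measurable borel" by (subst borel_measurable_complex_iff) simp
  show ?thesis by measurable
qed

lemma ft_measurable [measurable]: "ft \<in> borel_measurable borel"
proof -
  have "ft = (\<lambda>t. LBINT x. f (Complex x 0) * exp (- \<i> * Complex x 0 * of_real t))"
    by (simp add: ft_def[abs_def] complex_of_real_def)
  also have "\<dots> \<in> borel_measurable borel"
    using joint_measurable[of 0] sigma_pos
    by (intro lborel.borel_measurable_lebesgue_integral) (simp add: case_prod_beta cong: measurable_cong_sets)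
  finally show ?thesis .
qed

lemma ft_set_integrable: "set_integrable lborel {a<..} ft"
proof -
  have e: "0 < \<sigma> / 2" "\<sigma> / 2 < \<sigma>" using sigma_pos by auto
  show ?thesis
  proof (rule set_integrable_bound[where f = "\<lambda>t. C * (LBINT x. (1 + \<bar>x\<bar>) powr (- 1 - \<delta>)) * exp (- (\<sigma> / 2 * t))"])
    show "set_integrable lborel {a<..} (\<lambda>t. C * (LBINT x. (1 + \<bar>x\<bar>) powr (- 1 - \<delta>)) * exp (- (\<sigma> / 2 * t)))"
      using set_integrable_exp_decay[OF e(1)] by (rule set_integrable_mult_right)
    show "set_borel_measurable lborel {a<..} ft" by (simp add: set_borel_measurable_def)
  qed (use ft_bound[OF e] in \<open>auto intro: order_trans[OF _ abs_ge_self]\<close>)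
qed

end

section \<open>The Abel transform\<close>

lemma cosh_real_measurable [measurable]: "(cosh :: real \<Rightarrow> real) \<in> borel_measurable borel"
  by (intro borel_measurable_continuous_onI continuous_intros)

text \<open>In the addition formula \<open>cosh \<tau>\<close> is lowered to
  \<open>sinh \<tau>\<close>. This compares the Legendre kernel with
  \<open>1 / sqrt (exp s - 1)\<close>, \<open>s = t - \<tau>\<close>, which has an elementary
  antiderivative.\<close>

lemma cosh_diff_ge:
  fixes \<tau> t :: real assumes "0 < \<tau>" "\<tau> < t"
  shows "sinh \<tau> * (exp (t - \<tau>) - 1) \<le> cosh t - cosh \<tau>"
proof -
  have "cosh t = cosh \<tau> * cosh (t - \<tau>) + sinh \<tau> * sinh (t - \<tau>)"
    using cosh_add[of \<tau> "t - \<tau>"] by simp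
  moreover have "sinh \<tau> * (cosh (t - \<tau>) - 1) \<le> cosh \<tau> * (cosh (t - \<tau>) - 1)"
    using sinh_le_cosh_real cosh_real_ge_1[of "t - \<tau>"] by (intro mult_right_mono) auto
  moreover have "exp (t - \<tau>) = cosh (t - \<tau>) + sinh (t - \<tau>)" by (simp add: cosh_plus_sinh)
  ultimately show ?thesis by (simp add: algebra_simps)
qed

lemma arctan_sqrt_exp_integral:
  "set_integrable lborel {0<..} (\<lambda>s. 1 / sqrt (exp s - 1))"
  "(LBINT s:{0<..}. 1 / sqrt (exp s - 1)) = pi"
proof -
  let ?F = "\<lambda>s. 2 * arctan (sqrt (exp s - 1))"
  have D: "DERIV ?F s :> 1 / sqrt (exp s - 1)" if "ereal 0 < ereal s" for s
  proof -
    have "exp s > 1" using that by simp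
    then have "sqrt (exp s - 1) > 0" "(sqrt (exp s - 1))\<^sup>2 = exp s - 1" by auto
    then show ?thesis using \<open>exp s > 1\<close> by (auto intro!: derivative_eq_intros simp: field_simps)
  qed
  have A: "((?F \<circ> real_of_ereal) \<longlongrightarrow> 0) (at_right (ereal 0))"
    unfolding ereal_tendsto_simps by (auto intro!: tendsto_eq_intros)
  have "filterlim (\<lambda>s. sqrt (exp s - 1)) at_top at_top" by real_asymp
  then have "(?F \<longlongrightarrow> 2 * (pi / 2)) at_top"
    by (intro tendsto_mult tendsto_const filterlim_compose[OF tendsto_arctan_at_top])
  then have B: "((?F \<circ> real_of_ereal) \<longlongrightarrow> pi) (at_left \<infinity>)"
    unfolding ereal_tendsto_simps by simp
  have 1: "set_integrable lborel (einterval (ereal 0) \<infinity>) (\<lambda>s. 1 / sqrt (exp s - 1))"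
    and 2: "(LBINT s=ereal 0..\<infinity>. 1 / sqrt (exp s - 1)) = pi - 0"
    by (rule interval_integral_FTC_nonneg[OF _ D _ _ A B]; auto intro!: continuous_intros)+
  show "set_integrable lborel {0<..} (\<lambda>s. 1 / sqrt (exp s - 1))"
    using 1 by (simp add: einterval_def greaterThan_def)
  show "(LBINT s:{0<..}. 1 / sqrt (exp s - 1)) = pi"
    using 2 by (simp add: interval_lebesgue_integral_def einterval_def greaterThan_def)
qed

text \<open>Beyond finiteness, the size in \<open>\<tau>\<close> matters: the bound falls like
  \<open>exp (- \<tau> / 2)\<close>, and this decay makes the sum over the group converge
  pointwise.\<close>

lemma
  fixes \<tau> :: real assumes \<tau>: "\<tau> > 0"
  shows legendre_kernel_integrable: "set_integrable lborel {\<tau><..} (\<lambda>t. 1 / sqrt (cosh t - cosh \<tau>))"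
    and legendre_kernel_integral_le: "(LBINT t:{\<tau><..}. 1 / sqrt (cosh t - cosh \<tau>)) \<le> pi / sqrt (sinh \<tau>)"
proof -
  have sh: "sinh \<tau> > 0" using \<tau> by simp
  let ?g = "\<lambda>t. (1 / sqrt (sinh \<tau>)) * (indicator {0<..} (- \<tau> + 1 * t) *\<^sub>R (1 / sqrt (exp (- \<tau> + 1 * t) - 1)))"
  let ?f = "\<lambda>t. indicator {\<tau><..} t *\<^sub>R (1 / sqrt (cosh t - cosh \<tau>))"
  have gi: "integrable lborel ?g"
    by (intro integrable_mult_right lborel_integrable_real_affine)
      (use arctan_sqrt_exp_integral(1) in \<open>simp_all add: set_integrable_def\<close>)
  have le: "?f t \<le> ?g t" "0 \<le> ?f t" for t
  proof -
    have "?f t \<le> ?g t \<and> 0 \<le> ?f t"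
    proof (cases "t > \<tau>")
      case True
      have e: "exp (t - \<tau>) - 1 > 0" using True by simp
      then have "0 < sqrt (sinh \<tau> * (exp (t - \<tau>) - 1))" using sh by simp
      moreover have "sqrt (sinh \<tau> * (exp (t - \<tau>) - 1)) \<le> sqrt (cosh t - cosh \<tau>)"
        using cosh_diff_ge[OF \<tau> True] by simp
      ultimately have "1 / sqrt (cosh t - cosh \<tau>) \<le> 1 / sqrt (sinh \<tau> * (exp (t - \<tau>) - 1))"
        by (intro divide_left_mono) auto
      moreover have "cosh \<tau> < cosh t" using True \<tau> by (intro cosh_real_strict_mono) auto
      ultimately show ?thesis using True by (simp add: real_sqrt_mult)
    qed (auto simp: indicator_def)
    then show "?f t \<le> ?g t" "0 \<le> ?f t" by auto
  qed
  have fi: "integrable lborel ?f"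
  proof (rule Bochner_Integration.integrable_bound[OF gi])
    show "?f \<in> borel_measurable lborel" by measurable
    show "AE t in lborel. norm (?f t) \<le> norm (?g t)"
    proof (rule AE_I2)
      fix t
      have "norm (?f t) = ?f t" by (simp only: real_norm_def abs_of_nonneg[OF le(2)])
      also have "\<dots> \<le> norm (?g t)" unfolding real_norm_def by (rule order_trans[OF le(1) abs_ge_self])
      finally show "norm (?f t) \<le> norm (?g t)" .
    qed
  qed
  then show "set_integrable lborel {\<tau><..} (\<lambda>t. 1 / sqrt (cosh t - cosh \<tau>))" by (simp add: set_integrable_def)
  have "integral\<^sup>L lborel ?f \<le> integral\<^sup>L lborel ?g" by (intro integral_mono fi gi le)
  also have "\<dots> = (1 / sqrt (sinh \<tau>)) * (LBINT t. indicator {0<..} (- \<tau> + 1 * t) *\<^sub>R (1 / sqrt (exp (- \<tau> + 1 * t) - 1)))"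
    by (rule integral_mult_right_zero)
  also have "\<dots> = (1 / sqrt (sinh \<tau>)) * (LBINT t. indicator {0<..} t *\<^sub>R (1 / sqrt (exp t - 1)))"
    using lborel_integral_real_affine[of 1 "\<lambda>t. indicator {0<..} t *\<^sub>R (1 / sqrt (exp t - 1))" "- \<tau>"] by simp
  also have "\<dots> = pi / sqrt (sinh \<tau>)" using arctan_sqrt_exp_integral(2) by (simp add: set_lebesgue_integral_def)
  finally show "(LBINT t:{\<tau><..}. 1 / sqrt (cosh t - cosh \<tau>)) \<le> pi / sqrt (sinh \<tau>)"
    by (simp add: set_lebesgue_integral_def)
qed

lemma arcsin_integral:
  "integrable lborel (\<lambda>v::real. indicator {- 1<..<1} v * (1 / sqrt (1 - v\<^sup>2)))"
  "(LBINT v::real. indicator {- 1<..<1} v * (1 / sqrt (1 - v\<^sup>2))) = pi"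
proof -
  have sq: "v\<^sup>2 < 1" if "- 1 < v" "v < 1" for v :: real
    using that by (simp add: abs_square_less_1)
  have D: "DERIV arcsin v :> 1 / sqrt (1 - v\<^sup>2)" if "ereal (- 1) < ereal v" "ereal v < ereal 1" for v
    using that by (auto intro!: derivative_eq_intros simp: field_simps)
  have c: "isCont (\<lambda>v. 1 / sqrt (1 - v\<^sup>2)) v" if "ereal (- 1) < ereal v" "ereal v < ereal 1" for v :: real
    using sq[of v] that by (auto intro!: continuous_intros)
  have cont: "continuous_on {- 1..1} arcsin" by (rule continuous_on_arcsin')
  have A: "((arcsin \<circ> real_of_ereal) \<longlongrightarrow> - (pi / 2)) (at_right (ereal (- 1)))"
    unfolding ereal_tendsto_simps
    using cont[unfolded continuous_on_def, rule_format, of "- 1"] by (simp add: at_within_Icc_at_right)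
  have B: "((arcsin \<circ> real_of_ereal) \<longlongrightarrow> pi / 2) (at_left (ereal 1))"
    unfolding ereal_tendsto_simps
    using cont[unfolded continuous_on_def, rule_format, of 1] by (simp add: at_within_Icc_at_left)
  have nn: "AE v in lborel. ereal (- 1) < ereal v \<longrightarrow> ereal v < ereal 1 \<longrightarrow> 0 \<le> 1 / sqrt (1 - v\<^sup>2)"
    using sq by (auto intro!: AE_I2 simp: less_imp_le)
  have lt: "ereal (- 1) < ereal 1" by simp
  note I = interval_integral_FTC_nonneg[OF lt D c nn A B]
  show "integrable lborel (\<lambda>v::real. indicator {- 1<..<1} v * (1 / sqrt (1 - v\<^sup>2)))"
    using I(1) by (simp add: set_integrable_def)
  show "(LBINT v::real. indicator {- 1<..<1} v * (1 / sqrt (1 - v\<^sup>2))) = pi"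
    using I(2) by (simp add: interval_lebesgue_integral_def set_lebesgue_integral_def)
qed

text \<open>Rescaling by \<open>sqrt (\<kappa> / A)\<close> leads to the arcsine integral. That
  \<open>A\<close> disappears from the value is the point: \<open>A\<close> will carry the
  dependence on \<open>t\<close>.\<close>

lemma
  fixes A \<kappa> :: real assumes A: "A > 0" and \<kappa>: "\<kappa> > 0"
  shows scaled_arcsin_integrable: "integrable lborel (\<lambda>u. if \<kappa> * u\<^sup>2 < A then 1 / sqrt (A - \<kappa> * u\<^sup>2) else 0)"
    and scaled_arcsin_integral: "(LBINT u. if \<kappa> * u\<^sup>2 < A then 1 / sqrt (A - \<kappa> * u\<^sup>2) else 0) = pi / sqrt \<kappa>"
proof -
  define c where "c = sqrt (\<kappa> / A)"
  have c: "c > 0" "A * c\<^sup>2 = \<kappa>" using A \<kappa> by (auto simp: c_def)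
  have eq: "(if \<kappa> * u\<^sup>2 < A then 1 / sqrt (A - \<kappa> * u\<^sup>2) else 0) =
    (1 / sqrt A) * (indicator {- 1<..<1} (0 + c * u) * (1 / sqrt (1 - (0 + c * u)\<^sup>2)))" for u
  proof -
    have "A - \<kappa> * u\<^sup>2 = A * (1 - (0 + c * u)\<^sup>2)"
      unfolding c(2)[symmetric] by (simp add: power_mult_distrib algebra_simps)
    moreover from this have "\<kappa> * u\<^sup>2 < A \<longleftrightarrow> \<bar>0 + c * u\<bar> < 1"
      using A by (metis abs_square_less_1 diff_gt_0_iff_gt zero_less_mult_iff less_asym)
    ultimately show ?thesis by (auto simp: real_sqrt_mult indicator_def abs_less_iff)
  qed
  show "integrable lborel (\<lambda>u. if \<kappa> * u\<^sup>2 < A then 1 / sqrt (A - \<kappa> * u\<^sup>2) else 0)"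
    unfolding eq by (intro integrable_mult_right lborel_integrable_real_affine[OF arcsin_integral(1)]) (use c in auto)
  have "(LBINT u. indicator {- 1<..<1} (0 + c * u) * (1 / sqrt (1 - (0 + c * u)\<^sup>2))) = pi / c"
    using lborel_integral_real_affine[of c "\<lambda>v. indicator {- 1<..<1} v * (1 / sqrt (1 - v\<^sup>2))" 0] c(1) arcsin_integral(2)
    by (simp add: field_simps)
  then have "(LBINT u. if \<kappa> * u\<^sup>2 < A then 1 / sqrt (A - \<kappa> * u\<^sup>2) else 0) = (1 / sqrt A) * (pi / c)"
    unfolding eq by (subst integral_mult_right_zero) simp
  also have "\<dots> = pi / sqrt \<kappa>" using A by (simp add: c_def real_sqrt_divide)
  finally show "(LBINT u. if \<kappa> * u\<^sup>2 < A then 1 / sqrt (A - \<kappa> * u\<^sup>2) else 0) = pi / sqrt \<kappa>" .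
qed

text \<open>Up to a constant, the point-pair invariant at distance \<open>\<tau>\<close> in its form
  with \<open>g'\<close>, where \<open>P\<close> stands for a multiple of \<open>g'\<close>.\<close>

definition abel :: "(real \<Rightarrow> complex) \<Rightarrow> real \<Rightarrow> complex" where
  "abel P \<tau> = (LBINT t:{\<tau><..}. P t / of_real (sqrt (cosh t - cosh \<tau>)))"

lemma abel_bound:
  assumes \<tau>: "\<tau> > 0" and B: "\<And>t. t > 0 \<Longrightarrow> cmod (P t) \<le> B"
  shows "cmod (abel P \<tau>) \<le> B * pi / sqrt (sinh \<tau>)"
proof -
  have B0: "B \<ge> 0" using B[of 1] norm_ge_zero[of "P 1"] by linarith
  have "cmod (abel P \<tau>) \<le> (LBINT t. norm (indicator {\<tau><..} t *\<^sub>R (P t / of_real (sqrt (cosh t - cosh \<tau>)))))"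
    unfolding abel_def set_lebesgue_integral_def by (rule integral_norm_bound)
  also have "\<dots> \<le> (LBINT t. B * (indicator {\<tau><..} t *\<^sub>R (1 / sqrt (cosh t - cosh \<tau>))))"
  proof (rule integral_mono_AE')
    show "integrable lborel (\<lambda>t. B * (indicator {\<tau><..} t *\<^sub>R (1 / sqrt (cosh t - cosh \<tau>))))"
      using legendre_kernel_integrable[OF \<tau>] unfolding set_integrable_def by (rule integrable_mult_right)
    show "AE t in lborel. norm (indicator {\<tau><..} t *\<^sub>R (P t / of_real (sqrt (cosh t - cosh \<tau>)))) \<le>
        B * (indicator {\<tau><..} t *\<^sub>R (1 / sqrt (cosh t - cosh \<tau>)))"
    proof (rule AE_I2)
      fix t :: real
      show "norm (indicator {\<tau><..} t *\<^sub>R (P t / of_real (sqrt (cosh t - cosh \<tau>)))) \<le>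
        B * (indicator {\<tau><..} t *\<^sub>R (1 / sqrt (cosh t - cosh \<tau>)))"
      proof (cases "t > \<tau>")
        case True
        then have "cosh \<tau> < cosh t" using \<tau> by (intro cosh_real_strict_mono) auto
        then show ?thesis using True \<tau> B[of t] by (simp add: norm_divide divide_right_mono)
      qed simp
    qed
    show "AE t in lborel. 0 \<le> B * (indicator {\<tau><..} t *\<^sub>R (1 / sqrt (cosh t - cosh \<tau>)))"
    proof (rule AE_I2)
      fix t :: real
      show "0 \<le> B * (indicator {\<tau><..} t *\<^sub>R (1 / sqrt (cosh t - cosh \<tau>)))"
        using B0 \<tau> cosh_real_strict_mono[of \<tau> t] by (cases "t > \<tau>") auto
    qed
  qed
  also have "\<dots> = B * (LBINT t:{\<tau><..}. 1 / sqrt (cosh t - cosh \<tau>))"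
    unfolding set_lebesgue_integral_def by (rule integral_mult_right_zero)
  also have "\<dots> \<le> B * (pi / sqrt (sinh \<tau>))" by (intro mult_left_mono legendre_kernel_integral_le \<tau> B0)
  finally show ?thesis by simp
qed

text \<open>With \<open>t\<close> fixed, the integral over \<open>u\<close> is an arcsine integral
  with \<open>A = cosh t - cosh a\<close>, hence the constant \<open>pi / sqrt \<kappa>\<close>. The
  inequality for norms is kept separately because it later justifies summing over the group under
  the integral.\<close>

lemma
  fixes a \<kappa> :: real and P :: "real \<Rightarrow> complex"
  assumes a: "a > 0" and \<kappa>: "\<kappa> > 0" and P[measurable]: "P \<in> borel_measurable borel"
    and Pi: "set_integrable lborel {a<..} P"
  defines "\<tau> \<equiv> \<lambda>u. arcosh (cosh a + \<kappa> * u\<^sup>2)"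
  shows abel_integrable: "integrable lborel (\<lambda>u. abel P (\<tau> u))"
    and abel_integral: "(LBINT u. abel P (\<tau> u)) = of_real (pi / sqrt \<kappa>) * (LBINT t:{a<..}. P t)"
    and abel_norm_integral: "(LBINT u. norm (abel P (\<tau> u))) \<le> pi / sqrt \<kappa> * (LBINT t:{a<..}. norm (P t))"
proof -
  \<comment> \<open>The kernel is extended by 0, which encodes the moving limit
    \<open>t > \<tau> u\<close> and gives Fubini a product domain.\<close>
  define k where "k t u = (if \<kappa> * u\<^sup>2 < cosh t - cosh a then 1 / sqrt ((cosh t - cosh a) - \<kappa> * u\<^sup>2) else 0)" for t u
  define \<Psi> where "\<Psi> p = (indicator {a<..} (fst p) *\<^sub>R P (fst p)) * of_real (k (fst p) (snd p))" for p
  have k0: "k t u \<ge> 0" for t u by (simp add: k_def)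
  have ki: "integrable lborel (k t)" "(LBINT u. k t u) = pi / sqrt \<kappa>" if "t > a" for t
  proof -
    have "cosh t - cosh a > 0" using a that cosh_real_strict_mono[of a t] by simp
    then show "integrable lborel (k t)" "(LBINT u. k t u) = pi / sqrt \<kappa>"
      using scaled_arcsin_integrable[OF _ \<kappa>] scaled_arcsin_integral[OF _ \<kappa>] unfolding k_def[abs_def] by auto
  qed
  have [measurable]: "(\<lambda>p. k (fst p) (snd p)) \<in> borel_measurable (borel \<Otimes>\<^sub>M borel)"
    unfolding k_def by measurable
  have [measurable]: "(\<lambda>u. k t u) \<in> borel_measurable borel" for t
    unfolding k_def by measurable
  have \<Psi>m: "\<Psi> \<in> borel_measurable (lborel \<Otimes>\<^sub>M lborel)"
    unfolding \<Psi>_def[abs_def] by measurable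
  have \<Psi>n: "norm (\<Psi> (t, u)) = (indicator {a<..} t * norm (P t)) * k t u" for t u
    using k0[of t u] by (simp add: \<Psi>_def norm_mult)
  have nI: "(LBINT u. norm (\<Psi> (t, u))) = (indicator {a<..} t * norm (P t)) * (pi / sqrt \<kappa>)" for t
    unfolding \<Psi>n using ki(2)[of t] by (cases "t > a") simp_all
  have Pn: "integrable lborel (\<lambda>t. indicator {a<..} t * norm (P t))"
    using integrable_norm[OF Pi[unfolded set_integrable_def]] by simp
  have \<Psi>i: "integrable (lborel \<Otimes>\<^sub>M lborel) \<Psi>"
  proof (rule lborel_pair.Fubini_integrable[OF \<Psi>m])
    show "integrable lborel (\<lambda>t. LBINT u. norm (\<Psi> (t, u)))"
      unfolding nI by (intro integrable_mult_left Pn)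
    have "integrable lborel (\<lambda>u. \<Psi> (t, u))" for t
    proof (cases "t > a")
      case True
      then show ?thesis using ki(1)[OF True] unfolding \<Psi>_def by (simp add: integrable_mult_right integrable_of_real)
    qed (simp add: \<Psi>_def)
    then show "AE t in lborel. integrable lborel (\<lambda>u. \<Psi> (t, u))" by simp
  qed
  have chu: "cosh a + \<kappa> * u\<^sup>2 \<ge> 1" for u using cosh_real_ge_1[of a] \<kappa> by (simp add: add_increasing2)
  have ch: "cosh (\<tau> u) = cosh a + \<kappa> * u\<^sup>2" for u unfolding \<tau>_def by (intro cosh_arcosh_real chu)
  have \<tau>0: "\<tau> u \<ge> 0" for u unfolding \<tau>_def by (intro arcosh_nonneg_real chu)
  have \<tau>a: "\<tau> u \<ge> a" for u
    using a \<tau>0[of u] \<kappa> cosh_real_nonneg_le_iff[of a "\<tau> u"] by (simp add: ch)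
  have ab: "abel P (\<tau> u) = (LBINT t. \<Psi> (t, u))" for u
    unfolding abel_def set_lebesgue_integral_def
  proof (rule Bochner_Integration.integral_cong[OF refl])
    fix t :: real
    \<comment> \<open>Since \<open>cosh\<close> is increasing on nonnegative reals and
      \<open>\<tau> u \<ge> a\<close>, the region of integration can be described without
      \<open>arcosh\<close>.\<close>
    have "t > \<tau> u \<longleftrightarrow> t > a \<and> \<kappa> * u\<^sup>2 < cosh t - cosh a"
    proof (cases "t > a")
      case True
      then show ?thesis using a \<tau>0[of u] cosh_real_nonneg_less_iff[of "\<tau> u" t] by (auto simp: ch)
    next
      case False
      then show ?thesis using \<tau>a[of u] by auto
    qed
    then show "indicator {\<tau> u<..} t *\<^sub>R (P t / of_real (sqrt (cosh t - cosh (\<tau> u)))) = \<Psi> (t, u)"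
      by (auto simp: \<Psi>_def k_def ch indicator_def diff_diff_eq)
  qed
  have swap: "integrable (lborel \<Otimes>\<^sub>M lborel) (\<lambda>(t, u). \<Psi> (t, u))" using \<Psi>i by simp
  show "integrable lborel (\<lambda>u. abel P (\<tau> u))"
    unfolding ab using lborel_pair.integrable_snd[OF swap] .
  have "(LBINT u. abel P (\<tau> u)) = (LBINT t. LBINT u. \<Psi> (t, u))"
    unfolding ab by (rule lborel_pair.Fubini_integral[OF swap])
  also have "\<dots> = (LBINT t. (indicator {a<..} t *\<^sub>R P t) * of_real (pi / sqrt \<kappa>))"
  proof (rule Bochner_Integration.integral_cong[OF refl])
    fix t
    show "(LBINT u. \<Psi> (t, u)) = (indicator {a<..} t *\<^sub>R P t) * of_real (pi / sqrt \<kappa>)"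
    proof (cases "t > a")
      case True
      then show ?thesis using ki(2)[OF True] unfolding \<Psi>_def by (simp add: integral_of_real)
    qed (simp add: \<Psi>_def)
  qed
  also have "\<dots> = of_real (pi / sqrt \<kappa>) * (LBINT t:{a<..}. P t)"
    unfolding set_lebesgue_integral_def by (subst integral_mult_left_zero) (rule mult.commute)
  finally show "(LBINT u. abel P (\<tau> u)) = of_real (pi / sqrt \<kappa>) * (LBINT t:{a<..}. P t)" .
  have swap': "integrable (lborel \<Otimes>\<^sub>M lborel) (\<lambda>(t, u). norm (\<Psi> (t, u)))"
  proof -
    have "(\<lambda>(t, u). norm (\<Psi> (t, u))) = (\<lambda>p. norm (\<Psi> p))" by (simp add: fun_eq_iff)
    then show ?thesis using integrable_norm[OF \<Psi>i] by simp
  qed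
  have "(LBINT u. norm (abel P (\<tau> u))) \<le> (LBINT u. LBINT t. norm (\<Psi> (t, u)))"
  proof (rule integral_mono)
    show "integrable lborel (\<lambda>u. norm (abel P (\<tau> u)))"
      unfolding ab using lborel_pair.integrable_snd[OF swap] by (rule integrable_norm)
    show "integrable lborel (\<lambda>u. LBINT t. norm (\<Psi> (t, u)))"
      using lborel_pair.integrable_snd[OF swap'] .
  qed (simp add: ab integral_norm_bound)
  also have "\<dots> = (LBINT t. LBINT u. norm (\<Psi> (t, u)))"
    by (rule lborel_pair.Fubini_integral[OF swap'])
  also have "\<dots> = pi / sqrt \<kappa> * (LBINT t:{a<..}. norm (P t))"
    unfolding nI set_lebesgue_integral_def by (subst integral_mult_left_zero) (simp add: mult.commute)
  finally show "(LBINT u. norm (abel P (\<tau> u))) \<le> pi / sqrt \<kappa> * (LBINT t:{a<..}. norm (P t))" .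
qed

section \<open>The point-pair invariant\<close>

lemma hdist_pos:
  assumes "z \<in> hplane" "w \<in> hplane" "z \<noteq> w"
  shows "hdist z w > 0"
proof -
  have "(cmod (z - w))\<^sup>2 / (2 * Im z * Im w) > 0" using assms by (simp add: hplane_def)
  then show ?thesis unfolding hdist_def by (subst arcosh_real_gt_1_iff) auto
qed

locale test_function =
  fixes h :: "complex \<Rightarrow> complex" and \<sigma> \<delta> C :: real
  assumes \<sigma>_pos: "\<sigma> > 0" and \<delta>_pos: "\<delta> > 0"
    and h_holo: "h holomorphic_on {z. \<bar>Im z\<bar> < \<sigma>}"
    and h_bound: "\<And>z. \<bar>Im z\<bar> < \<sigma> \<Longrightarrow> cmod (h z) \<le> C * (1 + \<bar>Re z\<bar>) powr (- 2 - \<delta>)"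
begin

lemma C_ge_0: "C \<ge> 0"
  using h_bound[of 0] \<sigma>_pos by (auto intro: order_trans[OF norm_ge_zero])

sublocale H: strip_function h \<sigma> \<delta> C
proof
  show "cmod (h z) \<le> C * (1 + \<bar>Re z\<bar>) powr (- 1 - \<delta>)" if "\<bar>Im z\<bar> < \<sigma>" for z
    using h_bound[OF that] C_ge_0
    by (elim order_trans) (intro mult_left_mono powr_mono, auto)
qed (fact \<sigma>_pos \<delta>_pos h_holo)+

sublocale P: strip_function "\<lambda>z. z * h z" \<sigma> \<delta> "C * (1 + \<sigma>)"
proof
  show "(\<lambda>z. z * h z) holomorphic_on {z. \<bar>Im z\<bar> < \<sigma>}" by (intro holomorphic_intros h_holo)
  fix z :: complex assume z: "\<bar>Im z\<bar> < \<sigma>"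
  have "cmod z \<le> \<bar>Re z\<bar> + \<bar>Im z\<bar>" by (rule cmod_le)
  also have "\<dots> \<le> \<bar>Re z\<bar> + \<sigma>" using z by simp
  \<comment> \<open>The factor \<open>z\<close> costs one power of
    \<open>1 + \<bar>Re z\<bar>\<close> and, as \<open>Im z\<close> is bounded on the strip, the
    constant \<open>1 + \<sigma>\<close>.\<close>
  also have "\<dots> \<le> (1 + \<sigma>) * (1 + \<bar>Re z\<bar>)" using \<sigma>_pos by (simp add: algebra_simps)
  finally have "cmod (z * h z) \<le> ((1 + \<sigma>) * (1 + \<bar>Re z\<bar>)) * (C * (1 + \<bar>Re z\<bar>) powr (- 2 - \<delta>))"
    unfolding norm_mult using h_bound[OF z] \<sigma>_pos by (intro mult_mono) auto
  also have "\<dots> = C * (1 + \<sigma>) * ((1 + \<bar>Re z\<bar>) * (1 + \<bar>Re z\<bar>) powr (- 2 - \<delta>))" by simp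
  also have "(1 + \<bar>Re z\<bar>) * (1 + \<bar>Re z\<bar>) powr (- 2 - \<delta>) = (1 + \<bar>Re z\<bar>) powr (- 1 - \<delta>)"
    by (subst powr_mult_base) auto
  finally show "cmod (z * h z) \<le> C * (1 + \<sigma>) * (1 + \<bar>Re z\<bar>) powr (- 1 - \<delta>)" .
qed (fact \<sigma>_pos \<delta>_pos)+

text \<open>Formally \<open>P.ft\<close> is \<open>\<i>\<close> times the derivative of
  \<open>H.ft\<close>, which vanishes at infinity. On the line \<open>Im z = - e\<close> the double
  integral converges absolutely; integrating over \<open>t\<close> first gives
  \<open>1 / (\<i> * z)\<close>, which removes the factor \<open>z\<close>, and shifting back yields
  \<open>H.ft\<close>.\<close>

lemma integral_P_ft: "(LBINT t:{a<..}. P.ft t) = - \<i> * H.ft a"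
proof -
  define e where "e = \<sigma> / 2"
  have e: "0 < e" "e < \<sigma>" "\<bar>- e\<bar> < \<sigma>" using \<sigma>_pos by (auto simp: e_def)
  let ?z = "\<lambda>x. Complex x (- e)"
  define \<Theta> where "\<Theta> p = indicator {a<..} (fst p) *\<^sub>R
    (?z (snd p) * h (?z (snd p)) * exp (- \<i> * ?z (snd p) * of_real (fst p)))" for p
  have \<Theta>m: "\<Theta> \<in> borel_measurable (lborel \<Otimes>\<^sub>M lborel)"
    unfolding \<Theta>_def[abs_def] using P.joint_measurable[OF e(3)]
    by (intro borel_measurable_scaleR) (auto simp: measurable_cong_sets[OF sets_pair_measure_cong[OF sets_lborel sets_lborel] refl])
  have \<Theta>i: "integrable (lborel \<Otimes>\<^sub>M lborel) \<Theta>"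
  proof (rule Bochner_Integration.integrable_bound[OF _ \<Theta>m])
    show "integrable (lborel \<Otimes>\<^sub>M lborel) (\<lambda>p. (indicator {a<..} (fst p) *\<^sub>R exp (- (e * fst p))) *
        (C * (1 + \<sigma>) * (1 + \<bar>snd p\<bar>) powr (- 1 - \<delta>)))"
      by (rule integrable_pair_mult)
        (use set_integrable_exp_decay[OF e(1), of a] in \<open>auto simp: set_integrable_def intro!: integrable_mult_right integrable_powr_decay \<delta>_pos\<close>)
    have "norm (\<Theta> (t, x)) \<le> (indicator {a<..} t *\<^sub>R exp (- (e * t))) * (C * (1 + \<sigma>) * (1 + \<bar>x\<bar>) powr (- 1 - \<delta>))" for t x
      using P.line_bound[OF e(3), of x t] by (cases "t > a") (auto simp: \<Theta>_def mult_ac)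
    then show "AE p in lborel \<Otimes>\<^sub>M lborel. norm (\<Theta> p) \<le>
        norm ((indicator {a<..} (fst p) *\<^sub>R exp (- (e * fst p))) * (C * (1 + \<sigma>) * (1 + \<bar>snd p\<bar>) powr (- 1 - \<delta>)))"
      by (intro AE_I2) (auto intro: order_trans[OF _ abs_ge_self])
  qed
  then have swap: "integrable (lborel \<Otimes>\<^sub>M lborel) (\<lambda>(t, x). \<Theta> (t, x))" by simp
  have "(LBINT t:{a<..}. P.ft t) = (LBINT t. LBINT x. \<Theta> (t, x))"
    unfolding set_lebesgue_integral_def P.ft_shift[OF e(1,2)] \<Theta>_def fst_conv snd_conv
    by (subst integral_scaleR_right) simp
  also have "\<dots> = (LBINT x. LBINT t. \<Theta> (t, x))"
    by (rule lborel_pair.Fubini_integral[OF swap, symmetric])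
  also have "\<dots> = (LBINT x. - \<i> * (h (?z x) * exp (- \<i> * ?z x * of_real a)))"
  proof (rule Bochner_Integration.integral_cong[OF refl])
    fix x :: real
    have z: "Im (?z x) < 0" "?z x \<noteq> 0" using e(1) by (auto simp: complex_eq_iff)
    have "(LBINT t. \<Theta> (t, x)) = ?z x * h (?z x) * (LBINT t:{a<..}. exp (- \<i> * ?z x * of_real t))"
      unfolding \<Theta>_def set_lebesgue_integral_def fst_conv snd_conv
      by (subst integral_mult_right_zero[symmetric]) (simp add: mult_ac)
    also have "\<dots> = ?z x * h (?z x) * (exp (- \<i> * ?z x * of_real a) / (\<i> * ?z x))"
      unfolding integral_exp_decay[OF z(1)] ..
    also have "\<dots> = - \<i> * (h (?z x) * exp (- \<i> * ?z x * of_real a))"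
      using z(2) by (simp add: field_simps)
    finally show "(LBINT t. \<Theta> (t, x)) = - \<i> * (h (?z x) * exp (- \<i> * ?z x * of_real a))" .
  qed
  also have "\<dots> = - \<i> * H.ft a"
    unfolding H.ft_shift[OF e(1,2)] by (rule integral_mult_right_zero)
  finally show ?thesis .
qed

text \<open>This is \<open>1 / (\<pi> \<i>) * (- 1 / (2 \<pi>)) * (1 / sqrt 2)\<close>, the product of the prefactors of the point-pair
  invariant, of the Green function and of \<open>Q\<close>.\<close>
definition c0 :: complex where "c0 = \<i> / of_real (2 * sqrt 2 * pi\<^sup>2)"

text \<open>This is the passage from Green functions to the form with \<open>g'\<close>. It is
  Fubini in \<open>\<rho>\<close> and \<open>t\<close>: \<open>\<rho> * h \<rho>\<close> is
  integrable by its decay, and the Legendre kernel is integrable because distinct points have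
  positive distance.\<close>

lemma point_pair_eq_abel:
  assumes zw: "z \<in> hplane" "w \<in> hplane" "z \<noteq> w"
  shows "point_pair h z w = c0 * abel P.ft (hdist z w)"
proof -
  define \<tau> where "\<tau> = hdist z w"
  have \<tau>: "\<tau> > 0" unfolding \<tau>_def by (rule hdist_pos[OF zw])
  let ?s = "\<lambda>t. complex_of_real (sqrt (cosh t - cosh \<tau>))"
  define \<Theta> where "\<Theta> p = (indicator {\<tau><..} (snd p) *\<^sub>R (exp (- \<i> * of_real (fst p) * of_real (snd p)) / ?s (snd p))) *
    (of_real (fst p) * h (of_real (fst p)))" for p :: "real \<times> real"
  have [measurable]: "(\<lambda>x. h (of_real x)) \<in> borel_measurable borel"
    using H.line_measurable[of 0] \<sigma>_pos by (simp add: complex_of_real_def)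
  have \<Theta>m: "\<Theta> \<in> borel_measurable (lborel \<Otimes>\<^sub>M lborel)"
    unfolding \<Theta>_def[abs_def] by measurable
  have \<Theta>i: "integrable (lborel \<Otimes>\<^sub>M lborel) \<Theta>"
  proof (rule Bochner_Integration.integrable_bound[OF _ \<Theta>m])
    show "integrable (lborel \<Otimes>\<^sub>M lborel) (\<lambda>p. (C * (1 + \<sigma>) * (1 + \<bar>fst p\<bar>) powr (- 1 - \<delta>)) *
        (indicator {\<tau><..} (snd p) *\<^sub>R (1 / sqrt (cosh (snd p) - cosh \<tau>))))"
      by (rule integrable_pair_mult)
        (use legendre_kernel_integrable[OF \<tau>] in \<open>auto simp: set_integrable_def intro!: integrable_mult_right integrable_powr_decay \<delta>_pos\<close>)
    have nb: "norm (\<Theta> (x, t)) \<le> (C * (1 + \<sigma>) * (1 + \<bar>x\<bar>) powr (- 1 - \<delta>)) *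
        (indicator {\<tau><..} t *\<^sub>R (1 / sqrt (cosh t - cosh \<tau>)))" for x t
    proof (cases "t > \<tau>")
      case True
      then have "cosh \<tau> < cosh t" using \<tau> by (intro cosh_real_strict_mono) auto
      moreover have "cmod (of_real x * h (of_real x)) \<le> C * (1 + \<sigma>) * (1 + \<bar>x\<bar>) powr (- 1 - \<delta>)"
        using P.bound[of "of_real x"] \<sigma>_pos by simp
      moreover have "cmod (exp (- \<i> * of_real x * of_real t)) = 1" by (simp add: norm_exp_eq_Re)
      ultimately show ?thesis using True
        by (simp add: \<Theta>_def norm_mult norm_divide divide_right_mono del: norm_exp_eq_Re)
    qed (simp add: \<Theta>_def)
    show "AE p in lborel \<Otimes>\<^sub>M lborel. norm (\<Theta> p) \<le> norm ((C * (1 + \<sigma>) * (1 + \<bar>fst p\<bar>) powr (- 1 - \<delta>)) *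
        (indicator {\<tau><..} (snd p) *\<^sub>R (1 / sqrt (cosh (snd p) - cosh \<tau>))))"
    proof (rule AE_I2)
      fix p :: "real \<times> real"
      obtain x t where p: "p = (x, t)" by (cases p)
      show "norm (\<Theta> p) \<le> norm ((C * (1 + \<sigma>) * (1 + \<bar>fst p\<bar>) powr (- 1 - \<delta>)) *
        (indicator {\<tau><..} (snd p) *\<^sub>R (1 / sqrt (cosh (snd p) - cosh \<tau>))))"
        unfolding p fst_conv snd_conv real_norm_def by (rule order_trans[OF nb abs_ge_self])
    qed
  qed
  then have swap: "integrable (lborel \<Otimes>\<^sub>M lborel) (\<lambda>(x, t). \<Theta> (x, t))" by simp
  have "(LBINT x. (LBINT t:{\<tau><..}. exp (- \<i> * of_real x * of_real t) / ?s t) * (of_real x * h (of_real x))) =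
      (LBINT x. LBINT t. \<Theta> (x, t))"
    unfolding set_lebesgue_integral_def \<Theta>_def fst_conv snd_conv by (subst integral_mult_left_zero) simp
  also have "\<dots> = (LBINT t. LBINT x. \<Theta> (x, t))"
    by (rule lborel_pair.Fubini_integral[OF swap, symmetric])
  also have "\<dots> = abel P.ft \<tau>"
    unfolding abel_def set_lebesgue_integral_def
  proof (rule Bochner_Integration.integral_cong[OF refl])
    fix t :: real
    have "\<Theta> (x, t) = (indicator {\<tau><..} t *\<^sub>R (1 / ?s t)) * (of_real x * h (of_real x) * exp (- \<i> * of_real x * of_real t))" for x
      by (simp add: \<Theta>_def scaleR_conv_of_real field_simps)
    then have "(LBINT x. \<Theta> (x, t)) = (indicator {\<tau><..} t *\<^sub>R (1 / ?s t)) * P.ft t"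
      unfolding P.ft_def by (simp only: integral_mult_right_zero)
    then show "(LBINT x. \<Theta> (x, t)) = indicator {\<tau><..} t *\<^sub>R (P.ft t / ?s t)"
      by (simp add: scaleR_conv_of_real field_simps)
  qed
  finally have main: "(LBINT x. (LBINT t:{\<tau><..}. exp (- \<i> * of_real x * of_real t) / ?s t) * (of_real x * h (of_real x))) = abel P.ft \<tau>" .
  define k where "k = complex_of_real (- 1 / (2 * pi)) * complex_of_real (1 / sqrt 2)"
  have "green \<rho> z w * complex_of_real \<rho> * h (complex_of_real \<rho>) =
      k * ((LBINT t:{\<tau><..}. exp (- \<i> * of_real \<rho> * of_real t) / ?s t) * (of_real \<rho> * h (of_real \<rho>)))" for \<rho>
    unfolding green_def legendre_Q_def \<tau>_def[symmetric] k_def by (simp add: mult_ac)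
  then have "(LBINT \<rho>. green \<rho> z w * complex_of_real \<rho> * h (complex_of_real \<rho>)) = k * abel P.ft \<tau>"
    unfolding main[symmetric] by (simp only: integral_mult_right_zero)
  then have "point_pair h z w = 1 / (pi * \<i>) * (k * abel P.ft \<tau>)"
    using zw(3) by (simp add: point_pair_def)
  then have "point_pair h z w = (1 / (pi * \<i>) * k) * abel P.ft \<tau>" by (simp only: mult.assoc)
  moreover have "1 / (pi * \<i>) * k = c0"
    by (simp add: k_def c0_def power2_eq_square field_simps)
  ultimately show ?thesis by (simp only: \<tau>_def)
qed

lemma abel_P_bound:
  obtains B where "B \<ge> 0" "\<And>\<tau>. \<tau> > 0 \<Longrightarrow> cmod (c0 * abel P.ft \<tau>) \<le> B / sqrt (sinh \<tau>)"
proof -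
  define B0 where "B0 = C * (1 + \<sigma>) * (LBINT x. (1 + \<bar>x\<bar>) powr (- 1 - \<delta>))"
  have e: "0 < \<sigma> / 2" "\<sigma> / 2 < \<sigma>" using \<sigma>_pos by auto
  have B00: "B0 \<ge> 0" using C_ge_0 \<sigma>_pos unfolding B0_def by (intro mult_nonneg_nonneg integral_nonneg_AE) auto
  have P: "cmod (P.ft t) \<le> B0" if "t > 0" for t
  proof -
    have "cmod (P.ft t) \<le> B0 * exp (- (\<sigma> / 2 * t))" unfolding B0_def by (rule P.ft_bound[OF e])
    also have "\<dots> \<le> B0 * 1" using that \<sigma>_pos B00 by (intro mult_left_mono) auto
    finally show ?thesis by simp
  qed
  show ?thesis
  proof
    show "cmod c0 * (B0 * pi) \<ge> 0" using B00 by simp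
    fix \<tau> :: real assume "\<tau> > 0"
    from mult_left_mono[OF abel_bound[OF this P] norm_ge_zero[of c0]]
    show "cmod (c0 * abel P.ft \<tau>) \<le> cmod c0 * (B0 * pi) / sqrt (sinh \<tau>)" by (simp add: norm_mult)
  qed
qed

end

section \<open>Summation over the group\<close>

lemma infsum_eq_suminf:
  fixes f :: "nat \<Rightarrow> 'a :: banach"
  assumes "summable (\<lambda>n. norm (f n))"
  shows "infsum f UNIV = suminf f"
  by (rule infsumI[OF norm_summable_imp_has_sum[OF assms summable_sums[OF summable_norm_cancel[OF assms]]]])

lemma
  fixes f :: "int \<Rightarrow> 'a :: banach"
  assumes p: "summable (\<lambda>n. norm (f (int (Suc n))))" and m: "summable (\<lambda>n. norm (f (- int (Suc n))))"
  shows summable_on_int: "f summable_on UNIV"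
    and infsum_int: "infsum f UNIV = f 0 + ((\<Sum>n. f (int (Suc n))) + (\<Sum>n. f (- int (Suc n))))"
proof -
  let ?A = "range (\<lambda>n. int (Suc n))" and ?B = "range (\<lambda>n. - int (Suc n))"
  have A: "(f has_sum (\<Sum>n. f (int (Suc n)))) ?A"
    using norm_summable_imp_has_sum[OF p summable_sums[OF summable_norm_cancel[OF p]]]
    by (subst has_sum_reindex) (auto simp: inj_on_def o_def)
  have B: "(f has_sum (\<Sum>n. f (- int (Suc n)))) ?B"
    using norm_summable_imp_has_sum[OF m summable_sums[OF summable_norm_cancel[OF m]]]
    by (subst has_sum_reindex) (auto simp: inj_on_def o_def)
  have U: "{0} \<union> (?A \<union> ?B) = UNIV"
  proof -
    have "k \<in> {0} \<union> (?A \<union> ?B)" for k :: int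
    proof (cases k rule: int_cases3)
      case (pos n)
      then have "k = int (Suc (n - 1))" by simp
      then show ?thesis by blast
    next
      case (neg n)
      then have "k = - int (Suc (n - 1))" by simp
      then show ?thesis by blast
    qed simp
    then show ?thesis by blast
  qed
  have "(f has_sum f 0) {0}" using has_sum_finite[of "{0}" f] by simp
  then have "(f has_sum (f 0 + ((\<Sum>n. f (int (Suc n))) + (\<Sum>n. f (- int (Suc n)))))) ({0} \<union> (?A \<union> ?B))"
    by (intro has_sum_Un_disjoint A B) auto
  then have "(f has_sum (f 0 + ((\<Sum>n. f (int (Suc n))) + (\<Sum>n. f (- int (Suc n)))))) UNIV"
    by (simp only: U)
  then show "f summable_on UNIV" "infsum f UNIV = f 0 + ((\<Sum>n. f (int (Suc n))) + (\<Sum>n. f (- int (Suc n))))"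
    by (auto simp: summable_on_def infsumI)
qed

text \<open>Domination by a product of geometric series makes the family absolutely summable over
  pairs, so the iterated sums agree as unordered sums and are then read as ordinary series.\<close>

lemma suminf_swap_geometric:
  fixes f :: "nat \<Rightarrow> nat \<Rightarrow> 'a :: banach"
  assumes r: "0 \<le> r" "r < 1" and f: "\<And>m n. norm (f m n) \<le> r ^ m * r ^ n"
  shows "(\<Sum>m. \<Sum>n. f m n) = (\<Sum>n. \<Sum>m. f m n)"
proof -
  have geo: "summable (\<lambda>n. r ^ n)" using r by simp
  have s1: "summable (\<lambda>n. norm (f m n))" for m
    by (rule summable_comparison_test'[OF summable_mult[OF geo, of "r ^ m"], of 0]) (simp add: f)
  have s2: "summable (\<lambda>m. norm (f m n))" for n
    by (rule summable_comparison_test'[OF summable_mult2[OF geo, of "r ^ n"], of 0]) (simp add: f)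
  have b1: "norm (\<Sum>n. f m n) \<le> r ^ m * (\<Sum>n. r ^ n)" for m
  proof -
    have "norm (\<Sum>n. f m n) \<le> (\<Sum>n. norm (f m n))" by (rule summable_norm[OF s1])
    also have "\<dots> \<le> (\<Sum>n. r ^ m * r ^ n)" by (intro suminf_le s1 summable_mult geo f)
    also have "\<dots> = r ^ m * (\<Sum>n. r ^ n)" by (rule suminf_mult[OF geo])
    finally show ?thesis .
  qed
  have b2: "norm (\<Sum>m. f m n) \<le> (\<Sum>m. r ^ m) * r ^ n" for n
  proof -
    have "norm (\<Sum>m. f m n) \<le> (\<Sum>m. norm (f m n))" by (rule summable_norm[OF s2])
    also have "\<dots> \<le> (\<Sum>m. r ^ m * r ^ n)" by (intro suminf_le s2 summable_mult2 geo f)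
    also have "\<dots> = (\<Sum>m. r ^ m) * r ^ n" by (rule suminf_mult2[OF geo, symmetric])
    finally show ?thesis .
  qed
  have o1: "summable (\<lambda>m. norm (\<Sum>n. f m n))"
    by (rule summable_comparison_test'[OF summable_mult2[OF geo], of 0]) (use b1 in simp)
  have o2: "summable (\<lambda>n. norm (\<Sum>m. f m n))"
    by (rule summable_comparison_test'[OF summable_mult[OF geo], of 0]) (use b2 in simp)
  have g: "(\<lambda>p. norm (case p of (m, n) \<Rightarrow> r ^ m * r ^ n)) summable_on (UNIV \<times> UNIV :: (nat \<times> nat) set)"
  proof (rule Infinite_Sum.abs_summable_on_Sigma_iff[THEN iffD2], intro conjI ballI)
    show "(\<lambda>n. norm (case (m, n) of (m, n) \<Rightarrow> r ^ m * r ^ n)) summable_on UNIV" for m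
      using r by (intro norm_summable_imp_summable_on) (simp add: abs_mult power_abs summable_mult)
    have "infsum (\<lambda>n. norm (r ^ m * r ^ n)) UNIV = r ^ m * (\<Sum>n. r ^ n)" for m
      using r by (subst infsum_eq_suminf) (auto simp: abs_mult power_abs suminf_mult summable_mult)
    then show "(\<lambda>m. norm (infsum (\<lambda>n. norm (case (m, n) of (m, n) \<Rightarrow> r ^ m * r ^ n)) UNIV)) summable_on UNIV"
      using r by (intro norm_summable_imp_summable_on) (simp add: abs_mult power_abs summable_mult2)
  qed
  have "(\<lambda>p. norm (case p of (m, n) \<Rightarrow> f m n)) summable_on (UNIV \<times> UNIV)"
    by (rule Infinite_Sum.abs_summable_on_comparison_test[OF g]) (use f r in \<open>auto intro: order_trans[OF _ abs_ge_self]\<close>)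
  then have "(\<lambda>(m, n). f m n) summable_on (UNIV \<times> UNIV)" by (rule Infinite_Sum.abs_summable_summable)
  from infsum_swap_banach[OF this] show ?thesis
    by (simp add: infsum_eq_suminf s1 s2 o1 o2)
qed

lemma sinh_add_ge:
  fixes a b :: real assumes "b \<ge> 0"
  shows "sinh (a + b) \<ge> exp b * sinh a"
proof -
  have le: "exp (- (a + b)) \<le> exp (b + - a)" using assms by simp
  have e1: "exp b * sinh a = (exp (a + b) - exp (b + - a)) / 2"
    unfolding sinh_field_def exp_add by (simp add: algebra_simps)
  have e2: "sinh (a + b) = (exp (a + b) - exp (- (a + b))) / 2" by (rule sinh_field_def)
  show ?thesis unfolding e1 e2 by (intro divide_right_mono diff_left_mono le) simp
qed

lemma inverse_sinh_le:
  fixes c :: real assumes "c > 0"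
  shows "1 / sinh (real (Suc n) * c) \<le> (1 / sinh c) * exp (- c) ^ n"
proof -
  have "exp (real n * c) * sinh c \<le> sinh (c + real n * c)" using assms by (intro sinh_add_ge) auto
  also have "c + real n * c = real (Suc n) * c" by (simp add: distrib_right)
  finally have "1 / sinh (real (Suc n) * c) \<le> 1 / (exp (real n * c) * sinh c)"
    using assms by (intro divide_left_mono) auto
  also have "\<dots> = (1 / sinh c) * exp (- c) ^ n"
    unfolding exp_of_nat_mult exp_minus power_inverse by (simp add: divide_inverse mult.commute)
  finally show ?thesis .
qed

lemma summable_inverse_sinh:
  fixes c :: real assumes c: "c > 0"
  shows "summable (\<lambda>n. 1 / sinh (real (Suc n) * c))"
proof (rule summable_comparison_test'[of "\<lambda>n. (1 / sinh c) * exp (- c) ^ n" 0])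
  show "summable (\<lambda>n. (1 / sinh c) * exp (- c) ^ n)"
    using c by (intro summable_mult summable_geometric) auto
  show "norm (1 / sinh (real (Suc n) * c)) \<le> (1 / sinh c) * exp (- c) ^ n" for n
    using inverse_sinh_le[OF c, of n] c by simp
qed

lemma nZ_fourier_series:
  assumes l: "l > 0"
  shows "nZ l (of_real x) = of_real (l / pi) *
    (\<Sum>n. exp (- \<i> * of_real x * of_real (real (Suc n) * l)) / of_real (2 * sinh (real (Suc n) * (l / 2))))"
proof -
  define w where "w m = (of_nat m + 1 / 2 + \<i> * of_real x) * complex_of_real l" for m
  \<comment> \<open>\<open>1 / (exp w - 1)\<close> expands as the sum of
    \<open>exp (- k * w)\<close> over \<open>k \<ge> 1\<close>, hence the exponent
    \<open>Suc n\<close>. For real \<open>x\<close> the real part of \<open>w m\<close> is positive,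
    since all poles lie above the real axis.\<close>
  define a where "a m n = exp (- w m) ^ Suc n" for m n
  have q: "norm (exp (- w m)) = exp (- ((of_nat m + 1 / 2) * l))" for m
    by (simp add: w_def norm_exp_eq_Re)
  have q1: "norm (exp (- w m)) < 1" for m
    unfolding q using l by (simp add: add_pos_nonneg mult_pos_pos)
  have term_m: "nZ_term l (of_real x) m = (\<Sum>n. a m n)" for m
  proof -
    have ne: "exp (w m) \<noteq> 1"
    proof
      assume "exp (w m) = 1"
      then have "exp (- w m) = 1" by (simp add: exp_minus)
      then show False using q1[of m] by simp
    qed
    have "(\<lambda>n. exp (- w m) * exp (- w m) ^ n) sums (exp (- w m) * (1 / (1 - exp (- w m))))"
      by (intro sums_mult geometric_sums q1)
    moreover have "exp (- w m) * (1 / (1 - exp (- w m))) = inverse (exp (w m) - 1)"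
      using ne by (simp add: exp_minus field_simps)
    ultimately show ?thesis unfolding a_def nZ_term_def w_def[symmetric] by (simp add: sums_iff)
  qed
  have sum_m: "(\<Sum>m. a m n) = exp (- \<i> * of_real x * of_real (real (Suc n) * l)) / of_real (2 * sinh (real (Suc n) * (l / 2)))" for n
  proof -
    define y where "y = real (Suc n) * (l / 2)"
    have y: "y > 0" using l by (simp add: y_def)
    define E where "E = exp (- \<i> * of_real x * of_real (real (Suc n) * l))"
    have "a m n = (E * of_real (exp (- y))) * of_real (exp (- (2 * y))) ^ m" for m
    proof -
      have "of_nat (Suc n) * (- w m) = - \<i> * of_real x * of_real (real (Suc n) * l) + of_real (- y) + of_nat m * of_real (- (2 * y))"
        by (simp add: w_def y_def algebra_simps)
      then show ?thesis
        unfolding a_def E_def exp_of_nat_mult[symmetric] exp_of_real[symmetric] exp_add[symmetric] by simp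
    qed
    moreover have "(\<lambda>m. complex_of_real (exp (- (2 * y))) ^ m) sums (1 / (1 - complex_of_real (exp (- (2 * y)))))"
      by (rule geometric_sums) (use y in \<open>simp only: norm_of_real, simp\<close>)
    ultimately have sm: "(\<lambda>m. a m n) sums ((E * of_real (exp (- y))) * (1 / (1 - of_real (exp (- (2 * y))))))"
      by (simp only: sums_mult)
    have e1: "(E * of_real (exp (- y))) * (1 / (1 - of_real (exp (- (2 * y))))) = E * of_real (exp (- y) / (1 - exp (- (2 * y))))"
      by simp
    have e2: "exp (- y) / (1 - exp (- (2 * y))) = 1 / (2 * sinh y)"
    proof -
      have "exp (- (2 * y)) = exp (- y) * exp (- y)" by (simp flip: exp_add)
      moreover have "exp y * exp (- y) = 1" by (simp flip: exp_add)
      moreover have "exp (- y) < 1" using y by simp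
      moreover have "exp (- y) * exp (- y) < 1" using y by (simp flip: exp_add)
      ultimately show ?thesis using y by (simp add: sinh_field_def frac_eq_eq algebra_simps)
    qed
    have "(\<Sum>m. a m n) = E * of_real (1 / (2 * sinh y))"
      using sums_unique[OF sm] unfolding e1 e2 by (rule sym)
    then show ?thesis unfolding E_def[symmetric] y_def[symmetric] by simp
  qed
  have bound: "norm (a m n) \<le> exp (- (l / 2)) ^ m * exp (- (l / 2)) ^ n" for m n
  proof -
    have "norm (a m n) = exp (real (Suc n) * - ((of_nat m + 1 / 2) * l))"
      unfolding a_def norm_power q exp_of_nat_mult ..
    also have "\<dots> \<le> exp (real m * - (l / 2) + real n * - (l / 2))"
    proof (subst exp_le_cancel_iff)
      \<comment> \<open>The expansion
        \<open>(n + 1) * (m + 1/2) = m/2 + n/2 + (n * m + m/2 + 1/2)\<close> decouples the two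
        indices.\<close>
      have "real (Suc n) * - ((of_nat m + 1 / 2) * l) = (real m * - (l / 2) + real n * - (l / 2)) - (real n * real m + real m / 2 + 1 / 2) * l"
        by (simp add: algebra_simps)
      moreover have "(real n * real m + real m / 2 + 1 / 2) * l \<ge> 0" using l by simp
      ultimately show "real (Suc n) * - ((of_nat m + 1 / 2) * l) \<le> real m * - (l / 2) + real n * - (l / 2)" by linarith
    qed
    also have "\<dots> = exp (- (l / 2)) ^ m * exp (- (l / 2)) ^ n" by (simp only: exp_add exp_of_nat_mult)
    finally show ?thesis .
  qed
  have "(\<Sum>m. nZ_term l (of_real x) m) = (\<Sum>n. \<Sum>m. a m n)"
    unfolding term_m by (rule suminf_swap_geometric[where r = "exp (- (l / 2))"]) (use l bound in auto)
  then show ?thesis unfolding nZ_def sum_m by simp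
qed

section \<open>Termwise integration of the spectral side\<close>

context test_function
begin

lemma
  assumes l: "l > 0"
  shows integrable_h_nZ: "integrable lborel (\<lambda>x. h (of_real x) * nZ l (of_real x))"
    and integral_h_nZ: "(LBINT x. h (of_real x) * nZ l (of_real x)) =
      (\<Sum>n. of_real (l / pi / (2 * sinh (real (Suc n) * (l / 2)))) * H.ft (real (Suc n) * l))"
proof -
  define s where "s n = l / pi / (2 * sinh (real (Suc n) * (l / 2)))" for n
  have s0: "s n \<ge> 0" for n using l by (simp add: s_def)
  define F where "F n x = of_real (s n) * (h (of_real x) * exp (- \<i> * of_real x * of_real (real (Suc n) * l)))" for n and x :: real
  have "summable (\<lambda>n. l / pi / 2 * (1 / sinh (real (Suc n) * (l / 2))))"
    using l by (intro summable_mult summable_inverse_sinh) auto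
  moreover have "s = (\<lambda>n. l / pi / 2 * (1 / sinh (real (Suc n) * (l / 2))))"
    by (simp add: s_def fun_eq_iff)
  ultimately have ss: "summable s" by (simp only:)
  \<comment> \<open>The oscillating factor has modulus 1 on the real line, so \<open>cmod h\<close>
    times the summable coefficients dominates both the pointwise series and the series of
    integrals.\<close>
  have Fn: "norm (F n x) = s n * norm (h (of_real x))" for n x
    using s0[of n] by (simp add: F_def norm_mult norm_exp_eq_Re)
  have Fi: "integrable lborel (F n)" for n
    unfolding F_def using H.line_integrable[of 0 "real (Suc n) * l"] \<sigma>_pos
    by (intro integrable_mult_right) (simp add: complex_of_real_def)
  have AEs: "AE x in lborel. summable (\<lambda>n. norm (F n x))"
    unfolding Fn using ss by (intro AE_I2 summable_mult2)
  have Is: "summable (\<lambda>n. LBINT x. norm (F n x))"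
    unfolding Fn using ss by (simp add: summable_mult2)
  have eq: "h (of_real x) * nZ l (of_real x) = (\<Sum>n. F n x)" for x :: real
  proof -
    let ?c = "h (of_real x) * of_real (l / pi)"
    let ?e = "\<lambda>n. exp (- \<i> * of_real x * of_real (real (Suc n) * l)) / of_real (2 * sinh (real (Suc n) * (l / 2)))"
    have "F n x = ?c * ?e n" for n by (simp add: F_def s_def mult_ac)
    moreover have "summable ?e"
    proof (rule summable_norm_cancel, rule summable_comparison_test'[of "\<lambda>n. 1 / sinh (real (Suc n) * (l / 2))" 0])
      show "summable (\<lambda>n. 1 / sinh (real (Suc n) * (l / 2)))" using l by (intro summable_inverse_sinh) simp
      show "norm (norm (?e n)) \<le> 1 / sinh (real (Suc n) * (l / 2))" for n
      proof -
        have "sinh (real (Suc n) * (l / 2)) > 0" using l by simp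
        then show ?thesis by (simp add: norm_divide norm_mult norm_exp_eq_Re field_simps)
      qed
    qed
    ultimately have "(\<Sum>n. F n x) = ?c * (\<Sum>n. ?e n)" by (simp only: suminf_mult)
    then show ?thesis unfolding nZ_fourier_series[OF l] by (simp only: mult_ac)
  qed
  show "integrable lborel (\<lambda>x. h (of_real x) * nZ l (of_real x))"
    unfolding eq by (rule integrable_suminf[OF Fi AEs Is])
  have "(LBINT x. h (of_real x) * nZ l (of_real x)) = (\<Sum>n. LBINT x. F n x)"
    unfolding eq by (rule integral_suminf[OF Fi AEs Is])
  also have "\<dots> = (\<Sum>n. of_real (s n) * H.ft (real (Suc n) * l))"
    unfolding F_def H.ft_def by (simp only: integral_mult_right_zero)
  finally show "(LBINT x. h (of_real x) * nZ l (of_real x)) =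
      (\<Sum>n. of_real (l / pi / (2 * sinh (real (Suc n) * (l / 2)))) * H.ft (real (Suc n) * l))"
    by (simp only: s_def)
qed

end

section \<open>The geometric side: summation over the powers of the isometry\<close>

lemma sinh_ge_half_cosh:
  fixes x :: real assumes "x \<ge> 0" "cosh x \<ge> 2"
  shows "sinh x \<ge> cosh x / 2"
proof -
  have "cosh x - sinh x = exp (- x)" by (rule cosh_minus_sinh)
  moreover have "exp (- x) \<le> 1" using assms by simp
  ultimately show ?thesis using assms by linarith
qed

locale cyclic_trace = scaling_conjugate \<gamma> M N l + test_function h \<sigma> \<delta> C
  for \<gamma> M N l h \<sigma> \<delta> C
begin

lemma hdist_T: "z \<in> hplane \<Longrightarrow> w \<in> hplane \<Longrightarrow> hdist (T n z) w = hdist (of_real (exp (of_int n * l)) * M z) (M w)"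
  using real_moebius_hdist[OF M T_in, of z w n] by (simp add: M_T)

lemma hdist_T_self:
  assumes z: "z \<in> hplane"
  shows "hdist (T n z) z = arcosh (cosh (of_int n * l) + (cosh (of_int n * l) - 1) * (slope z)\<^sup>2)"
proof -
  define E x y where "E = exp (of_int n * l)" and "x = Re (M z)" and "y = Im (M z)"
  have y: "y > 0" using real_moebius_in[OF M z] by (simp add: y_def hplane_def)
  have E: "E > 0" by (simp add: E_def)
  have c: "cosh (of_int n * l) = (E + 1 / E) / 2" unfolding E_def cosh_field_def exp_minus inverse_eq_divide ..
  have "(cmod (of_real E * M z - M z))\<^sup>2 = (E - 1)\<^sup>2 * (x\<^sup>2 + y\<^sup>2)"
  proof -
    have "of_real E * M z - M z = of_real (E - 1) * M z" by (simp add: algebra_simps)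
    then have "(cmod (of_real E * M z - M z))\<^sup>2 = (E - 1)\<^sup>2 * (cmod (M z))\<^sup>2"
      by (simp only: norm_mult norm_of_real power_mult_distrib power2_abs)
    then show ?thesis by (simp add: cmod_power2 x_def y_def)
  qed
  then have "hdist (of_real E * M z) (M z) = arcosh (1 + (E - 1)\<^sup>2 * (x\<^sup>2 + y\<^sup>2) / (2 * (E * y) * y))"
    by (simp add: hdist_def y_def)
  then have "hdist (T n z) z = arcosh (1 + (E - 1)\<^sup>2 * (x\<^sup>2 + y\<^sup>2) / (2 * (E * y) * y))"
    by (simp only: hdist_T[OF z z] E_def)
  also have "1 + (E - 1)\<^sup>2 * (x\<^sup>2 + y\<^sup>2) / (2 * (E * y) * y) =
      (E + 1 / E) / 2 + ((E + 1 / E) / 2 - 1) * (x / y)\<^sup>2"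
    using y E by (simp add: field_simps power2_eq_square)
  finally show ?thesis by (simp add: c slope_def x_def y_def)
qed

text \<open>Imaginary parts alone suffice: with height ratio \<open>q = E * y / v\<close> one has
  \<open>cosh d \<ge> (q + 1 / q) / 2\<close>, and \<open>q\<close> is multiplied by
  \<open>exp l\<close> at each step. Positive powers are controlled by \<open>q\<close>, negative
  ones by \<open>1 / q\<close>.\<close>

lemma cosh_hdist_T_ge:
  assumes z: "z \<in> hplane" and w: "w \<in> hplane"
  obtains m where "m > 0" "\<And>j. m * exp (of_int \<bar>j\<bar> * l) \<le> cosh (hdist (T j z) w)"
proof -
  define y v where "y = Im (M z)" and "v = Im (M w)"
  have yv: "y > 0" "v > 0"
    using real_moebius_in[OF M z] real_moebius_in[OF M w] by (simp_all add: y_def v_def hplane_def)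
  define m0 where "m0 = min (y / v) (v / y)"
  have m0: "m0 \<le> y / v" "m0 \<le> v / y" "m0 > 0" using yv by (auto simp: m0_def)
  show ?thesis
  proof
    show "m0 / 2 > 0" using m0(3) by simp
    fix j :: int
    define E where "E = exp (of_int j * l)"
    have E: "E > 0" by (simp add: E_def)
    have Eh: "of_real E * M z \<in> hplane" using real_moebius_in[OF M z] E by (simp add: hplane_def)
    have "Im (of_real E * M z - M w) = E * y - v" by (simp add: y_def v_def)
    then have "(E * y - v)\<^sup>2 \<le> (cmod (of_real E * M z - M w))\<^sup>2"
      using abs_Im_le_cmod[of "of_real E * M z - M w"] by (metis abs_ge_zero power2_abs power_mono)
    then have "1 + (E * y - v)\<^sup>2 / (2 * (E * y) * v) \<le> cosh (hdist (T j z) w)"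
      unfolding hdist_T[OF z w] E_def[symmetric] cosh_hdist[OF Eh real_moebius_in[OF M w]]
      using E yv by (simp add: y_def[symmetric] v_def[symmetric] divide_right_mono)
    moreover have "1 + (E * y - v)\<^sup>2 / (2 * (E * y) * v) = (E * (y / v) + (1 / E) * (v / y)) / 2"
      using E yv by (simp add: field_simps power2_eq_square)
    moreover have "m0 * exp (of_int \<bar>j\<bar> * l) \<le> E * (y / v) + (1 / E) * (v / y)"
    proof (cases "j \<ge> 0")
      case True
      then have "m0 * exp (of_int \<bar>j\<bar> * l) = m0 * E" by (simp add: E_def)
      also have "\<dots> \<le> (y / v) * E" using E by (intro mult_right_mono m0) auto
      also have "(y / v) * E = E * (y / v)" by (rule mult.commute)
      finally have "m0 * exp (of_int \<bar>j\<bar> * l) \<le> E * (y / v)" .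
      moreover have "(1 / E) * (v / y) \<ge> 0" using E yv by simp
      ultimately show ?thesis by linarith
    next
      case False
      then have "of_int \<bar>j\<bar> * l = - (of_int j * l)" by simp
      then have "exp (of_int \<bar>j\<bar> * l) = 1 / E" unfolding E_def by (simp only: exp_minus inverse_eq_divide)
      then have "m0 * exp (of_int \<bar>j\<bar> * l) = m0 * (1 / E)" by simp
      also have "\<dots> \<le> (v / y) * (1 / E)" using E by (intro mult_right_mono m0) auto
      also have "(v / y) * (1 / E) = (1 / E) * (v / y)" by (rule mult.commute)
      finally have "m0 * exp (of_int \<bar>j\<bar> * l) \<le> (1 / E) * (v / y)" .
      moreover have "E * (y / v) \<ge> 0" using E yv by simp
      ultimately show ?thesis by linarith
    qed
    moreover have "m0 / 2 * exp (of_int \<bar>j\<bar> * l) = (m0 * exp (of_int \<bar>j\<bar> * l)) / 2"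
      by simp
    moreover have "a \<le> c" if "q \<le> c" "q = s / 2" "p \<le> s" "a = p / 2" for a c p q s :: real
      using that by linarith
    ultimately show "m0 / 2 * exp (of_int \<bar>j\<bar> * l) \<le> cosh (hdist (T j z) w)" by blast
  qed
qed

text \<open>The sequence \<open>j\<close> stands for either half of the nonzero integers. The orbit
  of \<open>z\<close> may pass through \<open>w\<close>, where the diagonal value is used, but it
  leaves every bounded region; so the estimate is only needed for large \<open>n\<close>.\<close>

lemma summable_norm_point_pair:
  assumes z: "z \<in> hplane" and w: "w \<in> hplane" and j: "\<And>n. \<bar>j n\<bar> = int (Suc n)"
  shows "summable (\<lambda>n. norm (point_pair h (isom_power \<gamma> (j n) z) w))"
proof -
  obtain B where B: "B \<ge> 0" "\<And>\<tau>. \<tau> > 0 \<Longrightarrow> cmod (c0 * abel P.ft \<tau>) \<le> B / sqrt (sinh \<tau>)"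
    using abel_P_bound by blast
  obtain m where m: "m > 0" "\<And>j. m * exp (of_int \<bar>j\<bar> * l) \<le> cosh (hdist (T j z) w)"
    using cosh_hdist_T_ge[OF z w] by blast
  \<comment> \<open>\<open>sinh\<close> of the distance grows at least like a multiple of
    \<open>exp (n * l)\<close>, and it enters the bound under a square root.\<close>
  define r where "r = sqrt (exp (- l))"
  have r: "0 \<le> r" "r < 1" using l_pos by (auto simp: r_def)
  have "filterlim (\<lambda>n. m * exp (real (Suc n) * l)) at_top sequentially"
  proof -
    have "filterlim (\<lambda>x. m * exp ((x + 1) * l)) at_top at_top" using m(1) l_pos by real_asymp
    from filterlim_compose[OF this filterlim_real_sequentially] show ?thesis by (simp add: add.commute)
  qed
  \<comment> \<open>The threshold 2 serves twice: it separates the translate from \<open>w\<close>,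
    whose distance to itself has \<open>cosh\<close> equal to 1, and it allows \<open>cosh\<close>
    to be replaced by \<open>sinh\<close> at the cost of a factor 2.\<close>
  then have "\<forall>\<^sub>F n in sequentially. m * exp (real (Suc n) * l) \<ge> 2"
    by (simp add: filterlim_at_top)
  then have "\<forall>\<^sub>F n in sequentially. norm (norm (point_pair h (isom_power \<gamma> (j n) z) w)) \<le> B * sqrt (2 / m) * r * r ^ n"
  proof eventually_elim
    case (elim n)
    let ?\<tau> = "hdist (T (j n) z) w" and ?X = "m * exp (real (Suc n) * l)"
    have c: "?X \<le> cosh ?\<tau>" using m(2)[of "j n"] by (simp add: j)
    then have c2: "cosh ?\<tau> \<ge> 2" using elim by linarith
    have ne: "T (j n) z \<noteq> w"
    proof
      assume "T (j n) z = w"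
      then have "cosh ?\<tau> = 1" using cosh_hdist[OF w w] by simp
      with c2 show False by simp
    qed
    have \<tau>: "?\<tau> > 0" by (rule hdist_pos[OF T_in[OF z] w ne])
    have "?X / 2 \<le> sinh ?\<tau>" using sinh_ge_half_cosh[of ?\<tau>] \<tau> c c2 by linarith
    then have "B / sqrt (sinh ?\<tau>) \<le> B / sqrt (?X / 2)"
      using B(1) m(1) \<tau> by (intro divide_left_mono mult_pos_pos) auto
    moreover have "1 / sqrt (?X / 2) = sqrt (2 / m) * r * r ^ n"
    proof -
      have "?X / 2 = 1 / (2 / m * exp (- l) ^ Suc n)"
        using m(1) by (simp only: exp_of_nat_mult exp_minus power_inverse) (simp add: field_simps)
      then show ?thesis by (simp add: real_sqrt_divide real_sqrt_mult real_sqrt_power r_def)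
    qed
    ultimately have "B / sqrt (sinh ?\<tau>) \<le> B * sqrt (2 / m) * r * r ^ n"
      by (metis mult.assoc times_divide_eq_right mult.right_neutral)
    then show ?case
      using B(2)[OF \<tau>] by (simp add: isom_power_apply[OF z] point_pair_eq_abel[OF T_in[OF z] w ne])
  qed
  moreover have "summable (\<lambda>n. B * sqrt (2 / m) * r * r ^ n)"
    using r by (intro summable_mult summable_geometric) auto
  ultimately show ?thesis by (rule summable_comparison_test_ev)
qed

lemma point_pair_summable_on:
  "z \<in> hplane \<Longrightarrow> w \<in> hplane \<Longrightarrow> (\<lambda>n. point_pair h (isom_power \<gamma> n z) w) summable_on UNIV"
  by (intro summable_on_int summable_norm_point_pair) auto

text \<open>The common contribution of the powers \<open>n + 1\<close> and \<open>- (n + 1)\<close>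
  of \<open>\<gamma>\<close>, as a function of the slope.\<close>

definition k :: "nat \<Rightarrow> real \<Rightarrow> complex" where
  "k n u = c0 * abel P.ft (arcosh (cosh (real (Suc n) * l) + (cosh (real (Suc n) * l) - 1) * u\<^sup>2))"

lemma point_pair_k:
  assumes z: "z \<in> hplane" and j: "\<bar>j\<bar> = int (Suc n)"
  shows "point_pair h (isom_power \<gamma> j z) z = k n (slope z)"
proof -
  have "T j z \<noteq> z" using T_eqD[OF z, of j 0] j by (auto simp: T_0 z)
  then have "point_pair h (isom_power \<gamma> j z) z = c0 * abel P.ft (hdist (T j z) z)"
    using z T_in[OF z] by (simp add: isom_power_apply point_pair_eq_abel)
  moreover have "cosh (of_int j * l) = cosh (real (Suc n) * l)"
  proof -
    have "j = int (Suc n) \<or> j = - int (Suc n)" using j by linarith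
    then show ?thesis
    proof
      assume j: "j = - int (Suc n)"
      have "of_int j * l = - (real (Suc n) * l)" unfolding j by (simp add: algebra_simps)
      then show ?thesis by (simp only: cosh_minus)
    qed simp
  qed
  ultimately show ?thesis by (simp add: k_def hdist_T_self[OF z])
qed

lemma point_pair_cyclic_diff:
  assumes z: "z \<in> hplane"
  shows "point_pair_cyclic \<gamma> h z z - point_pair h z z = 2 * (\<Sum>n. k n (slope z))"
proof -
  have "point_pair_cyclic \<gamma> h z z = point_pair h (isom_power \<gamma> 0 z) z +
      ((\<Sum>n. point_pair h (isom_power \<gamma> (int (Suc n)) z) z) + (\<Sum>n. point_pair h (isom_power \<gamma> (- int (Suc n)) z) z))"
    unfolding point_pair_cyclic_def by (rule infsum_int) (intro summable_norm_point_pair z; simp)+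
  moreover have "point_pair h (isom_power \<gamma> (int (Suc n)) z) z = k n (slope z)"
    "point_pair h (isom_power \<gamma> (- int (Suc n)) z) z = k n (slope z)" for n
    by (intro point_pair_k z; simp)+
  ultimately show ?thesis by (simp only:) (simp add: isom_power_apply z T_0)
qed

text \<open>Sum and integral may be exchanged because the norm integrals are bounded by a constant
  over \<open>sinh ((n + 1) * l / 2)\<close>. Pointwise convergence is separate and comes from the
  decay of the point-pair invariant in the distance.\<close>

lemma
  shows k_series_integrable: "integrable lborel (\<lambda>u. 2 * (\<Sum>n. k n u))"
    and k_series_integral: "of_real l * (LBINT u. 2 * (\<Sum>n. k n u)) = (LBINT x. h (of_real x) * nZ l (of_real x))"
proof -
  define s where "s n = sinh (real (Suc n) * (l / 2))" for n
  have s: "s n > 0" for n using l_pos by (simp add: s_def)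
  define \<kappa> where "\<kappa> n = cosh (real (Suc n) * l) - 1" for n
  \<comment> \<open>The double-angle formula; it produces the \<open>sinh\<close> of the half-length
    that occurs in the expansion of \<open>nZ\<close>.\<close>
  have "\<kappa> n = 2 * (s n)\<^sup>2" for n
    using cosh_double[of "real (Suc n) * (l / 2)"] cosh_square_eq[of "real (Suc n) * (l / 2)"]
    by (simp add: \<kappa>_def s_def)
  then have \<kappa>: "\<kappa> n > 0" "sqrt (\<kappa> n) = sqrt 2 * s n" for n using s[of n] by (simp_all add: real_sqrt_mult)
  have x: "real (Suc n) * l > 0" for n using l_pos by simp
  note A = x \<kappa>(1) P.ft_measurable P.ft_set_integrable
  have ki: "integrable lborel (k n)" for n
    unfolding k_def[abs_def] \<kappa>_def[symmetric] by (intro integrable_mult_right abel_integrable[OF A])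
  have kI: "(LBINT u. k n u) = of_real (1 / (4 * pi * s n)) * H.ft (real (Suc n) * l)" for n
  proof -
    have "(LBINT u. k n u) = c0 * (of_real (pi / sqrt (\<kappa> n)) * (- \<i> * H.ft (real (Suc n) * l)))"
      unfolding k_def \<kappa>_def[symmetric]
      by (simp only: integral_mult_right_zero abel_integral[OF A] integral_P_ft)
    also have "\<dots> = (c0 * - \<i> * of_real (pi / sqrt (\<kappa> n))) * H.ft (real (Suc n) * l)" by simp
    \<comment> \<open>The \<open>\<i>\<close> in \<open>c0\<close> meets the \<open>- \<i>\<close>
      of \<open>integral_P_ft\<close>, and the two roots of 2 combine. Doubling for the two signs of
      the exponent and multiplying by \<open>l\<close> gives \<open>l / (2 * pi * s n)\<close>, the
      coefficient in \<open>integral_h_nZ\<close>.\<close>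
    also have "c0 * - \<i> * of_real (pi / sqrt (\<kappa> n)) = of_real (1 / (2 * sqrt 2 * pi\<^sup>2) * (pi / (sqrt 2 * s n)))"
      unfolding \<kappa>(2) c0_def by simp
    also have "1 / (2 * sqrt 2 * pi\<^sup>2) * (pi / (sqrt 2 * s n)) = 1 / (4 * pi * s n)"
      using s[of n] by (simp add: field_simps power2_eq_square)
    finally show ?thesis .
  qed
  define J where "J = (LBINT t:{l<..}. norm (P.ft t))"
  have kn: "(LBINT u. norm (k n u)) \<le> (cmod c0 * J * pi / sqrt 2) * (1 / s n)" for n
  proof -
    \<comment> \<open>All half-lines start at \<open>l\<close> or beyond, so a single constant
      \<open>J\<close> serves for every \<open>n\<close>.\<close>
    have JJ: "(LBINT t:{real (Suc n) * l<..}. norm (P.ft t)) \<le> J"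
      unfolding J_def set_lebesgue_integral_def
    proof (rule integral_mono)
      show "integrable lborel (\<lambda>t. indicator {a<..} t *\<^sub>R norm (P.ft t))" for a
        using integrable_norm[OF P.ft_set_integrable[unfolded set_integrable_def]] by simp
      then show "integrable lborel (\<lambda>t. indicator {a<..} t *\<^sub>R norm (P.ft t))" for a .
      have "l \<le> real (Suc n) * l" using l_pos by (simp add: algebra_simps)
      then show "indicator {real (Suc n) * l<..} t *\<^sub>R norm (P.ft t) \<le> indicator {l<..} t *\<^sub>R norm (P.ft t)" for t
        by (auto split: split_indicator)
    qed
    have "(LBINT u. norm (k n u)) \<le> cmod c0 * (pi / sqrt (\<kappa> n) * (LBINT t:{real (Suc n) * l<..}. norm (P.ft t)))"
      unfolding k_def \<kappa>_def[symmetric] norm_mult integral_mult_right_zero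
      by (intro mult_left_mono abel_norm_integral[OF A]) simp
    also have "\<dots> \<le> cmod c0 * (pi / sqrt (\<kappa> n) * J)"
      using \<kappa>(1)[of n] by (intro mult_left_mono JJ) auto
    also have "\<dots> = (cmod c0 * J * pi / sqrt 2) * (1 / s n)" by (simp add: \<kappa>(2))
    finally show ?thesis .
  qed
  have Is: "summable (\<lambda>n. LBINT u. norm (k n u))"
  proof (rule summable_comparison_test'[of "\<lambda>n. (cmod c0 * J * pi / sqrt 2) * (1 / s n)" 0])
    show "summable (\<lambda>n. (cmod c0 * J * pi / sqrt 2) * (1 / s n))"
      unfolding s_def using l_pos by (intro summable_mult summable_inverse_sinh) simp
    show "norm (LBINT u. norm (k n u)) \<le> (cmod c0 * J * pi / sqrt 2) * (1 / s n)" for n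
      using kn[of n] by (simp add: integral_nonneg_AE)
  qed
  have ks: "summable (\<lambda>n. norm (k n u))" for u
  proof -
    obtain B where B: "B \<ge> 0" "\<And>\<tau>. \<tau> > 0 \<Longrightarrow> cmod (c0 * abel P.ft \<tau>) \<le> B / sqrt (sinh \<tau>)"
      using abel_P_bound by blast
    define r where "r = sqrt (exp (- l))"
    have r: "0 \<le> r" "r < 1" using l_pos by (auto simp: r_def)
    show ?thesis
    proof (rule summable_comparison_test'[of "\<lambda>n. B * (sqrt (1 / sinh l) * r ^ n)" 0])
      show "summable (\<lambda>n. B * (sqrt (1 / sinh l) * r ^ n))"
        using r by (intro summable_mult summable_geometric) auto
      fix n
      define \<tau> where "\<tau> = arcosh (cosh (real (Suc n) * l) + \<kappa> n * u\<^sup>2)"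
      have ge: "cosh (real (Suc n) * l) + \<kappa> n * u\<^sup>2 \<ge> cosh (real (Suc n) * l)" using \<kappa>(1)[of n] by simp
      then have ge1: "cosh (real (Suc n) * l) + \<kappa> n * u\<^sup>2 \<ge> 1" using cosh_real_ge_1[of "real (Suc n) * l"] by linarith
      have \<tau>0: "\<tau> \<ge> 0" unfolding \<tau>_def by (rule arcosh_nonneg_real[OF ge1])
      have "cosh \<tau> \<ge> cosh (real (Suc n) * l)" unfolding \<tau>_def cosh_arcosh_real[OF ge1] by (rule ge)
      then have \<tau>: "\<tau> \<ge> real (Suc n) * l" using \<tau>0 x[of n] cosh_real_nonneg_le_iff[of "real (Suc n) * l" \<tau>] by auto
      then have \<tau>p: "\<tau> > 0" using x[of n] by linarith
      have "1 / sinh \<tau> \<le> 1 / sinh (real (Suc n) * l)"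
        using \<tau> \<tau>p x[of n] by (intro divide_left_mono) auto
      also have "\<dots> \<le> (1 / sinh l) * exp (- l) ^ n" by (rule inverse_sinh_le[OF l_pos])
      finally have "sqrt (1 / sinh \<tau>) \<le> sqrt ((1 / sinh l) * exp (- l) ^ n)" by (rule real_sqrt_le_mono)
      then have "1 / sqrt (sinh \<tau>) \<le> sqrt (1 / sinh l) * r ^ n"
        by (simp only: real_sqrt_mult real_sqrt_power r_def real_sqrt_divide real_sqrt_one)
      then have "B / sqrt (sinh \<tau>) \<le> B * (sqrt (1 / sinh l) * r ^ n)"
        using mult_left_mono[OF _ B(1)] by fastforce
      then show "norm (norm (k n u)) \<le> B * (sqrt (1 / sinh l) * r ^ n)"
        using B(2)[OF \<tau>p] by (simp add: k_def \<kappa>_def \<tau>_def)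
    qed
  qed
  have AEs: "AE u in lborel. summable (\<lambda>n. norm (k n u))" using ks by simp
  show "integrable lborel (\<lambda>u. 2 * (\<Sum>n. k n u))"
    by (intro integrable_mult_right integrable_suminf ki AEs Is)
  have "of_real l * (LBINT u. 2 * (\<Sum>n. k n u)) = of_real l * (2 * (\<Sum>n. LBINT u. k n u))"
    by (simp only: integral_mult_right_zero integral_suminf[OF ki AEs Is])
  also have "\<dots> = (\<Sum>n. of_real l * (2 * (LBINT u. k n u)))"
    using summable_integral[OF ki AEs Is] by (simp add: suminf_mult summable_mult)
  also have "\<dots> = (\<Sum>n. of_real (l / pi / (2 * s n)) * H.ft (real (Suc n) * l))"
  proof -
    have "of_real l * (2 * (of_real (1 / (4 * pi * s n)) * z)) = of_real (l / pi / (2 * s n)) * z" for n and z :: complex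
      by (simp add: mult_ac)
    then show ?thesis unfolding kI by (simp only:)
  qed
  also have "\<dots> = (LBINT x. h (of_real x) * nZ l (of_real x))"
    unfolding s_def by (rule integral_h_nZ[OF l_pos, symmetric])
  finally show "of_real l * (LBINT u. 2 * (\<Sum>n. k n u)) = (LBINT x. h (of_real x) * nZ l (of_real x))" .
qed

lemma has_quotient_integral_cyclic:
  "has_quotient_integral (cyclic_isoms \<gamma>) (\<lambda>z. point_pair_cyclic \<gamma> h z z - point_pair h z z)
    (LBINT x. h (of_real x) * nZ l (of_real x))"
  using has_quotient_integral_slope[OF k_series_integrable point_pair_cyclic_diff] unfolding k_series_integral .

end

theorem proposition7:
  fixes \<gamma> h :: "complex \<Rightarrow> complex" and l \<sigma> \<delta> C :: real
  assumes "hyperbolic \<gamma>"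
    and "l = hlength \<gamma>"
    and "\<sigma> > 1 / 2"
    and "h analytic_on {\<rho>. \<bar>Im \<rho>\<bar> \<le> \<sigma>}"
    and "\<And>\<rho>. \<bar>Im \<rho>\<bar> \<le> \<sigma> \<Longrightarrow> h (- \<rho>) = h \<rho>"
    and "\<delta> > 0" and "C > 0"
    and "\<And>\<rho>. \<bar>Im \<rho>\<bar> \<le> \<sigma> \<Longrightarrow> cmod (h \<rho>) \<le> C * (1 + \<bar>Re \<rho>\<bar>) powr (- 2 - \<delta>)"
  shows "(\<forall>z\<in>hplane. \<forall>w\<in>hplane. (\<lambda>n. point_pair h (isom_power \<gamma> n z) w) summable_on UNIV) \<and>
    integrable lborel (\<lambda>\<rho>. h (complex_of_real \<rho>) * nZ l (complex_of_real \<rho>)) \<and>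
    has_quotient_integral (cyclic_isoms \<gamma>)
      (\<lambda>z. point_pair_cyclic \<gamma> h z z - point_pair h z z)
      (LBINT \<rho>. h (complex_of_real \<rho>) * nZ l (complex_of_real \<rho>)) \<and>
    (\<forall>\<rho>. (\<nexists>\<nu> m. \<rho> = nZ_pole l \<nu> m) \<longrightarrow> summable (nZ_term l \<rho>)) \<and>
    nZ l meromorphic_on UNIV \<and>
    nZ l analytic_on - {nZ_pole l \<nu> m | \<nu> m. True} \<and>
    (\<forall>\<nu> m. is_pole (nZ l) (nZ_pole l \<nu> m) \<and> zorder (nZ l) (nZ_pole l \<nu> m) = - 1 \<and>
       residue (nZ l) (nZ_pole l \<nu> m) = 1 / (pi * \<i>))"
proof -
  have l: "l > 0" using assms(1,2) by (simp add: hyperbolic_def)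
  obtain M N where MN: "real_moebius M" "real_moebius N"
    "\<And>z. z \<in> hplane \<Longrightarrow> N (M z) = z" "\<And>z. z \<in> hplane \<Longrightarrow> M (N z) = z"
    "\<And>z. z \<in> hplane \<Longrightarrow> \<gamma> z = N (of_real (exp l) * M z)"
    using hyperbolic_conjugate_scaling[OF assms(1)] unfolding assms(2) by blast
  interpret cyclic_trace \<gamma> M N l h \<sigma> \<delta> C
  proof
    show "\<gamma> \<in> Bij hplane" using assms(1) by (simp add: hyperbolic_def hisometry_def)
    show "h holomorphic_on {z. \<bar>Im z\<bar> < \<sigma>}"
      by (rule holomorphic_on_subset[OF analytic_imp_holomorphic[OF assms(4)]]) auto
  qed (use assms(3,6,8) l MN in auto)
  show ?thesis
    by (intro conjI ballI allI impI point_pair_summable_on integrable_h_nZ has_quotient_integral_cyclic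
        summable_nZ_term nZ_meromorphic nZ_analytic nZ_is_pole nZ_zorder nZ_residue l; assumption)
qed

end
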